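(* Let $(E_k)_{k\ge1}$ be i.i.d. exponentially distributed random variables with parameter $1$. Let $\theta\in\mathbb{R}$ with $\theta\ne1$, $\xi\in[0,1]$ and $\Omega\in\{\mathbb{R},\mathbb{R}_{<0}\}$, and assume that $(\theta,\xi,\Omega)$ belongs to one of the regimes (i)-(v) below. Let $p'$ be the Markov kernel on $\Omega$ $$p'(x_1,\mathrm{d}x_2)=\mathbf{1}_{\{x_2>\theta x_1\}}\frac{h(x_2)}{h(x_1)}\frac1\lambda\phi_\xi(x_2)\,\mathrm{d}x_2,\qquad x_1,x_2\in\Omega,$$ with $\lambda$ and $h$ given for the respective regime in the context. Then $p'$ admits a unique invariant probability measure $\pi$ on $\Omega$, given explicitly as follows. (i) If $0<\theta<1$, $\xi\in[0,1)$ and $\Omega=\mathbb{R}$, then $\pi(\mathrm{d}x)=\mathbb{P}\left((1-\theta)\sum_{k=0}^\infty\theta^kE_{k+1}\in\mathrm{d}x\right)$. (ii) If $\theta>1$, $\xi\in(0,1]$ and $\Omega=\mathbb{R}_{<0}$, then $\pi(\mathrm{d}x)=\mathbb{P}\left(-(1-\theta^{-1})\sum_{k=0}^\infty\theta^{-k}E_{k+1}\in\mathrm{d}x\right)$. (iii) If $\theta<0$, $\xi\in(0,1)$ and $\Omega=\mathbb{R}$, then, with $a:=\arctan_{-\theta}\left(\sqrt{\frac{\xi}{1-\xi}}\right)$, $$\pi(\mathrm{d}x)=\frac1b\begin{cases}e^{-x}\cos_{-\theta}(a,-x)\cos_{-\theta^{-1}}(a,-x)\,\mathrm{d}x, & x>0,\\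 e^{x}\sin_{-\theta}(a,x)\sin_{-\theta^{-1}}(a,x)\,\mathrm{d}x, & x\le0,\end{cases}$$ where $b:=\int_0^\infty e^{-x}\cos_{-\theta}(a,-x)\cos_{-\theta^{-1}}(a,-x)\,\mathrm{d}x+\int_{-\infty}^0e^x\sin_{-\theta}(a,x)\sin_{-\theta^{-1}}(a,x)\,\mathrm{d}x$. (iv) If $\theta<0$, $\xi=0$ and $\Omega=\mathbb{R}$, then $\pi(\mathrm{d}x)=\mathbb{P}(E_1\in\mathrm{d}x)$. (v) If $\theta=0$, $\xi\in[0,1)$ and $\Omega=\mathbb{R}$, then $\pi(\mathrm{d}x)=\mathbb{P}(E_1\in\mathrm{d}x)$.
   Context: For $\xi\in[0,1]$ let $\phi_\xi(x)=\xi e^{x}$ for $x<0$ and $\phi_\xi(x)=(1-\xi)e^{-x}$ for $x>0$ (a probability density on $\mathbb{R}$). The pairs $(\lambda,h)$ are: (i) $\lambda=(1-\xi)(1-\theta)$; $h(x)=e^{\frac{\theta}{\theta-1}x}$ for $x>0$ and $h(x)=e^{\frac{\theta x}{1-\theta}}\sum_{m\ge0}\frac{(-\frac{\theta x}{1-\theta})^m}{m!}\left(\frac{-\xi}{\lambda}(1-\theta);\theta\right)_m$ for $x\le0$. (ii) $\lambda=(1-\frac1\theta)\xi$; $h(x)=0$ for $x>0$ and $h(x)=e_\theta\left(\frac{1-\xi}{\lambda}\right)\sum_{j\ge0}\frac{(-\xi/\lambda)^j}{[j]_\theta!}e^{\frac{\theta(1-\theta^j)}{1-\theta}x}$ for $x\le0$.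 (iii) $\lambda=\sqrt{\xi(1-\xi)}/a$ with $a=\arctan_{-\theta}(\sqrt{\xi/(1-\xi)})$; $h(x)=\cos_{-\theta}(a,-x)$ for $x>0$ and $h(x)=\frac{\sqrt{1-\xi}}{\sqrt\xi}\sin_{-\theta}(a,x)$ for $x\le0$. (iv) $\lambda=1$; $h(x)=1$ for $x\ge0$ and $h(x)=e^{-\theta x}$ for $x<0$. (v) $\lambda=1-\xi$; $h\equiv1$. $q$-notation. $(a;q)_n=\prod_{k=0}^{n-1}(1-aq^k)$. For $q>0$, $q\ne1$: $[k]_q=\frac{1-q^k}{1-q}$, $[n]_q!=\prod_{k=1}^n[k]_q$, and $[n]_1!=n!$. Define $e_q(z)=\sum_{n\ge0}\frac{z^n}{[n]_q!}$, $\cos_q(z)=\sum_{n\ge0}\frac{(-1)^nz^{2n}}{[2n]_q!}$, $\sin_q(z)=\sum_{n\ge0}\frac{(-1)^nz^{2n+1}}{[2n+1]_q!}$. For $q\ge1$ these are entire. For $0<q<1$ the series converge for $|z|<1/(1-q)$, and the same symbols denote the meromorphic continuations to $\mathbb{C}$, given by $e_q(z)=\prod_{n\ge0}\frac{1}{1-z(1-q)q^n}$, $\cos_q(z)=\frac{e_q(iz)+e_q(-iz)}{2}$, $\sin_q(z)=\frac{e_q(iz)-e_q(-iz)}{2i}$. Two-variable functions. For $0<q<1$ and $y\in\mathbb{R}$, or $q>1$ and $y\le0$: $\sin_q(z,y)=\sum_{j\ge0}\frac{(-1)^jz^{2j+1}}{[2j+1]_q!}e^{q\frac{1-q^{2j+1}}{1-q}y}$,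 $\cos_q(z,y)=\sum_{j\ge0}\frac{(-1)^jz^{2j}}{[2j]_q!}e^{q\frac{1-q^{2j}}{1-q}y}$, and $\sin_1(z,y)=\sin(ze^y)$, $\cos_1(z,y)=\cos(ze^y)$. For $0<q<1$ the symbols again denote the meromorphic continuations in $z$, given by $\sin_q(z,y)=e^{\frac{qy}{1-q}}\sum_{m\ge0}\frac{(-\frac{qy}{1-q})^m}{m!}\sin_q(q^mz)$ and the same formula with $\cos$ in place of $\sin$. For $q>0$, $z_c(q)$ is the smallest positive real zero of $\cos_q$; the function $\tan_q=\sin_q/\cos_q:[0,z_c(q))\to[0,\infty)$ is a strictly increasing bijection, and $\arctan_q$ denotes its inverse. A probability measure $\pi$ on $\Omega$ is invariant for $p'$ if $\int_\Omega\pi(\mathrm{d}x)p'(x,B)=\pi(B)$ for all Borel $B\subseteq\Omega$. *)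

theory Defs
  imports "HOL-Probability.Probability"
begin

section \<open>q-analogues\<close>

definition q_poch :: "real \<Rightarrow> real \<Rightarrow> nat \<Rightarrow> real" where
  "q_poch a q n = (\<Prod>k<n. 1 - a * q ^ k)"

definition q_int :: "real \<Rightarrow> nat \<Rightarrow> real" where
  "q_int q k = (1 - q ^ k) / (1 - q)"

definition q_fact :: "real \<Rightarrow> nat \<Rightarrow> real" where
  "q_fact q n = (if q = 1 then fact n else (\<Prod>k=1..n. q_int q k))"

text \<open>
  For \<open>q \<ge> 1\<close> the functions below are given by their everywhere convergent power series. For
  \<open>0 < q < 1\<close> the series converge only for \<open>norm z < 1 / (1 - q)\<close>, and the definitions use the
  formulas for the meromorphic continuations; the lemmas at the end of this section show that
  these agree with the series on the disc of convergence. Nothing is claimed for \<open>q \<le> 0\<close>, nor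
  at the poles of the continuations, which lie on the positive real axis for \<open>q_exp\<close> and on the
  imaginary axis for the other functions.
\<close>

definition q_exp :: "real \<Rightarrow> complex \<Rightarrow> complex" where
  "q_exp q z =
     (if q \<ge> 1 then (\<Sum>n. z ^ n / of_real (q_fact q n))
      else (\<Prod>n. 1 / (1 - z * of_real ((1 - q) * q ^ n))))"

definition q_cos :: "real \<Rightarrow> complex \<Rightarrow> complex" where
  "q_cos q z =
     (if q \<ge> 1 then (\<Sum>n. (-1) ^ n * z ^ (2 * n) / of_real (q_fact q (2 * n)))
      else (q_exp q (\<i> * z) + q_exp q (- \<i> * z)) / 2)"

definition q_sin :: "real \<Rightarrow> complex \<Rightarrow> complex" where
  "q_sin q z =
     (if q \<ge> 1 then (\<Sum>n. (-1) ^ n * z ^ (2 * n + 1) / of_real (q_fact q (2 * n + 1)))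
      else (q_exp q (\<i> * z) - q_exp q (- \<i> * z)) / (2 * \<i>))"

text \<open>The two-variable functions; for \<open>q > 1\<close> they are only meant for \<open>y \<le> 0\<close>.\<close>

definition q_cos2 :: "real \<Rightarrow> complex \<Rightarrow> real \<Rightarrow> complex" where
  "q_cos2 q z y =
     (if q = 1 then cos (z * of_real (exp y))
      else if q > 1 then
        (\<Sum>j. (-1) ^ j * z ^ (2 * j) / of_real (q_fact q (2 * j))
               * of_real (exp (q * ((1 - q ^ (2 * j)) / (1 - q)) * y)))
      else of_real (exp (q * y / (1 - q)))
             * (\<Sum>m. of_real ((- (q * y / (1 - q))) ^ m / fact m) * q_cos q (of_real (q ^ m) * z)))"

definition q_sin2 :: "real \<Rightarrow> complex \<Rightarrow> real \<Rightarrow> complex" where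
  "q_sin2 q z y =
     (if q = 1 then sin (z * of_real (exp y))
      else if q > 1 then
        (\<Sum>j. (-1) ^ j * z ^ (2 * j + 1) / of_real (q_fact q (2 * j + 1))
               * of_real (exp (q * ((1 - q ^ (2 * j + 1)) / (1 - q)) * y)))
      else of_real (exp (q * y / (1 - q)))
             * (\<Sum>m. of_real ((- (q * y / (1 - q))) ^ m / fact m) * q_sin q (of_real (q ^ m) * z)))"

text \<open>
  All these functions are real on the real axis (away from poles), where only they are used
  below; \<open>Re\<close> just changes the type there.
\<close>

definition q_zc :: "real \<Rightarrow> real" where
  "q_zc q = (LEAST z. 0 < z \<and> q_cos q (of_real z) = 0)"

definition q_tan :: "real \<Rightarrow> real \<Rightarrow> real" where
  "q_tan q z = Re (q_sin q (of_real z) / q_cos q (of_real z))"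

definition q_arctan :: "real \<Rightarrow> real \<Rightarrow> real" where
  "q_arctan q = the_inv_into {0..<q_zc q} (q_tan q)"


lemma q_fact_0: "q_fact q 0 = 1"
  by (simp add: q_fact_def)

lemma q_fact_Suc:
  assumes "q \<noteq> 1" shows "q_fact q (Suc n) = q_int q (Suc n) * q_fact q n"
  using assms by (simp add: q_fact_def)

lemma q_fact_nonzero:
  assumes "0 < q" "q < 1" shows "q_fact q n \<noteq> 0"
proof (induction n)
  case (Suc n)
  have "q ^ Suc n < 1" using assms by (intro power_Suc_less_one) auto
  then show ?case using Suc assms by (simp add: q_fact_Suc q_int_def)
qed (simp add: q_fact_0)

lemma q_exp_series_abs:
  assumes q: "0 < q" "q < 1" and z: "norm z < 1 / (1 - q)"
  shows "summable (\<lambda>n. norm (z ^ n / complex_of_real (q_fact q n)))"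
proof (cases "z = 0")
  case True
  then show ?thesis
    by (intro summable_finite[of "{0}"]) auto
next
  case False
  have lim: "(\<lambda>n. norm z * (1 - q) / (1 - q ^ Suc n)) \<longlonglongrightarrow> norm z * (1 - q) / (1 - 0)"
    by (intro tendsto_intros LIMSEQ_Suc LIMSEQ_realpow_zero) (use q in auto)
  have lt: "norm z * (1 - q) / (1 - 0) < 1" using z q by (simp add: field_simps)
  define c where "c = (norm z * (1 - q) / (1 - 0) + 1) / 2"
  have c: "c < 1" "norm z * (1 - q) / (1 - 0) < c" using lt by (auto simp: c_def)
  from order_tendstoD(2)[OF lim c(2)] obtain N where
    N: "\<And>n. n \<ge> N \<Longrightarrow> norm z * (1 - q) / (1 - q ^ Suc n) < c"
    by (auto simp: eventually_sequentially)
  show ?thesis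
  proof (rule summable_ratio_test[OF c(1)])
    fix n assume n: "N \<le> n"
    have lt1: "q ^ Suc n < 1" using q by (intro power_Suc_less_one) auto
    have i: "\<bar>q_int q (Suc n)\<bar> = (1 - q ^ Suc n) / (1 - q)" using lt1 q by (simp add: q_int_def)
    have "norm (norm (z ^ Suc n / complex_of_real (q_fact q (Suc n)))) =
        (norm z * (1 - q) / (1 - q ^ Suc n)) * norm (norm (z ^ n / complex_of_real (q_fact q n)))"
      using q i lt1 by (simp add: q_fact_Suc norm_divide norm_mult norm_power abs_mult)
    also have "\<dots> \<le> c * norm (norm (z ^ n / complex_of_real (q_fact q n)))"
      by (intro mult_right_mono less_imp_le[OF N[OF n]]) auto
    finally show "norm (norm (z ^ Suc n / complex_of_real (q_fact q (Suc n))))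
        \<le> c * norm (norm (z ^ n / complex_of_real (q_fact q n)))" .
  qed
qed

lemma q_exp_sums:
  assumes q: "0 < q" "q < 1" and z: "norm z < 1 / (1 - q)"
  shows "(\<lambda>n. z ^ n / of_real (q_fact q n)) sums q_exp q z"
proof -
  define c where "c = (\<lambda>n. 1 / complex_of_real (q_fact q n))"
  define f where "f = (\<lambda>z. \<Sum>n. c n * z ^ n)"
  have summ: "summable (\<lambda>n. c n * w ^ n)" if "norm w < 1 / (1 - q)" for w
    using summable_norm_cancel[OF q_exp_series_abs[OF q that]] by (simp add: c_def)
  have step: "f (of_real q * w) = (1 - w * of_real (1 - q)) * f w" if w: "norm w < 1 / (1 - q)" for w
  proof -
    have "norm (of_real q * w) \<le> norm w" using q by (simp add: norm_mult mult_left_le_one_le)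
    then have w': "norm (of_real q * w) < 1 / (1 - q)" using w by linarith
    have s1: "(\<lambda>n. c n * w ^ n - c n * (of_real q * w) ^ n) sums (f w - f (of_real q * w))"
      unfolding f_def by (intro sums_diff summable_sums summ w w')
    have "(\<lambda>n. c (Suc n) * w ^ Suc n - c (Suc n) * (of_real q * w) ^ Suc n) =
          (\<lambda>n. (w * of_real (1 - q)) * (c n * w ^ n))"
    proof
      fix n
      have lt1: "q ^ Suc n < 1" using q by (intro power_Suc_less_one) auto
      have ne: "complex_of_real (1 - q ^ Suc n) \<noteq> 0" using lt1 by (subst of_real_eq_0_iff) simp
      have cS: "c (Suc n) = of_real (1 - q) / of_real (1 - q ^ Suc n) * c n"
        using q lt1 q_fact_nonzero[OF q, of n] unfolding c_def
        by (simp only: q_fact_Suc[of q n] q_int_def) (simp add: field_simps)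
      have "c (Suc n) * w ^ Suc n - c (Suc n) * (of_real q * w) ^ Suc n
          = c (Suc n) * of_real (1 - q ^ Suc n) * w ^ Suc n"
        by (simp add: power_mult_distrib algebra_simps)
      also have "\<dots> = of_real (1 - q) * c n * w ^ Suc n"
        unfolding cS using ne by simp
      finally show "c (Suc n) * w ^ Suc n - c (Suc n) * (of_real q * w) ^ Suc n =
          (w * of_real (1 - q)) * (c n * w ^ n)" by (simp add: algebra_simps)
    qed
    moreover have "(\<lambda>n. (w * of_real (1 - q)) * (c n * w ^ n)) sums ((w * of_real (1 - q)) * f w)"
      unfolding f_def by (intro sums_mult summable_sums summ w)
    ultimately have "(\<lambda>n. c n * w ^ n - c n * (of_real q * w) ^ n) sums
        ((w * of_real (1 - q)) * f w + (c 0 * w ^ 0 - c 0 * (of_real q * w) ^ 0))"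
      by (intro iffD1[OF sums_Suc_iff]) simp
    with s1 have "f w - f (of_real q * w) = (w * of_real (1 - q)) * f w"
      using sums_unique2 by fastforce
    then show ?thesis by (simp add: algebra_simps)
  qed
  have small: "norm (of_real (q ^ n) * z) < 1 / (1 - q)" for n
  proof -
    have "norm (of_real (q ^ n) * z) \<le> norm z"
      using q by (simp add: norm_mult norm_power mult_left_le_one_le power_le_one)
    then show ?thesis using z by linarith
  qed
  have nz: "1 - z * of_real ((1 - q) * q ^ n) \<noteq> 0" for n
  proof
    assume "1 - z * of_real ((1 - q) * q ^ n) = 0"
    then have "of_real (1 - q) * (of_real (q ^ n) * z) = 1" by (simp add: algebra_simps)
    then have "(1 - q) * norm (of_real (q ^ n) * z) = 1"
      using q by (metis norm_mult norm_of_real norm_one abs_of_pos diff_gt_0_iff_gt)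
    then show False using small[of n] q by (simp add: field_simps)
  qed
  have part: "f z = f (of_real (q ^ N) * z) * (\<Prod>n<N. 1 / (1 - z * of_real ((1 - q) * q ^ n)))" for N
  proof (induction N)
    case (Suc N)
    have "f (of_real (q ^ Suc N) * z) = (1 - z * of_real ((1 - q) * q ^ N)) * f (of_real (q ^ N) * z)"
      using step[OF small[of N]] by (simp add: mult_ac)
    then show ?case using Suc nz[of N] by (simp only: prod.lessThan_Suc) simp
  qed simp
  have "isCont f 0" unfolding f_def
    using q by (intro isCont_powser[where K = "of_real (1 / 2 / (1 - q))"] summ)
      (simp_all add: norm_of_real frac_less2 del: of_real_divide)
  moreover have "(\<lambda>N. of_real (q ^ N) * z) \<longlonglongrightarrow> of_real 0 * z"
    by (intro tendsto_intros LIMSEQ_realpow_zero) (use q in auto)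
  ultimately have "(\<lambda>N. f (of_real (q ^ N) * z)) \<longlonglongrightarrow> f 0"
    by (intro isCont_tendsto_compose[of 0 f]) auto
  moreover have "f 0 = 1" using powser_zero[of c] by (simp add: f_def c_def q_fact_0)
  ultimately have l1: "(\<lambda>N. f (of_real (q ^ N) * z)) \<longlonglongrightarrow> 1" by simp
  have "summable (\<lambda>n. norm z * (1 - q) * q ^ n)"
    by (intro summable_mult summable_geometric) (use q in auto)
  then have "abs_convergent_prod (\<lambda>n. 1 - z * of_real ((1 - q) * q ^ n))"
    using q by (simp add: abs_convergent_prod_conv_summable norm_mult norm_power mult.assoc)
  then have "convergent_prod (\<lambda>n. 1 - z * of_real ((1 - q) * q ^ n))"
    by (rule abs_convergent_prod_imp_convergent_prod)
  then have "convergent_prod (\<lambda>n. 1 / (1 - z * of_real ((1 - q) * q ^ n)))"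
    using convergent_prod_inverse by (simp add: divide_inverse)
  then have "(\<lambda>N. \<Prod>n\<le>N. 1 / (1 - z * of_real ((1 - q) * q ^ n))) \<longlonglongrightarrow> q_exp q z"
    using convergent_prod_LIMSEQ q by (fastforce simp: q_exp_def)
  then have l2: "(\<lambda>N. \<Prod>n<N. 1 / (1 - z * of_real ((1 - q) * q ^ n))) \<longlonglongrightarrow> q_exp q z"
    by (subst (asm) lessThan_Suc_atMost[symmetric]) (rule LIMSEQ_imp_Suc)
  have "(\<lambda>N. f z) \<longlonglongrightarrow> 1 * q_exp q z"
    using tendsto_mult[OF l1 l2] part by simp
  then have "f z = q_exp q z" by (simp add: LIMSEQ_const_iff)
  then show ?thesis using summable_sums[OF summ[OF z]] by (simp add: f_def c_def)
qed

lemma q_cos_sums: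
  assumes q: "0 < q" "q < 1" and z: "norm z < 1 / (1 - q)"
  shows "(\<lambda>n. (-1) ^ n * z ^ (2 * n) / of_real (q_fact q (2 * n))) sums q_cos q z"
proof -
  let ?g = "\<lambda>n. ((\<i> * z) ^ n / of_real (q_fact q n) + (- \<i> * z) ^ n / of_real (q_fact q n)) / 2"
  have "?g sums q_cos q z"
    using q z by (auto simp: q_cos_def norm_mult intro!: sums_divide sums_add q_exp_sums)
  moreover have "?g n = 0" if "n \<notin> range (\<lambda>n. 2 * n)" for n
  proof -
    have "odd n" using that by (auto elim!: evenE)
    then show ?thesis by (simp add: power_mult_distrib)
  qed
  ultimately have "(\<lambda>n. ?g (2 * n)) sums q_cos q z"
    by (subst sums_mono_reindex) (auto simp: strict_mono_def)
  moreover have "(\<lambda>n. ?g (2 * n)) =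
      (\<lambda>n. (-1) ^ n * z ^ (2 * n) / of_real (q_fact q (2 * n)))"
  proof
    fix n
    have p1: "(\<i> * z) ^ (2 * n) = (-1) ^ n * z ^ (2 * n)"
      by (simp only: power_mult_distrib power_mult power2_i)
    have p2: "(- \<i> * z) ^ (2 * n) = (-1) ^ n * z ^ (2 * n)"
      using p1 by simp
    show "?g (2 * n) = (-1) ^ n * z ^ (2 * n) / of_real (q_fact q (2 * n))"
      unfolding p1 p2 by simp
  qed
  ultimately show ?thesis by simp
qed

lemma q_sin_sums:
  assumes q: "0 < q" "q < 1" and z: "norm z < 1 / (1 - q)"
  shows "(\<lambda>n. (-1) ^ n * z ^ (2 * n + 1) / of_real (q_fact q (2 * n + 1))) sums q_sin q z"
proof -
  let ?g = "\<lambda>n. ((\<i> * z) ^ n / of_real (q_fact q n) - (- \<i> * z) ^ n / of_real (q_fact q n)) / (2 * \<i>)"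
  have "?g sums q_sin q z"
    using q z sums_divide[OF sums_diff[OF q_exp_sums[OF q, of "\<i> * z"] q_exp_sums[OF q, of "- \<i> * z"]],
        of "2 * \<i>"] by (simp add: q_sin_def norm_mult)
  moreover have "?g n = 0" if "n \<notin> range (\<lambda>n. 2 * n + 1)" for n
  proof -
    have "even n" using that by (metis oddE rangeI)
    then show ?thesis by (simp add: power_mult_distrib)
  qed
  ultimately have "(\<lambda>n. ?g (2 * n + 1)) sums q_sin q z"
    by (subst sums_mono_reindex) (auto simp: strict_mono_def)
  moreover have "(\<lambda>n. ?g (2 * n + 1)) =
      (\<lambda>n. (-1) ^ n * z ^ (2 * n + 1) / of_real (q_fact q (2 * n + 1)))"
  proof
    fix n
    have "(\<i> * z) ^ (2 * n) = (-1) ^ n * z ^ (2 * n)"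
      by (simp only: power_mult_distrib power_mult power2_i)
    then have p1: "(\<i> * z) ^ (2 * n + 1) = \<i> * ((-1) ^ n * z ^ (2 * n + 1))"
      by simp
    have p2: "(- \<i> * z) ^ (2 * n + 1) = - \<i> * ((-1) ^ n * z ^ (2 * n + 1))"
      using p1 by simp
    show "?g (2 * n + 1) = (-1) ^ n * z ^ (2 * n + 1) / of_real (q_fact q (2 * n + 1))"
      unfolding p1 p2 by simp
  qed
  ultimately show ?thesis by simp
qed

text \<open>The interchange of summation behind the two-variable continuation formulas.\<close>

lemma poisson_mixture_sums:
  fixes d F :: "nat \<Rightarrow> complex" and r :: "nat \<Rightarrow> real" and t :: real
  assumes d: "summable (\<lambda>j. norm (d j))" and r: "\<And>j. 0 \<le> r j" "\<And>j. r j \<le> 1"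
    and F: "\<And>m. (\<lambda>j. d j * of_real (r j ^ m)) sums F m"
  shows "(\<lambda>j. d j * of_real (exp (- t * (1 - r j)))) sums
           (of_real (exp (- t)) * (\<Sum>m. of_real (t ^ m / fact m) * F m))"
proof -
  define g where "g = (\<lambda>j m. d j * of_real (t ^ m / fact m * r j ^ m))"
  have ex: "(\<lambda>m. x ^ m / fact m) sums exp x" for x :: real
    using exp_converges[of x] by (simp add: divide_inverse mult.commute)
  have bound: "norm (g j m) \<le> norm (d j) * (\<bar>t\<bar> ^ m / fact m)" for j m
  proof -
    have "norm (g j m) = norm (d j) * (\<bar>t\<bar> ^ m / fact m) * r j ^ m"
      using r[of j] by (simp add: g_def norm_mult norm_divide norm_power)
    also have "\<dots> \<le> norm (d j) * (\<bar>t\<bar> ^ m / fact m)"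
      using r[of j] by (intro mult_left_le power_le_one) auto
    finally show ?thesis .
  qed
  have hd: "(\<lambda>j. norm (d j)) summable_on UNIV"
    using d by (simp add: summable_on_UNIV_nonneg_real_iff)
  have he: "(\<lambda>m. \<bar>t\<bar> ^ m / fact m) summable_on UNIV"
    using ex[of "\<bar>t\<bar>"] by (simp add: summable_on_UNIV_nonneg_real_iff sums_iff)
  have "(\<lambda>(j, m). norm (d j) * (\<bar>t\<bar> ^ m / fact m)) summable_on (UNIV \<times> UNIV)"
    using hd he by (intro summable_on_SigmaI[where g = "\<lambda>j. norm (d j) * infsum (\<lambda>m. \<bar>t\<bar> ^ m / fact m) UNIV"])
      (auto intro!: has_sum_cmult_right summable_on_cmult_left has_sum_infsum simp del: times_divide_eq_right)
  then have "(\<lambda>(j, m). norm (g j m)) summable_on (UNIV \<times> UNIV)"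
    by (rule summable_on_comparison_test) (auto intro!: bound simp del: times_divide_eq_right)
  then have abs: "(\<lambda>(j, m). g j m) summable_on (UNIV \<times> UNIV)"
    using abs_summable_summable[of "\<lambda>(j, m). g j m" "UNIV \<times> UNIV"]
    by (simp only: case_prod_unfold)
  have rowm: "(g j has_sum (d j * of_real (exp (t * r j)))) UNIV" for j
  proof (rule norm_summable_imp_has_sum)
    show "summable (\<lambda>m. norm (g j m))"
    proof (rule summable_comparison_test'[where N = 0])
      show "summable (\<lambda>m. norm (d j) * (\<bar>t\<bar> ^ m / fact m))"
        by (intro summable_mult sums_summable[OF ex])
      show "norm (norm (g j m)) \<le> norm (d j) * (\<bar>t\<bar> ^ m / fact m)" for m
        using bound by simp
    qed
    have "(\<lambda>m. of_real (t ^ m / fact m * r j ^ m)) sums complex_of_real (exp (t * r j))"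
      using ex[of "t * r j"] by (intro sums_of_real) (simp add: power_mult_distrib)
    then show "g j sums (d j * of_real (exp (t * r j)))"
      unfolding g_def by (rule sums_mult)
  qed
  have colj: "((\<lambda>j. g j m) has_sum (of_real (t ^ m / fact m) * F m)) UNIV" for m
  proof (rule norm_summable_imp_has_sum)
    show "summable (\<lambda>j. norm (g j m))"
    proof (rule summable_comparison_test'[where N = 0])
      show "summable (\<lambda>j. norm (d j) * (\<bar>t\<bar> ^ m / fact m))"
        by (intro summable_mult2 d)
      show "norm (norm (g j m)) \<le> norm (d j) * (\<bar>t\<bar> ^ m / fact m)" for j
        using bound by simp
    qed
    show "(\<lambda>j. g j m) sums (of_real (t ^ m / fact m) * F m)"
      using sums_mult[OF F[of m], of "of_real (t ^ m / fact m)"] by (simp add: g_def mult_ac)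
  qed
  obtain S where S: "((\<lambda>(j, m). g j m) has_sum S) (UNIV \<times> UNIV)"
    using abs by (auto simp: summable_on_def)
  have "((\<lambda>j. d j * of_real (exp (t * r j))) has_sum S) UNIV"
    by (rule has_sum_SigmaD[OF S]) (simp only: prod.case rowm)
  then have A: "(\<lambda>j. d j * of_real (exp (t * r j))) sums S" by (rule has_sum_imp_sums)
  have "((\<lambda>(m, j). g j m) has_sum S) (UNIV \<times> UNIV)"
    using S has_sum_swap[of "\<lambda>(j, m). g j m" UNIV UNIV S] by simp
  then have "((\<lambda>m. of_real (t ^ m / fact m) * F m) has_sum S) UNIV"
    by (rule has_sum_SigmaD) (simp only: prod.case colj)
  then have B: "(\<lambda>m. of_real (t ^ m / fact m) * F m) sums S" by (rule has_sum_imp_sums)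
  have "exp (- t * (1 - r j)) = exp (- t) * exp (t * r j)" for j
    unfolding exp_add[symmetric] by (simp add: algebra_simps)
  then show ?thesis
    using sums_mult[OF A, of "of_real (exp (- t))"] sums_unique[OF B] by (simp add: mult_ac)
qed

lemma summable_norm_subseq:
  fixes f :: "nat \<Rightarrow> complex"
  assumes "summable (\<lambda>n. norm (f n))" and "inj k"
  shows "summable (\<lambda>j. norm (f (k j)))"
proof -
  have "(\<lambda>n. norm (f n)) summable_on range k"
    using assms(1) summable_on_subset_banach[of "\<lambda>n. norm (f n)" UNIV "range k"]
    by (simp add: summable_on_UNIV_nonneg_real_iff)
  then have "(\<lambda>j. norm (f (k j))) summable_on UNIV"
    using summable_on_reindex[OF assms(2), of "\<lambda>n. norm (f n)"] by (simp add: o_def)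
  then show ?thesis by (simp add: summable_on_UNIV_nonneg_real_iff)
qed

lemma q_cos2_sums:
  assumes q: "0 < q" "q < 1" and z: "norm z < 1 / (1 - q)"
  shows "(\<lambda>j. (-1) ^ j * z ^ (2 * j) / of_real (q_fact q (2 * j))
            * of_real (exp (q * ((1 - q ^ (2 * j)) / (1 - q)) * y))) sums q_cos2 q z y"
proof -
  let ?d = "\<lambda>j. (-1) ^ j * z ^ (2 * j) / complex_of_real (q_fact q (2 * j))"
  let ?t = "- (q * y / (1 - q))"
  have "summable (\<lambda>j. norm (?d j))"
    using summable_norm_subseq[OF q_exp_series_abs[OF q z], of "\<lambda>j. 2 * j"]
    by (simp add: norm_divide norm_mult norm_power inj_def)
  moreover have "(\<lambda>j. ?d j * of_real ((q ^ (2 * j)) ^ m)) sums q_cos q (of_real (q ^ m) * z)" for m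
  proof -
    have "norm (of_real (q ^ m) * z) \<le> norm z"
      using q by (simp add: norm_mult norm_power mult_left_le_one_le power_le_one)
    then have "norm (of_real (q ^ m) * z) < 1 / (1 - q)" using z by linarith
    from q_cos_sums[OF q this] show ?thesis
      by (simp add: power_mult_distrib mult_ac flip: power_mult)
  qed
  ultimately have "(\<lambda>j. ?d j * of_real (exp (- ?t * (1 - q ^ (2 * j))))) sums
      (of_real (exp (- ?t)) * (\<Sum>m. of_real (?t ^ m / fact m) * q_cos q (of_real (q ^ m) * z)))"
    using q by (intro poisson_mixture_sums) (auto simp: power_le_one)
  then show ?thesis using q by (simp add: q_cos2_def mult_ac)
qed

lemma q_sin2_sums:
  assumes q: "0 < q" "q < 1" and z: "norm z < 1 / (1 - q)"
  shows "(\<lambda>j. (-1) ^ j * z ^ (2 * j + 1) / of_real (q_fact q (2 * j + 1))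
            * of_real (exp (q * ((1 - q ^ (2 * j + 1)) / (1 - q)) * y))) sums q_sin2 q z y"
proof -
  let ?d = "\<lambda>j. (-1) ^ j * z ^ (2 * j + 1) / complex_of_real (q_fact q (2 * j + 1))"
  let ?t = "- (q * y / (1 - q))"
  have "summable (\<lambda>j. norm (?d j))"
    using summable_norm_subseq[OF q_exp_series_abs[OF q z], of "\<lambda>j. 2 * j + 1"]
    by (simp add: norm_divide norm_mult norm_power inj_def)
  moreover have "(\<lambda>j. ?d j * of_real ((q ^ (2 * j + 1)) ^ m)) sums q_sin q (of_real (q ^ m) * z)" for m
  proof -
    have "norm (of_real (q ^ m) * z) \<le> norm z"
      using q by (simp add: norm_mult norm_power mult_left_le_one_le power_le_one)
    then have "norm (of_real (q ^ m) * z) < 1 / (1 - q)" using z by linarith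
    from q_sin_sums[OF q this] show ?thesis
      by (simp add: power_mult_distrib mult_ac flip: power_mult)
  qed
  ultimately have "(\<lambda>j. ?d j * of_real (exp (- ?t * (1 - q ^ (2 * j + 1))))) sums
      (of_real (exp (- ?t)) * (\<Sum>m. of_real (?t ^ m / fact m) * q_sin q (of_real (q ^ m) * z)))"
    using q by (intro poisson_mixture_sums) (auto intro!: power_le_one simp del: power_Suc)
  then show ?thesis using q by (simp add: q_sin2_def mult_ac)
qed

section \<open>Kernels and invariant measures\<close>

text \<open>The value at the Lebesgue-null point \<open>0\<close> is an arbitrary choice.\<close>

definition phi :: "real \<Rightarrow> real \<Rightarrow> real" where
  "phi \<xi> x = (if x < 0 then \<xi> * exp x else if x > 0 then (1 - \<xi>) * exp (- x) else 0)"

definition pker :: "real set \<Rightarrow> real \<Rightarrow> real \<Rightarrow> real \<Rightarrow> (real \<Rightarrow> real) \<Rightarrow> real \<Rightarrow> real measure" where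
  "pker \<Omega> \<theta> \<xi> lam h x1 =
     density (restrict_space lborel \<Omega>)
       (\<lambda>x2. ennreal (indicator {\<theta> * x1<..} x2 * (h x2 / h x1) * (1 / lam) * phi \<xi> x2))"

definition markov_kernel_on :: "real set \<Rightarrow> (real \<Rightarrow> real measure) \<Rightarrow> bool" where
  "markov_kernel_on \<Omega> K \<longleftrightarrow>
     K \<in> restrict_space borel \<Omega> \<rightarrow>\<^sub>M prob_algebra (restrict_space borel \<Omega>)"

definition invariant_prob :: "real set \<Rightarrow> (real \<Rightarrow> real measure) \<Rightarrow> real measure \<Rightarrow> bool" where
  "invariant_prob \<Omega> K \<pi> \<longleftrightarrow>
     prob_space \<pi> \<and> sets \<pi> = sets (restrict_space borel \<Omega>) \<and>
     (\<forall>B \<in> sets (restrict_space borel \<Omega>). (\<integral>\<^sup>+x. emeasure (K x) B \<partial>\<pi>) = emeasure \<pi> B)"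

definition unique_invariant_prob :: "real set \<Rightarrow> (real \<Rightarrow> real measure) \<Rightarrow> real measure \<Rightarrow> bool" where
  "unique_invariant_prob \<Omega> K \<pi> \<longleftrightarrow>
     markov_kernel_on \<Omega> K \<and> invariant_prob \<Omega> K \<pi> \<and> (\<forall>\<mu>. invariant_prob \<Omega> K \<mu> \<longrightarrow> \<mu> = \<pi>)"

text \<open>
  The law of a real random variable \<open>X\<close> as a measure on \<open>\<Omega>\<close>. Restricting the law, rather than
  taking a push-forward into the subspace, allows \<open>X\<close> to leave \<open>\<Omega>\<close> on a null set.
\<close>

definition law_on :: "real set \<Rightarrow> 'a measure \<Rightarrow> ('a \<Rightarrow> real) \<Rightarrow> real measure" where
  "law_on \<Omega> M X = restrict_space (distr M borel X) \<Omega>"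

section \<open>The eigenvalues and eigenfunctions in the five regimes\<close>

definition lam_i :: "real \<Rightarrow> real \<Rightarrow> real" where
  "lam_i \<theta> \<xi> = (1 - \<xi>) * (1 - \<theta>)"

definition h_i :: "real \<Rightarrow> real \<Rightarrow> real \<Rightarrow> real" where
  "h_i \<theta> \<xi> x =
     (if x > 0 then exp (\<theta> / (\<theta> - 1) * x)
      else exp (\<theta> * x / (1 - \<theta>)) *
        (\<Sum>m. (- (\<theta> * x / (1 - \<theta>))) ^ m / fact m * q_poch (- \<xi> / lam_i \<theta> \<xi> * (1 - \<theta>)) \<theta> m))"

definition lam_ii :: "real \<Rightarrow> real \<Rightarrow> real" where
  "lam_ii \<theta> \<xi> = (1 - 1 / \<theta>) * \<xi>"

definition h_ii :: "real \<Rightarrow> real \<Rightarrow> real \<Rightarrow> real" where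
  "h_ii \<theta> \<xi> x =
     (if x > 0 then 0
      else Re (q_exp \<theta> (of_real ((1 - \<xi>) / lam_ii \<theta> \<xi>))) *
        (\<Sum>j. (- \<xi> / lam_ii \<theta> \<xi>) ^ j / q_fact \<theta> j * exp (\<theta> * (1 - \<theta> ^ j) / (1 - \<theta>) * x)))"

definition a_iii :: "real \<Rightarrow> real \<Rightarrow> real" where
  "a_iii \<theta> \<xi> = q_arctan (- \<theta>) (sqrt (\<xi> / (1 - \<xi>)))"

definition lam_iii :: "real \<Rightarrow> real \<Rightarrow> real" where
  "lam_iii \<theta> \<xi> = sqrt (\<xi> * (1 - \<xi>)) / a_iii \<theta> \<xi>"

definition h_iii :: "real \<Rightarrow> real \<Rightarrow> real \<Rightarrow> real" where
  "h_iii \<theta> \<xi> x =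
     (if x > 0 then Re (q_cos2 (- \<theta>) (of_real (a_iii \<theta> \<xi>)) (- x))
      else sqrt (1 - \<xi>) / sqrt \<xi> * Re (q_sin2 (- \<theta>) (of_real (a_iii \<theta> \<xi>)) x))"

definition h_iv :: "real \<Rightarrow> real \<Rightarrow> real" where
  "h_iv \<theta> x = (if x \<ge> 0 then 1 else exp (- \<theta> * x))"

section \<open>The invariant density for negative \<open>\<theta>\<close>\<close>

definition pos_iii :: "real \<Rightarrow> real \<Rightarrow> real \<Rightarrow> real" where
  "pos_iii \<theta> \<xi> x = exp (- x) * Re (q_cos2 (- \<theta>) (of_real (a_iii \<theta> \<xi>)) (- x))
                              * Re (q_cos2 (- (1 / \<theta>)) (of_real (a_iii \<theta> \<xi>)) (- x))"

definition neg_iii :: "real \<Rightarrow> real \<Rightarrow> real \<Rightarrow> real" where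
  "neg_iii \<theta> \<xi> x = exp x * Re (q_sin2 (- \<theta>) (of_real (a_iii \<theta> \<xi>)) x)
                          * Re (q_sin2 (- (1 / \<theta>)) (of_real (a_iii \<theta> \<xi>)) x)"

definition b_iii :: "real \<Rightarrow> real \<Rightarrow> real" where
  "b_iii \<theta> \<xi> = (LBINT x:{0<..}. pos_iii \<theta> \<xi> x) + (LBINT x:{..0}. neg_iii \<theta> \<xi> x)"

definition pi_iii :: "real \<Rightarrow> real \<Rightarrow> real measure" where
  "pi_iii \<theta> \<xi> = density lborel
     (\<lambda>x. ennreal (1 / b_iii \<theta> \<xi> * (if x > 0 then pos_iii \<theta> \<xi> x else neg_iii \<theta> \<xi> x)))"

end

theory Submission
  imports Defs
begin

text \<open>
  Write \<open>T h x\<close> for the integral of \<open>h \<phi>\<close> over \<open>y > \<theta> x\<close>, so that \<open>p'\<close> is Markov exactly when \<open>T h = \<lambda> h\<close>.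
  If moreover \<open>g\<close> solves the adjoint equation (integral of \<open>g \<phi>\<close> over all \<open>x\<close> with \<open>\<theta> x < y\<close> equals
  \<open>\<lambda> g y\<close>), then \<open>g h \<phi>\<close>, normalised, is invariant. For \<open>\<theta> < 0\<close> the adjoint equation is the original
  one with \<open>1 / \<theta>\<close> in place of \<open>\<theta>\<close>, which explains the product form in (iii); in (ii) \<open>g\<close> is an exponential,
  and reversing time turns the chain into \<open>X' = X / \<theta> + (1 - 1 / \<theta>) E\<close>, up to a sign. In (i), (iv) and (v)
  the chain is of this affine form once it is positive.

  Uniqueness: if \<open>f\<close> and \<open>f'\<close> are invariant densities, then \<open>min f f'\<close> is mapped below itself and has the
  same mass as its image, so it is invariant; the two remainders are invariant with disjoint supports,
  although the kernel spreads any two of them over a common interval.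

  The arctangent of (iii) comes from \<open>e\<^sub>q (i x)\<close> being an infinite product, whose argument \<open>\<Sum> arctan (x (1 - \<eta>) \<eta>\<^sup>n)\<close>,
  \<open>\<eta> = min q (1 / q)\<close>, is the same for \<open>q\<close> and \<open>1 / q\<close>. For \<open>q < 1\<close> the eigenfunction is a Poisson mixture of
  values of sine and cosine at the points \<open>q\<^sup>m a\<close>, hence positive.
\<close>

section \<open>Markov kernels given by a density\<close>

text \<open>The obstacle is the sign of \<open>h\<close>: for \<theta> > 1 and \<theta> < -1 the
  eigenfunctions are alternating series. It is settled by a Perron-Frobenius argument that needs
  only one positive adjoint eigenfunction: \<open>\<bar>h\<bar>\<close> is at most its image, and
  pairing with the adjoint eigenfunction leaves no room for strict inequality. For \<theta> < 0 one
  of \<open>- \<theta>\<close> and \<open>- 1 / \<theta>\<close> is at most 1, and its eigenfunction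
  serves as the partner of the other. All two-variable functions are handled through one complex
  function \<open>E\<close> with \<open>E' y = q z exp (q y) E (q y)\<close>. Integrating
  \<open>exp s * E s\<close> up to \<open>y\<close> gives \<open>(E (y / q) - 1) / z\<close>, so the
  eigenvalue equation reduces to a condition at 0: in (iii) the argument of \<open>E 0\<close> is
  \<open>arctan (sqrt (\<xi> / (1 - \<xi>)))\<close>, which determines \<open>a\<close>; in (ii)
  \<open>E 0 = 0\<close>, which determines \<lambda>. For q < 1 the number
  \<open>a * (1 - q)\<close> can exceed 1 (small q, \<xi> near 1), outside the disc of convergence;
  there the arguments rest on the infinite product and on Poisson mixtures, not on power
  series.\<close>

lemma AE_eq_if_nn_integral_eq:
  fixes u v :: "'a \<Rightarrow> ennreal"
  assumes [measurable]: "u \<in> borel_measurable M" "v \<in> borel_measurable M"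
    and le: "AE x in M. u x \<le> v x"
    and ge: "(\<integral>\<^sup>+x. v x \<partial>M) \<le> (\<integral>\<^sup>+x. u x \<partial>M)" and fin: "(\<integral>\<^sup>+x. v x \<partial>M) < \<infinity>"
  shows "AE x in M. u x = v x"
proof -
  have eq: "(\<integral>\<^sup>+x. v x \<partial>M) = (\<integral>\<^sup>+x. u x \<partial>M)"
    using ge nn_integral_mono_AE[OF le] by (rule antisym)
  have "(\<integral>\<^sup>+x. v x - u x \<partial>M) = (\<integral>\<^sup>+x. v x \<partial>M) - (\<integral>\<^sup>+x. u x \<partial>M)"
    using fin eq le by (intro nn_integral_diff) auto
  also have "\<dots> = 0"
    using fin eq by simp
  finally have "AE x in M. v x - u x = 0"
    by (subst (asm) nn_integral_0_iff_AE) auto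
  moreover have "AE x in M. v x \<noteq> \<infinity>"
    using fin by (intro nn_integral_noteq_infinite) auto
  ultimately show ?thesis
    using le
  proof eventually_elim
    case (elim x)
    then have "v x = u x + (v x - u x)"
      by (metis add.commute diff_add_cancel_ennreal)
    with elim show ?case by simp
  qed
qed

text \<open>The reference measure is left abstract because two kinds of space occur: the whole line
  for the affine chain, and the restriction of \<open>lborel\<close> to \<open>\<Omega>\<close> for
  the kernels of the theorem.\<close>

locale markov_density = sigma_finite_measure L for L :: "'a measure" +
  fixes k :: "'a \<Rightarrow> 'a \<Rightarrow> ennreal"
  assumes k_measurable [measurable]: "case_prod k \<in> borel_measurable (L \<Otimes>\<^sub>M L)"
    and k_one: "\<And>x. x \<in> space L \<Longrightarrow> (\<integral>\<^sup>+y. k x y \<partial>L) = 1"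
begin

definition push :: "('a \<Rightarrow> ennreal) \<Rightarrow> 'a \<Rightarrow> ennreal" where
  "push f y = (\<integral>\<^sup>+x. f x * k x y \<partial>L)"

definition invariant :: "'a measure \<Rightarrow> bool" where
  "invariant \<mu> \<longleftrightarrow> prob_space \<mu> \<and> sets \<mu> = sets L \<and>
     (\<forall>B \<in> sets L. (\<integral>\<^sup>+x. emeasure (density L (k x)) B \<partial>\<mu>) = emeasure \<mu> B)"

lemma k_measurable_fst [measurable]: "x \<in> space L \<Longrightarrow> k x \<in> borel_measurable L"
  using measurable_compose_Pair1[OF _ k_measurable] by simp

lemma pair_sigma_finite_L: "pair_sigma_finite L L"
  by (intro pair_sigma_finite.intro sigma_finite_measure_axioms)

lemma push_measurable [measurable]:
  assumes [measurable]: "f \<in> borel_measurable L" shows "push f \<in> borel_measurable L"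
proof -
  interpret pair_sigma_finite L L by (rule pair_sigma_finite_L)
  have [measurable]: "(\<lambda>(y, x). k x y) \<in> borel_measurable (L \<Otimes>\<^sub>M L)"
    using measurable_compose[OF measurable_pair_swap' k_measurable] by (simp add: case_prod_unfold)
  show ?thesis unfolding push_def by measurable
qed

lemma nn_integral_push:
  assumes [measurable]: "f \<in> borel_measurable L" "B \<in> sets L"
  shows "(\<integral>\<^sup>+y. push f y * indicator B y \<partial>L) = (\<integral>\<^sup>+x. f x * emeasure (density L (k x)) B \<partial>L)"
proof -
  interpret pair_sigma_finite L L by (rule pair_sigma_finite_L)
  have [measurable]: "(\<lambda>(y, x). k x y) \<in> borel_measurable (L \<Otimes>\<^sub>M L)"
    using measurable_compose[OF measurable_pair_swap' k_measurable] by (simp add: case_prod_unfold)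
  have "(\<integral>\<^sup>+y. push f y * indicator B y \<partial>L) = (\<integral>\<^sup>+y. (\<integral>\<^sup>+x. f x * k x y * indicator B y \<partial>L) \<partial>L)"
    unfolding push_def by (intro nn_integral_cong nn_integral_multc[symmetric]) measurable
  also have "\<dots> = (\<integral>\<^sup>+x. (\<integral>\<^sup>+y. f x * k x y * indicator B y \<partial>L) \<partial>L)"
    by (rule Fubini') measurable
  also have "\<dots> = (\<integral>\<^sup>+x. f x * emeasure (density L (k x)) B \<partial>L)"
    by (intro nn_integral_cong) (simp add: emeasure_density nn_integral_cmult[symmetric] mult.assoc)
  finally show ?thesis .
qed

lemma nn_integral_push_total:
  assumes [measurable]: "f \<in> borel_measurable L"
  shows "(\<integral>\<^sup>+y. push f y \<partial>L) = (\<integral>\<^sup>+x. f x \<partial>L)"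
proof -
  have "(\<integral>\<^sup>+y. push f y \<partial>L) = (\<integral>\<^sup>+y. push f y * indicator (space L) y \<partial>L)"
    by (intro nn_integral_cong) auto
  also have "\<dots> = (\<integral>\<^sup>+x. f x * emeasure (density L (k x)) (space L) \<partial>L)"
    by (rule nn_integral_push) auto
  also have "\<dots> = (\<integral>\<^sup>+x. f x * 1 \<partial>L)"
    by (intro nn_integral_cong) (simp add: emeasure_density k_one cong: nn_integral_cong_simp)
  finally show ?thesis by simp
qed

lemma kernel_in_prob_algebra: "(\<lambda>x. density L (k x)) \<in> L \<rightarrow>\<^sub>M prob_algebra L"
proof (rule measurable_prob_algebraI)
  show P: "prob_space (density L (k x))" if "x \<in> space L" for x
    using that by (intro prob_spaceI) (simp add: emeasure_density k_one cong: nn_integral_cong_simp)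
  show "(\<lambda>x. density L (k x)) \<in> L \<rightarrow>\<^sub>M subprob_algebra L"
  proof (rule measurable_subprob_algebra)
    fix A assume [measurable]: "A \<in> sets L"
    have "(\<lambda>x. \<integral>\<^sup>+y. k x y * indicator A y \<partial>L) \<in> borel_measurable L" by measurable
    then show "(\<lambda>x. emeasure (density L (k x)) A) \<in> borel_measurable L"
      by (simp add: emeasure_density cong: measurable_cong)
  qed (auto intro: prob_space_imp_subprob_space P)
qed

lemma invariant_densityI:
  assumes [measurable]: "f \<in> borel_measurable L"
    and one: "(\<integral>\<^sup>+x. f x \<partial>L) = 1" and fixpt: "AE y in L. push f y = f y"
  shows "invariant (density L f)"
  unfolding invariant_def
proof (intro conjI ballI)
  show "prob_space (density L f)"
    using one by (intro prob_spaceI) (simp add: emeasure_density cong: nn_integral_cong_simp)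
  fix B assume [measurable]: "B \<in> sets L"
  have [measurable]: "(\<lambda>x. emeasure (density L (k x)) B) \<in> borel_measurable L"
    using measurable_compose[OF measurable_prob_algebraD[OF kernel_in_prob_algebra]
        measurable_emeasure_subprob_algebra, OF \<open>B \<in> sets L\<close>] .
  have "(\<integral>\<^sup>+x. emeasure (density L (k x)) B \<partial>density L f) = (\<integral>\<^sup>+y. push f y * indicator B y \<partial>L)"
    by (simp add: nn_integral_density nn_integral_push)
  also have "\<dots> = (\<integral>\<^sup>+y. f y * indicator B y \<partial>L)"
    using fixpt by (intro nn_integral_cong_AE) auto
  finally show "(\<integral>\<^sup>+x. emeasure (density L (k x)) B \<partial>density L f) = emeasure (density L f) B"
    by (simp add: emeasure_density)
qed auto

text \<open>An invariant law is an average of the measures \<open>density L (k x)\<close>, hence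
  absolutely continuous. The version of the density given by averaging \<open>k x y\<close> over
  \<open>\<mu>\<close> is a fixed point of \<open>push\<close> at every point, not just almost
  everywhere, so that minima of two such densities can be compared pointwise with their
  images.\<close>

lemma invariant_has_density:
  assumes "invariant \<mu>"
  obtains f where "f \<in> borel_measurable L" "(\<integral>\<^sup>+x. f x \<partial>L) = 1" "\<And>y. y \<in> space L \<Longrightarrow> push f y = f y"
    "\<mu> = density L f"
proof -
  from assms have "prob_space \<mu>" and sets [measurable_cong]: "sets \<mu> = sets L"
    and inv: "\<And>B. B \<in> sets L \<Longrightarrow> (\<integral>\<^sup>+x. emeasure (density L (k x)) B \<partial>\<mu>) = emeasure \<mu> B"
    by (auto simp: invariant_def)
  interpret \<mu>: prob_space \<mu> by fact
  interpret pair_sigma_finite \<mu> L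
    by (intro pair_sigma_finite.intro sigma_finite_measure_axioms \<mu>.sigma_finite_measure_axioms)
  have sp: "space \<mu> = space L" using sets by (rule sets_eq_imp_space_eq)
  have k': "(\<lambda>(y, x). k x y) \<in> borel_measurable (L \<Otimes>\<^sub>M L)"
    using measurable_compose[OF measurable_pair_swap' k_measurable] by (simp add: case_prod_unfold)
  have [measurable]: "case_prod k \<in> borel_measurable (\<mu> \<Otimes>\<^sub>M L)"
    using k_measurable by (simp cong: measurable_cong_sets add: sets_pair_measure_cong[OF sets refl])
  have [measurable]: "(\<lambda>(y, x). k x y) \<in> borel_measurable (L \<Otimes>\<^sub>M \<mu>)"
    using k' measurable_cong_sets[OF sets_pair_measure_cong[OF refl sets] refl] by blast
  define f where "f y = (\<integral>\<^sup>+x. k x y \<partial>\<mu>)" for y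
  have f [measurable]: "f \<in> borel_measurable L" unfolding f_def by measurable
  have \<mu>: "\<mu> = density L f"
  proof (rule measure_eqI)
    fix B assume "B \<in> sets \<mu>"
    then have [measurable]: "B \<in> sets L" by (simp add: sets)
    have "emeasure \<mu> B = (\<integral>\<^sup>+x. (\<integral>\<^sup>+y. k x y * indicator B y \<partial>L) \<partial>\<mu>)"
      unfolding inv[OF \<open>B \<in> sets L\<close>, symmetric] by (intro nn_integral_cong) (simp add: emeasure_density sp)
    also have "\<dots> = (\<integral>\<^sup>+y. (\<integral>\<^sup>+x. k x y * indicator B y \<partial>\<mu>) \<partial>L)"
      by (rule Fubini'[symmetric]) measurable
    also have "\<dots> = (\<integral>\<^sup>+y. f y * indicator B y \<partial>L)"
      unfolding f_def by (intro nn_integral_cong nn_integral_multc) measurable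
    finally show "emeasure \<mu> B = emeasure (density L f) B" by (simp add: emeasure_density)
  qed (simp add: sets)
  have p: "push f y = f y" if "y \<in> space L" for y
  proof -
    have [measurable]: "(\<lambda>x. k x y) \<in> borel_measurable L"
      using measurable_compose_Pair1[OF that k'] by simp
    show ?thesis unfolding push_def by (subst (2) f_def, subst \<mu>) (simp add: nn_integral_density)
  qed
  have "(\<integral>\<^sup>+x. f x \<partial>L) = emeasure \<mu> (space L)"
    by (subst \<mu>) (simp add: emeasure_density cong: nn_integral_cong_simp)
  then have "(\<integral>\<^sup>+x. f x \<partial>L) = 1"
    using \<mu>.emeasure_space_1 sp by simp
  with p \<mu> f show ?thesis by (intro that)
qed

text \<open>The kernels in question vanish below a threshold, so positivity is asked only locally:
  the sets \<open>A n\<close> exhaust the space, and from every point of \<open>A n\<close> all of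
  \<open>B n\<close> is charged. Since \<open>A\<close> increases, one index \<open>n\<close> serves
  for two given densities at once.\<close>

lemma invariant_unique:
  fixes A B :: "nat \<Rightarrow> 'a set"
  assumes A: "incseq A" "space L \<subseteq> (\<Union>n. A n)" "\<And>n. A n \<in> sets L"
    and B: "\<And>n. B n \<in> sets L" "\<And>n. emeasure L (B n) \<noteq> 0"
    and pos: "\<And>n x y. x \<in> A n \<Longrightarrow> y \<in> B n \<Longrightarrow> k x y \<noteq> 0"
    and "invariant \<mu>" "invariant \<nu>"
  shows "\<mu> = \<nu>"
proof -
  obtain f where f [measurable]: "f \<in> borel_measurable L" and f1: "(\<integral>\<^sup>+x. f x \<partial>L) = 1"
    and pf: "\<And>y. y \<in> space L \<Longrightarrow> push f y = f y" and \<mu>: "\<mu> = density L f"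
    using invariant_has_density[OF \<open>invariant \<mu>\<close>] by blast
  obtain g where g [measurable]: "g \<in> borel_measurable L" and g1: "(\<integral>\<^sup>+x. g x \<partial>L) = 1"
    and pg: "\<And>y. y \<in> space L \<Longrightarrow> push g y = g y" and \<nu>: "\<nu> = density L g"
    using invariant_has_density[OF \<open>invariant \<nu>\<close>] by blast
  define m where "m x = min (f x) (g x)" for x
  have m [measurable]: "m \<in> borel_measurable L" unfolding m_def by measurable
  have k_snd: "(\<lambda>x. k x y) \<in> borel_measurable L" if "y \<in> space L" for y
    using measurable_compose[OF measurable_Pair2'[OF that] k_measurable] by simp
  have push_mono: "push u y \<le> push v y" if "\<And>x. u x \<le> v x" for u v y
    unfolding push_def by (intro nn_integral_mono mult_right_mono that) auto
  have "(\<integral>\<^sup>+x. m x \<partial>L) \<le> 1"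
    unfolding f1[symmetric] by (intro nn_integral_mono) (simp add: m_def)
  then have mfin: "(\<integral>\<^sup>+x. m x \<partial>L) < \<infinity>" by (rule le_less_trans) simp
  have mm: "AE y in L. push m y = m y"
  proof (rule AE_eq_if_nn_integral_eq)
    show "AE y in L. push m y \<le> m y"
    proof (rule AE_I2)
      fix y assume y: "y \<in> space L"
      have "push m y \<le> push f y" "push m y \<le> push g y"
        by (intro push_mono; simp add: m_def)+
      then show "push m y \<le> m y" using pf[OF y] pg[OF y] by (simp add: m_def)
    qed
  qed (use mfin nn_integral_push_total[OF m] in auto)
  have mtop: "AE y in L. m y \<noteq> \<infinity>"
    using mfin by (intro nn_integral_noteq_infinite) auto
  \<comment> \<open>Additivity of \<open>push\<close> carries invariance over to the remainder;
    cancelling \<open>m y\<close> in the extended reals requires it to be finite, hence the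
    restriction to almost every \<open>y\<close>.\<close>
  have resid: "AE y in L. push (\<lambda>x. u x - m x) y = u y - m y"
    if [measurable]: "u \<in> borel_measurable L" and pu: "\<And>y. y \<in> space L \<Longrightarrow> push u y = u y"
      and ge: "\<And>x. m x \<le> u x" for u
    using mm mtop AE_space
  proof eventually_elim
    case (elim y)
    note [measurable] = k_snd[OF elim(3)]
    have "u y = push (\<lambda>x. (u x - m x) + m x) y"
      using pu[OF elim(3)] ge by (simp add: diff_add_cancel_ennreal)
    also have "\<dots> = push (\<lambda>x. u x - m x) y + push m y"
      unfolding push_def distrib_right by (intro nn_integral_add) measurable
    finally show ?case using elim by simp
  qed
  have nullA: "AE x in L. u x = 0" if "\<And>n. AE x in L. x \<in> A n \<longrightarrow> u x = 0" for u :: "'a \<Rightarrow> ennreal"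
  proof -
    have "AE x in L. \<forall>n. x \<in> A n \<longrightarrow> u x = 0" unfolding AE_all_countable using that by blast
    then show ?thesis using AE_space by eventually_elim (use A(2) in blast)
  qed
  have push_pos: "push u y \<noteq> 0"
    if [measurable]: "u \<in> borel_measurable L" and y: "y \<in> B n" and "\<not> (AE x in L. x \<in> A n \<longrightarrow> u x = 0)"
    for u y n
  proof
    assume "push u y = 0"
    have y': "y \<in> space L" using y B(1) sets.sets_into_space by blast
    note [measurable] = k_snd[OF y']
    from \<open>push u y = 0\<close> have "AE x in L. u x * k x y = 0"
      unfolding push_def by (subst (asm) nn_integral_0_iff_AE) auto
    then have "AE x in L. x \<in> A n \<longrightarrow> u x = 0"
      by eventually_elim (use pos y in auto)
    with that show False by simp
  qed
  define p where "p x = f x - m x" for x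
  define q where "q x = g x - m x" for x
  have [measurable]: "p \<in> borel_measurable L" "q \<in> borel_measurable L"
    unfolding p_def q_def by measurable
  have pq0: "AE x in L. p x = 0 \<or> q x = 0"
    using mtop
  proof eventually_elim
    case (elim x)
    then show ?case by (cases "f x \<le> g x") (auto simp: p_def q_def m_def min_def)
  qed
  have "(AE x in L. p x = 0) \<or> (AE x in L. q x = 0)"
  proof (rule ccontr)
    assume "\<not> ?thesis"
    then obtain n1 n2 where n1: "\<not> (AE x in L. x \<in> A n1 \<longrightarrow> p x = 0)"
      and n2: "\<not> (AE x in L. x \<in> A n2 \<longrightarrow> q x = 0)"
      using nullA by meson
    define n where "n = max n1 n2"
    have sub: "A n1 \<subseteq> A n" "A n2 \<subseteq> A n"
      unfolding n_def by (intro incseqD[OF A(1)]; simp)+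
    have np: "\<not> (AE x in L. x \<in> A n \<longrightarrow> p x = 0)"
      using n1 by (rule contrapos_nn) (erule eventually_mono, use sub in auto)
    have nq: "\<not> (AE x in L. x \<in> A n \<longrightarrow> q x = 0)"
      using n2 by (rule contrapos_nn) (erule eventually_mono, use sub in auto)
    have "AE y in L. push p y = p y" "AE y in L. push q y = q y"
      unfolding p_def[abs_def] q_def[abs_def]
      by (rule resid[OF f pf] resid[OF g pg]; simp add: m_def)+
    then have "AE y in L. y \<notin> B n"
      using pq0 by eventually_elim (use push_pos[OF _ _ np] push_pos[OF _ _ nq] in fastforce)
    moreover have "{y \<in> space L. \<not> y \<notin> B n} = B n"
      using sets.sets_into_space[OF B(1)[of n]] by auto
    ultimately have "emeasure L (B n) = 0"
      using AE_iff_measurable[OF B(1)[of n], of "\<lambda>y. y \<notin> B n"] by simp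
    with B(2) show False by simp
  qed
  then have "AE x in L. f x = g x"
  proof
    assume "AE x in L. p x = 0"
    then have "AE x in L. f x \<le> g x"
      using mtop by eventually_elim (simp add: p_def m_def diff_eq_0_iff_ennreal)
    then show ?thesis
      by (intro AE_eq_if_nn_integral_eq[OF f g]) (simp_all add: f1 g1)
  next
    assume "AE x in L. q x = 0"
    then have "AE x in L. g x \<le> f x"
      using mtop by eventually_elim (simp add: q_def m_def diff_eq_0_iff_ennreal)
    then have "AE x in L. g x = f x"
      by (intro AE_eq_if_nn_integral_eq[OF g f]) (simp_all add: f1 g1)
    then show ?thesis by eventually_elim simp
  qed
  then show ?thesis unfolding \<mu> \<nu> by (intro density_cong f g)
qed

end

section \<open>Positivity of eigenfunctions\<close>

lemma AE_meets_interval: "a < b \<Longrightarrow> \<not> (AE y in lborel. y \<notin> {a<..<b :: real})"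
proof
  assume "a < b" and *: "AE y in lborel. y \<notin> {a<..<b}"
  have "{y \<in> space lborel. \<not> y \<notin> {a<..<b}} = {a<..<b}" by auto
  then have "(AE y in lborel. y \<notin> {a<..<b}) \<longleftrightarrow> emeasure lborel {a<..<b} = 0"
    by (rule AE_iff_measurable[rotated]) simp
  with * have "emeasure lborel {a<..<b} = 0" by (simp only:)
  with \<open>a < b\<close> show False by simp
qed

lemma positive_if_nonzero:
  fixes f :: "real \<Rightarrow> real"
  assumes cont: "continuous_on {..b} f" and nz: "\<And>y. y \<le> b \<Longrightarrow> f y \<noteq> 0" and lim: "(f \<longlongrightarrow> 1) at_bot"
  shows "0 < f b"
proof (rule ccontr)
  assume "\<not> 0 < f b"
  have "\<forall>\<^sub>F y in at_bot. 0 < f y \<and> y \<le> b"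
    using order_tendstoD(1)[OF lim, of 0] eventually_le_at_bot[of b] by (simp add: eventually_conj_iff)
  then obtain a where a: "0 < f a" "a \<le> b"
    using eventually_happens'[OF trivial_limit_at_bot_linorder] by blast
  have "continuous_on {a..b} f" by (rule continuous_on_subset[OF cont]) auto
  then obtain x where "x \<le> b" "f x = 0"
    using IVT2'[of f b 0 a] a \<open>\<not> 0 < f b\<close> by auto
  then show False using nz by blast
qed

text \<open>\<open>w\<close> is the weight \<phi> / \<lambda>, so that both equations have
  eigenvalue 1. No sign of \<open>h\<close> is assumed; \<open>g\<close> is the nonnegative adjoint
  eigenfunction. \<open>Tadj\<close> is restricted to points with \<open>w y \<noteq> 0\<close>
  because the exponential solution used on the negative half-line satisfies it only for negative
  \<open>y\<close>.\<close>

locale eigen_pair =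
  fixes h w g :: "real \<Rightarrow> real" and \<theta> :: real
  assumes h_measurable [measurable]: "h \<in> borel_measurable borel"
    and w_measurable [measurable]: "w \<in> borel_measurable borel"
    and g_measurable [measurable]: "g \<in> borel_measurable borel"
    and w: "\<And>x. 0 \<le> w x" and g: "\<And>x. 0 \<le> g x"
    and T: "\<And>x. integral\<^sup>L lborel (\<lambda>y. indicator {\<theta> * x<..} y * (h y * w y)) = h x"
    and Tadj: "\<And>y. w y \<noteq> 0 \<Longrightarrow>
      (\<integral>\<^sup>+x. ennreal (indicator {\<theta> * x<..} y * (g x * w x)) \<partial>lborel) = ennreal (g y)"
    and fin: "(\<integral>\<^sup>+x. ennreal (w x * g x * \<bar>h x\<bar>) \<partial>lborel) < \<infinity>"
begin

definition Th :: "real \<Rightarrow> ennreal" where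
  "Th x = (\<integral>\<^sup>+y. ennreal (indicator {\<theta> * x<..} y * (\<bar>h y\<bar> * w y)) \<partial>lborel)"

text \<open>The triangle inequality gives \<open>\<bar>h\<bar> \<le> Th\<close> everywhere.
  Integrated against \<open>w * g\<close>, both sides have the same value by Fubini and the adjoint
  equation, and this value is finite; so the inequality is an equality almost everywhere on the set
  where \<open>w * g\<close> is positive.\<close>

lemma abs_eigen_AE: "AE x in lborel. 0 < w x * g x \<longrightarrow> ennreal \<bar>h x\<bar> = Th x"
proof -
  have ind: "indicator {\<theta> * x<..} y = (if \<theta> * x < y then 1 else (0::real))" for x y
    by (simp add: indicator_def)
  have [measurable]: "Th \<in> borel_measurable borel"
    unfolding Th_def ind by measurable
  have le: "ennreal \<bar>h x\<bar> \<le> Th x" for x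
  proof -
    have "ennreal \<bar>h x\<bar> = ennreal (norm (integral\<^sup>L lborel (\<lambda>y. indicator {\<theta> * x<..} y * (h y * w y))))"
      by (simp add: T)
    also have "\<dots> \<le> (\<integral>\<^sup>+y. ennreal (norm (indicator {\<theta> * x<..} y * (h y * w y))) \<partial>lborel)"
    \<comment> \<open>Without integrability the Bochner integral is 0 by convention and the bound is
      trivial.\<close>
    proof (cases "integrable lborel (\<lambda>y. indicator {\<theta> * x<..} y * (h y * w y))")
      case True then show ?thesis by (rule integral_norm_bound_ennreal)
    qed (simp add: not_integrable_integral_eq)
    also have "\<dots> = Th x"
      unfolding Th_def by (intro nn_integral_cong) (simp add: abs_mult w abs_indicator)
    finally show ?thesis .
  qed
  have "(\<integral>\<^sup>+x. ennreal (w x * g x) * Th x \<partial>lborel) =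
      (\<integral>\<^sup>+x. (\<integral>\<^sup>+y. ennreal (w x * g x) * ennreal (indicator {\<theta> * x<..} y * (\<bar>h y\<bar> * w y)) \<partial>lborel) \<partial>lborel)"
    unfolding Th_def ind by (intro nn_integral_cong nn_integral_cmult[symmetric]) measurable
  also have "\<dots> = (\<integral>\<^sup>+y. (\<integral>\<^sup>+x. ennreal (w x * g x) * ennreal (indicator {\<theta> * x<..} y * (\<bar>h y\<bar> * w y)) \<partial>lborel) \<partial>lborel)"
    unfolding ind by (rule lborel_pair.Fubini') measurable
  also have "\<dots> = (\<integral>\<^sup>+y. ennreal (\<bar>h y\<bar> * w y) * (\<integral>\<^sup>+x. ennreal (indicator {\<theta> * x<..} y * (g x * w x)) \<partial>lborel) \<partial>lborel)"
    unfolding ind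
    by (subst nn_integral_cmult[symmetric], measurable)
       (auto intro!: nn_integral_cong simp: ennreal_mult'[symmetric] w g mult_ac simp flip: ennreal_mult)
  also have "\<dots> = (\<integral>\<^sup>+y. ennreal (w y * g y * \<bar>h y\<bar>) \<partial>lborel)"
  proof (rule nn_integral_cong)
    fix y
    show "ennreal (\<bar>h y\<bar> * w y) * (\<integral>\<^sup>+x. ennreal (indicator {\<theta> * x<..} y * (g x * w x)) \<partial>lborel)
        = ennreal (w y * g y * \<bar>h y\<bar>)"
    proof (cases "w y = 0")
      case False
      show ?thesis
        unfolding Tadj[OF False] by (simp add: w g ennreal_mult[symmetric] mult_ac)
    qed simp
  qed
  finally have int: "(\<integral>\<^sup>+x. ennreal (w x * g x) * Th x \<partial>lborel) = (\<integral>\<^sup>+y. ennreal (w y * g y * \<bar>h y\<bar>) \<partial>lborel)" .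
  have "AE x in lborel. ennreal (w x * g x * \<bar>h x\<bar>) = ennreal (w x * g x) * Th x"
  proof (rule AE_eq_if_nn_integral_eq)
    show "AE x in lborel. ennreal (w x * g x * \<bar>h x\<bar>) \<le> ennreal (w x * g x) * Th x"
      using le w g by (intro AE_I2) (simp add: ennreal_mult mult_left_mono)
  qed (use int fin in auto)
  then show ?thesis
  proof eventually_elim
    case (elim x)
    show ?case
    proof
      assume "0 < w x * g x"
      with elim show "ennreal \<bar>h x\<bar> = Th x"
        by (auto simp: ennreal_mult ennreal_mult_cancel_left)
    qed
  qed
qed

text \<open>
  The Perron--Frobenius step: \<open>\<bar>h\<bar>\<close> inherits the eigenvalue equation, and the right-hand side of that
  equation is monotone, so that a zero of \<open>h\<close> kills the whole integral.
\<close>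

lemma zero_propagates:
  assumes "\<theta> \<noteq> 0" "open U" "z \<in> U" and U: "AE x in lborel. x \<in> U \<longrightarrow> 0 < w x * g x"
    and cont: "(h \<longlongrightarrow> h z) (at z within {x. \<theta> * x < \<theta> * z})" and "h z = 0"
  shows "AE y in lborel. \<theta> * z < y \<longrightarrow> h y * w y = 0"
proof -
  have good: "AE x in lborel. x \<in> U \<longrightarrow> ennreal \<bar>h x\<bar> = Th x"
    using abs_eigen_AE U by eventually_elim auto
  have small: "Th z \<le> ennreal e" if "e > 0" for e
  proof -
    from cont \<open>h z = 0\<close> \<open>e > 0\<close> have "\<forall>\<^sub>F x in at z within {x. \<theta> * x < \<theta> * z}. \<bar>h x\<bar> < e"
      by (auto simp: tendsto_iff dist_real_def)
    then obtain d where d: "d > 0" "\<And>x. \<theta> * x < \<theta> * z \<Longrightarrow> x \<noteq> z \<Longrightarrow> dist x z < d \<Longrightarrow> \<bar>h x\<bar> < e"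
      by (auto simp: eventually_at)
    from \<open>open U\<close> \<open>z \<in> U\<close> obtain d' where d': "d' > 0" "ball z d' \<subseteq> U"
      by (auto simp: open_contains_ball)
    \<comment> \<open>\<open>V\<close> is the side of \<open>z\<close> on which
      \<open>{\<theta> * x<..}\<close> contains \<open>{\<theta> * z<..}\<close>, so that
      \<open>Th z \<le> Th x\<close>. As \<open>Th x = \<bar>h x\<bar>\<close> is known only almost
      everywhere, \<open>V\<close> has to be shown not to be a null set before a point can be picked
      from it.\<close>
    define V where "V = {x. \<theta> * x < \<theta> * z} \<inter> ball z (min d d')"
    have "open V" unfolding V_def by (intro open_Int open_Collect_less continuous_intros) auto
    moreover have "z - sgn \<theta> * (min d d' / 2) \<in> V"
    proof -
      have "\<theta> * (sgn \<theta> * (min d d' / 2)) > 0"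
        using d d' \<open>\<theta> \<noteq> 0\<close> by (simp add: sgn_if mult_neg_neg zero_less_mult_iff)
      then show ?thesis using d d' \<open>\<theta> \<noteq> 0\<close>
        by (auto simp: V_def dist_real_def algebra_simps abs_mult sgn_if)
    qed
    ultimately have "\<not> negligible V" using open_not_negligible by blast
    then have "\<not> (AE x in lborel. x \<notin> V)"
      using \<open>open V\<close> AE_iff_null_sets[of V lborel] by (auto simp: negligible_iff_null_sets null_sets_completionI)
    have "\<exists>x. x \<in> V \<and> (x \<in> U \<longrightarrow> ennreal \<bar>h x\<bar> = Th x)"
    proof (rule ccontr)
      assume *: "\<not> ?thesis"
      from good have "AE x in lborel. x \<notin> V" by eventually_elim (use * in blast)
      with \<open>\<not> (AE x in lborel. x \<notin> V)\<close> show False by blast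
    qed
    then obtain x where x: "x \<in> V" "x \<in> U \<longrightarrow> ennreal \<bar>h x\<bar> = Th x" by blast
    have "\<theta> * x < \<theta> * z" "x \<noteq> z" "x \<in> U" using x d' by (auto simp: V_def)
    have "Th z \<le> Th x"
      unfolding Th_def using \<open>\<theta> * x < \<theta> * z\<close>
      by (intro nn_integral_mono ennreal_leI mult_right_mono) (auto simp: indicator_def w)
    also have "\<dots> = ennreal \<bar>h x\<bar>" using x \<open>x \<in> U\<close> by simp
    also have "\<dots> \<le> ennreal e"
      using d(2)[of x] x \<open>\<theta> * x < \<theta> * z\<close> \<open>x \<noteq> z\<close> by (intro ennreal_leI less_imp_le) (auto simp: V_def dist_commute)
    finally show ?thesis .
  qed
  have "Th z = 0"
  proof -
    have "Th z \<le> 0"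
      by (rule ennreal_le_epsilon) (use small in auto)
    then show ?thesis by simp
  qed
  then have "AE y in lborel. indicator {\<theta> * z<..} y * (\<bar>h y\<bar> * w y) \<le> 0"
    unfolding Th_def by (subst (asm) nn_integral_0_iff_AE) (auto simp: ennreal_eq_0_iff)
  then show ?thesis
    by eventually_elim (auto simp: indicator_def mult_le_0_iff w dest: antisym[OF _ w] split: if_splits)
qed

end

section \<open>Discounted sums of exponential variables\<close>

text \<open>The transition density of one affine step, from \<open>x\<close> to
  \<open>\<eta> * x + (1 - \<eta>) * e\<close> with \<open>e\<close> standard exponential; this
  explains the rate \<open>1 / (1 - \<eta>)\<close>.\<close>

definition exp_kernel :: "real \<Rightarrow> real \<Rightarrow> real \<Rightarrow> ennreal" where
  "exp_kernel \<eta> x y = ennreal (exponential_density (1 / (1 - \<eta>)) (y - \<eta> * x))"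

lemma exp_kernel_measurable [measurable]: "case_prod (exp_kernel \<eta>) \<in> borel_measurable (borel \<Otimes>\<^sub>M borel)"
  unfolding exp_kernel_def exponential_density_def by measurable

lemma emeasure_exp_kernel:
  assumes \<eta>: "\<eta> < 1" and [measurable]: "B \<in> sets borel"
  shows "emeasure (density lborel (exp_kernel \<eta> x)) B =
    (\<integral>\<^sup>+e. indicator B (\<eta> * x + (1 - \<eta>) * e) \<partial>density lborel (exponential_density 1))"
proof -
  have [measurable]: "exp_kernel \<eta> x \<in> borel_measurable borel"
    using measurable_compose_Pair1[OF _ exp_kernel_measurable, of x \<eta>] by simp
  have "emeasure (density lborel (exp_kernel \<eta> x)) B = (\<integral>\<^sup>+y. exp_kernel \<eta> x y * indicator B y \<partial>lborel)"
    by (simp add: emeasure_density)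
  also have "\<dots> = ennreal \<bar>1 - \<eta>\<bar> * (\<integral>\<^sup>+e. exp_kernel \<eta> x (\<eta> * x + (1 - \<eta>) * e) * indicator B (\<eta> * x + (1 - \<eta>) * e) \<partial>lborel)"
    using \<eta> by (intro nn_integral_real_affine) auto
  also have "\<dots> = (\<integral>\<^sup>+e. ennreal \<bar>1 - \<eta>\<bar> * (exp_kernel \<eta> x (\<eta> * x + (1 - \<eta>) * e) * indicator B (\<eta> * x + (1 - \<eta>) * e)) \<partial>lborel)"
    by (rule nn_integral_cmult[symmetric]) measurable
  also have "\<dots> = (\<integral>\<^sup>+e. ennreal (exponential_density 1 e) * indicator B (\<eta> * x + (1 - \<eta>) * e) \<partial>lborel)"
  proof (rule nn_integral_cong)
    fix e :: real
    have "\<bar>1 - \<eta>\<bar> * exponential_density (1 / (1 - \<eta>)) (\<eta> * x + (1 - \<eta>) * e - \<eta> * x) = exponential_density 1 e"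
      using \<eta> by (auto simp: exponential_density_def mult_less_0_iff)
    then show "ennreal \<bar>1 - \<eta>\<bar> * (exp_kernel \<eta> x (\<eta> * x + (1 - \<eta>) * e) * indicator B (\<eta> * x + (1 - \<eta>) * e))
        = ennreal (exponential_density 1 e) * indicator B (\<eta> * x + (1 - \<eta>) * e)"
      unfolding exp_kernel_def mult.assoc[symmetric]
      by (subst ennreal_mult[symmetric]) (use \<eta> in \<open>auto intro!: exponential_density_nonneg\<close>)
  qed
  also have "\<dots> = (\<integral>\<^sup>+e. indicator B (\<eta> * x + (1 - \<eta>) * e) \<partial>density lborel (exponential_density 1))"
    by (subst nn_integral_density) (auto simp: exponential_density_def)
  finally show ?thesis .
qed

lemma markov_density_exp_kernel:
  assumes "\<eta> < 1" shows "markov_density lborel (exp_kernel \<eta>)"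
proof unfold_locales
  have [measurable]: "exp_kernel \<eta> x \<in> borel_measurable borel" for x
    using measurable_compose_Pair1[OF _ exp_kernel_measurable, of x \<eta>] by simp
  show "case_prod (exp_kernel \<eta>) \<in> borel_measurable (lborel \<Otimes>\<^sub>M lborel)"
    by measurable
  fix x :: real
  interpret e: prob_space "density lborel (exponential_density 1)"
    by (rule prob_space_exponential_density) simp
  show "(\<integral>\<^sup>+y. exp_kernel \<eta> x y \<partial>lborel) = 1"
    using emeasure_exp_kernel[OF assms, of UNIV x] e.emeasure_space_1
    by (simp add: emeasure_density)
qed

lemma exp_kernel_unique:
  assumes "\<eta> < 1" "markov_density.invariant lborel (exp_kernel \<eta>) \<mu>"
    "markov_density.invariant lborel (exp_kernel \<eta>) \<nu>"
  shows "\<mu> = \<nu>"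
proof -
  interpret markov_density lborel "exp_kernel \<eta>" by (rule markov_density_exp_kernel) fact
  show ?thesis
  proof (rule invariant_unique[OF _ _ _ _ _ _ assms(2,3)])
    show "incseq (\<lambda>n. {x. \<eta> * x \<le> real n})"
      by (auto simp: incseq_def)
    show "space lborel \<subseteq> (\<Union>n. {x. \<eta> * x \<le> real n})"
      using real_arch_simple by auto
    show "emeasure lborel {real n<..<real n + 1} \<noteq> 0" for n by simp
    show "exp_kernel \<eta> x y \<noteq> 0" if "x \<in> {x. \<eta> * x \<le> real n}" "y \<in> {real n<..<real n + 1}" for n x y
      using that assms(1) by (auto simp: exp_kernel_def exponential_density_def)
  qed auto
qed

context prob_space
begin

text \<open>Splitting off the first term gives \<open>X = E 1 + \<eta> * Y\<close>, where
  \<open>Y\<close> is the same functional of the shifted sequence: it is independent of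
  \<open>E 1\<close> and, the sequence being i.i.d., has the law of \<open>X\<close>. Multiplied by
  \<open>1 - \<eta>\<close>, this is the stationarity equation of the affine chain.\<close>

lemma discounted_sum_invariant:
  fixes E :: "nat \<Rightarrow> 'a \<Rightarrow> real" and \<eta> :: real
  assumes ind: "indep_vars (\<lambda>_. borel) E {1..}"
    and E: "\<And>k. k \<ge> 1 \<Longrightarrow> distributed M lborel (E k) (exponential_density 1)"
    and \<eta>: "0 \<le> \<eta>" "\<eta> < 1"
  defines "S \<equiv> \<lambda>\<omega>. (1 - \<eta>) * (\<Sum>k. \<eta> ^ k * E (k + 1) \<omega>)"
  shows "random_variable borel S" and "AE \<omega> in M. 0 \<le> S \<omega>"
    and "markov_density.invariant lborel (exp_kernel \<eta>) (distr M borel S)"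
proof -
  define \<epsilon> where "\<epsilon> = density lborel (\<lambda>x. ennreal (exponential_density 1 x))"
  have rv: "random_variable borel (E k)" if "k \<ge> 1" for k
    using distributed_measurable[OF E[OF that]] by simp
  have [measurable]: "random_variable borel (E (Suc k))" for k by (rule rv) simp
  have law: "distr M borel (E k) = \<epsilon>" if "k \<ge> 1" for k
    using E[OF that] unfolding distributed_def \<epsilon>_def
    by (metis (no_types, lifting) distr_cong sets_lborel)
  have pos: "AE \<omega> in M. 0 \<le> E (Suc k) \<omega>" for k
  proof -
    have "AE x in \<epsilon>. 0 \<le> x"
      unfolding \<epsilon>_def by (subst AE_density) (auto simp: exponential_density_def)
    then have "AE x in distr M borel (E (Suc k)). 0 \<le> x" by (subst law) auto
    then show ?thesis by (subst (asm) AE_distr_iff) auto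
  qed
  have mean: "(\<integral>\<^sup>+\<omega>. ennreal (E (Suc k) \<omega>) \<partial>M) = 1" for k
    using nn_integral_erlang_ith_moment[of 1 0 1]
    by (subst distributed_nn_integral[OF E[of "Suc k"], symmetric])
      (auto simp: ennreal_mult'[symmetric] exponential_density_nonneg)
  show S [measurable]: "random_variable borel S"
    unfolding S_def Suc_eq_plus1[symmetric] by measurable
  have "(\<integral>\<^sup>+\<omega>. (\<Sum>k. ennreal (\<eta> ^ k * E (Suc k) \<omega>)) \<partial>M) = (\<Sum>k. \<integral>\<^sup>+\<omega>. ennreal (\<eta> ^ k * E (Suc k) \<omega>) \<partial>M)"
    by (rule nn_integral_suminf) measurable
  also have "\<dots> = (\<Sum>k. ennreal (\<eta> ^ k))"
    using \<eta> by (simp add: ennreal_mult' nn_integral_cmult mean)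
  also have "\<dots> = ennreal (\<Sum>k. \<eta> ^ k)"
    using \<eta> by (intro suminf_ennreal2 summable_geometric) auto
  finally have "(\<integral>\<^sup>+\<omega>. (\<Sum>k. ennreal (\<eta> ^ k * E (Suc k) \<omega>)) \<partial>M) \<noteq> \<infinity>" by simp
  then have "AE \<omega> in M. (\<Sum>k. ennreal (\<eta> ^ k * E (Suc k) \<omega>)) \<noteq> \<infinity>"
    by (intro nn_integral_noteq_infinite) measurable
  moreover have posA: "AE \<omega> in M. \<forall>k. 0 \<le> E (Suc k) \<omega>"
    using pos by (simp add: AE_all_countable)
  \<comment> \<open>The terms are nonnegative, so a finite expected sum forces almost sure
    convergence; where the series diverges, the value of \<open>suminf\<close> carries no
    information.\<close>
  ultimately have summ: "AE \<omega> in M. summable (\<lambda>k. \<eta> ^ k * E (Suc k) \<omega>)"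
    by eventually_elim (use \<eta> in \<open>auto intro!: summable_suminf_not_top\<close>)
  show S0: "AE \<omega> in M. 0 \<le> S \<omega>"
    using summ posA unfolding S_def by eventually_elim (use \<eta> in \<open>auto intro!: mult_nonneg_nonneg suminf_nonneg\<close>)

  define F where "F f = (\<Sum>k. \<eta> ^ k * f (Suc k))" for f :: "nat \<Rightarrow> real"
  define Y where "Y \<omega> = (\<Sum>k. \<eta> ^ k * E (Suc (Suc k)) \<omega>)" for \<omega>
  define X where "X \<omega> = (\<Sum>k. \<eta> ^ k * E (Suc k) \<omega>)" for \<omega>
  have [measurable]: "random_variable borel X" "random_variable borel Y"
    unfolding X_def Y_def by measurable
  have FM [measurable]: "F \<in> borel_measurable (PiM {1..} (\<lambda>_. borel))"
    unfolding F_def by measurable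
  have rvZ: "(\<lambda>\<omega>. \<lambda>i\<in>{1..}. E i \<omega>) \<in> M \<rightarrow>\<^sub>M PiM {1..} (\<lambda>_. borel)"
    "(\<lambda>\<omega>. \<lambda>i\<in>{1..}. E (Suc i) \<omega>) \<in> M \<rightarrow>\<^sub>M PiM {1..} (\<lambda>_. borel)"
    using rv by (auto intro!: measurable_restrict)
  interpret \<epsilon>: prob_space \<epsilon> unfolding \<epsilon>_def by (rule prob_space_exponential_density) simp
  have \<epsilon>sets [measurable_cong]: "sets \<epsilon> = sets borel" by (simp add: \<epsilon>_def)
  have Z: "distr M (PiM {1..} (\<lambda>_. borel)) (\<lambda>\<omega>. \<lambda>i\<in>{1..}. E i \<omega>) = PiM {1..} (\<lambda>_. \<epsilon>)"
  proof -
    have "distr M (PiM {1..} (\<lambda>_. borel)) (\<lambda>\<omega>. \<lambda>i\<in>{1..}. E i \<omega>) = PiM {1..} (\<lambda>i. distr M borel (E i))"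
      using ind rv by (subst indep_vars_iff_distr_eq_PiM'[symmetric]) auto
    also have "\<dots> = PiM {1..} (\<lambda>_. \<epsilon>)" by (intro PiM_cong) (auto simp: law)
    finally show ?thesis .
  qed
  \<comment> \<open>The shift maps the index set \<open>{1..}\<close> injectively into itself, so
    the law of the shifted sequence is again the product of copies of
    \<open>\<epsilon>\<close>.\<close>
  have shift: "(\<lambda>f. \<lambda>i\<in>{1..}. f (Suc i)) \<in> PiM {1..} (\<lambda>_. borel) \<rightarrow>\<^sub>M PiM {1..} (\<lambda>_. borel :: real measure)"
    by (intro measurable_restrict measurable_component_singleton) auto
  have "distr M (PiM {1..} (\<lambda>_. borel)) (\<lambda>\<omega>. \<lambda>i\<in>{1..}. E (Suc i) \<omega>) =
      distr (distr M (PiM {1..} (\<lambda>_. borel)) (\<lambda>\<omega>. \<lambda>i\<in>{1..}. E i \<omega>)) (PiM {1..} (\<lambda>_. borel))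
        (\<lambda>f. \<lambda>i\<in>{1..}. f (Suc i))"
    by (subst distr_distr[OF shift rvZ(1)]) (auto simp: o_def intro!: distr_cong)
  also have "\<dots> = distr (PiM {1..} (\<lambda>_. \<epsilon>)) (PiM {1..} (\<lambda>_. \<epsilon>)) (\<lambda>f. \<lambda>i\<in>{1..}. f (Suc i))"
    unfolding Z by (intro distr_cong sets_PiM_cong) (auto simp: \<epsilon>sets)
  also have "\<dots> = PiM {1..} (\<lambda>_. \<epsilon>)"
    by (rule distr_PiM_reindex) (auto intro: \<epsilon>.prob_space_axioms)
  finally have "distr (distr M (PiM {1..} (\<lambda>_. borel)) (\<lambda>\<omega>. \<lambda>i\<in>{1..}. E i \<omega>)) borel F =
      distr (distr M (PiM {1..} (\<lambda>_. borel)) (\<lambda>\<omega>. \<lambda>i\<in>{1..}. E (Suc i) \<omega>)) borel F" by (simp only: Z)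
  then have XY: "distr M borel Y = distr M borel X"
    unfolding distr_distr[OF FM rvZ(1)] distr_distr[OF FM rvZ(2)]
    by (simp add: o_def F_def X_def[abs_def] Y_def[abs_def])
  have "indep_var borel ((\<lambda>f. f 1) \<circ> (\<lambda>\<omega>. restrict (\<lambda>i. E i \<omega>) {1})) borel
      ((\<lambda>f. \<Sum>k. \<eta> ^ k * f (Suc (Suc k))) \<circ> (\<lambda>\<omega>. restrict (\<lambda>i. E i \<omega>) {2..}))"
    by (rule indep_var_compose[OF indep_var_restrict[OF ind]]) auto
  then have indXY: "indep_var borel (E 1) borel Y"
    by (simp add: o_def Y_def[abs_def])
  then have pair: "distr M borel (E 1) \<Otimes>\<^sub>M distr M borel Y = distr M (borel \<Otimes>\<^sub>M borel) (\<lambda>\<omega>. (E 1 \<omega>, Y \<omega>))"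
    by (simp add: indep_var_distribution_eq)
  have rec: "AE \<omega> in M. X \<omega> = E 1 \<omega> + \<eta> * Y \<omega>"
    using summ
  proof eventually_elim
    case (elim \<omega>)
    have s: "summable (\<lambda>k. \<eta> ^ Suc k * E (Suc (Suc k)) \<omega>)"
      using elim by (subst summable_Suc_iff) simp
    have "X \<omega> = E 1 \<omega> + (\<Sum>k. \<eta> ^ Suc k * E (Suc (Suc k)) \<omega>)"
      unfolding X_def using suminf_split_head[OF elim] by simp
    also have "(\<Sum>k. \<eta> ^ Suc k * E (Suc (Suc k)) \<omega>) = \<eta> * Y \<omega>"
    \<comment> \<open>Summability of the series of \<open>Y\<close> is inherited from that of
      \<open>X\<close> by dividing by \<open>\<eta>\<close>; for \<open>\<eta> = 0\<close> both
      sides vanish.\<close>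
    proof (cases "\<eta> = 0")
      case False
      have "summable (\<lambda>k. \<eta> ^ k * E (Suc (Suc k)) \<omega>)"
        using summable_mult[OF s, of "1 / \<eta>"] False by (simp add: field_simps)
      then show ?thesis unfolding Y_def by (subst suminf_mult[symmetric]) (auto simp: mult_ac)
    qed simp
    finally show ?case .
  qed
  have SX: "S = (\<lambda>\<omega>. (1 - \<eta>) * X \<omega>)" by (simp add: S_def X_def)
  interpret Yd: prob_space "distr M borel Y" by (rule prob_space_distr) measurable
  interpret P: pair_sigma_finite \<epsilon> "distr M borel Y" ..
  interpret K: markov_density lborel "exp_kernel \<eta>" by (rule markov_density_exp_kernel) fact
  show "markov_density.invariant lborel (exp_kernel \<eta>) (distr M borel S)"
    unfolding K.invariant_def
  proof (intro conjI ballI)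
    show "prob_space (distr M borel S)" by (rule prob_space_distr) measurable
    fix B assume "B \<in> sets (lborel :: real measure)"
    then have B [measurable]: "B \<in> sets borel" by simp
    have "emeasure (distr M borel S) B = (\<integral>\<^sup>+\<omega>. indicator B (S \<omega>) \<partial>M)"
      by (simp add: nn_integral_distr flip: nn_integral_indicator)
    also have "\<dots> = (\<integral>\<^sup>+\<omega>. indicator B ((1 - \<eta>) * (E 1 \<omega> + \<eta> * Y \<omega>)) \<partial>M)"
      using rec by (intro nn_integral_cong_AE) (auto simp: SX)
    also have "\<dots> = (\<integral>\<^sup>+z. indicator B ((1 - \<eta>) * (fst z + \<eta> * snd z)) \<partial>distr M (borel \<Otimes>\<^sub>M borel) (\<lambda>\<omega>. (E 1 \<omega>, Y \<omega>)))"
      by (subst nn_integral_distr) auto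
    also have "\<dots> = (\<integral>\<^sup>+z. indicator B ((1 - \<eta>) * (fst z + \<eta> * snd z)) \<partial>(\<epsilon> \<Otimes>\<^sub>M distr M borel Y))"
      by (simp only: pair[symmetric] law[OF order_refl])
    also have "\<dots> = (\<integral>\<^sup>+y. (\<integral>\<^sup>+e. indicator B ((1 - \<eta>) * (e + \<eta> * y)) \<partial>\<epsilon>) \<partial>distr M borel Y)"
      by (subst P.nn_integral_snd[symmetric]) (auto simp: case_prod_unfold)
    also have "\<dots> = (\<integral>\<^sup>+y. emeasure (density lborel (exp_kernel \<eta> ((1 - \<eta>) * y))) B \<partial>distr M borel Y)"
      using \<eta> by (intro nn_integral_cong) (simp add: emeasure_exp_kernel \<epsilon>_def algebra_simps)
    also have "\<dots> = (\<integral>\<^sup>+x. emeasure (density lborel (exp_kernel \<eta> x)) B \<partial>distr M borel S)"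
    proof -
      have [measurable]: "(\<lambda>x. emeasure (density lborel (exp_kernel \<eta> x)) B) \<in> borel_measurable borel"
        using measurable_compose[OF measurable_prob_algebraD[OF K.kernel_in_prob_algebra]
          measurable_emeasure_subprob_algebra, of B] by simp
      show ?thesis unfolding XY SX by (simp add: nn_integral_distr)
    qed
    finally show "(\<integral>\<^sup>+x. emeasure (density lborel (exp_kernel \<eta> x)) B \<partial>distr M borel S) = emeasure (distr M borel S) B" ..
  qed simp
qed

end

section \<open>Poisson mixtures and exponential series\<close>

text \<open>For real \<open>t \<ge> 0\<close> this is the expectation of \<open>s\<close> at a
  Poisson variable of mean \<open>t\<close>. The field is general because derivatives and limits are
  taken for complex values, positivity for real ones.\<close>

definition poisson_mix :: "(nat \<Rightarrow> 'a) \<Rightarrow> 'a \<Rightarrow> 'a :: {banach, real_normed_field}" where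
  "poisson_mix s t = exp (- t) * (\<Sum>m. t ^ m / fact m * s m)"

lemma summable_poisson_mix:
  fixes s :: "nat \<Rightarrow> 'a :: {banach, real_normed_field}"
  assumes "\<And>m. norm (s m) \<le> B"
  shows "summable (\<lambda>m. norm (t ^ m / fact m * s m))"
proof (rule summable_comparison_test'[where N = 0])
  show "summable (\<lambda>m. norm t ^ m / fact m * B)"
    using summable_exp[of "norm t"] by (intro summable_mult2) (simp add: field_simps)
  show "norm (norm (t ^ m / fact m * s m)) \<le> norm t ^ m / fact m * B" for m
    using assms[of m] by (simp add: norm_mult norm_divide norm_power mult_left_mono divide_right_mono)
qed

text \<open>Differentiating \<open>t ^ m / fact m\<close> shifts the index, and the factor
  \<open>exp (- t)\<close> subtracts the unshifted sum: the forward difference is the generator of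
  the Poisson process. When \<open>s (Suc m) - s m\<close> is a multiple of
  \<open>q ^ m * s m\<close>, \<open>poisson_mix_scale\<close> turns the derivative into the same
  mixture at \<open>q * t\<close>; this is the source of the delay equations for parameters below
  1.\<close>

lemma poisson_mix_deriv:
  fixes s :: "nat \<Rightarrow> 'a :: {banach, real_normed_field}"
  assumes s: "\<And>m. norm (s m) \<le> B"
  shows "(poisson_mix s has_field_derivative poisson_mix (\<lambda>m. s (Suc m) - s m) t) (at t)"
proof -
  have sm: "summable (\<lambda>m. s m / fact m * y ^ m)" for y
    using summable_norm_cancel[OF summable_poisson_mix[of s B y, OF s]] by (simp add: mult_ac)
  have sm': "summable (\<lambda>m. s (Suc m) / fact m * y ^ m)" for y
    using summable_norm_cancel[OF summable_poisson_mix[of "\<lambda>m. s (Suc m)" B y, OF s]] by (simp add: mult_ac)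
  have df: "diffs (\<lambda>m. s m / fact m) = (\<lambda>m. s (Suc m) / fact m)"
  proof
    fix m
    have "(of_nat (Suc m) :: 'a) \<noteq> 0" by (simp only: of_nat_neq_0 not_False_eq_True)
    then show "diffs (\<lambda>m. s m / fact m) m = s (Suc m) / fact m"
      by (simp add: diffs_def fact_Suc del: of_nat_Suc)
  qed
  have eq: "poisson_mix u = (\<lambda>t. exp (- t) * (\<Sum>m. u m / fact m * t ^ m))" for u :: "nat \<Rightarrow> 'a"
    by (simp add: poisson_mix_def fun_eq_iff mult_ac)
  have "((\<lambda>t. \<Sum>m. s m / fact m * t ^ m) has_field_derivative (\<Sum>m. s (Suc m) / fact m * t ^ m)) (at t)"
    using termdiffs_strong_converges_everywhere[OF sm] by (simp add: df)
  then have "((\<lambda>t. exp (- t) * (\<Sum>m. s m / fact m * t ^ m)) has_field_derivative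
      (exp (- t) * (\<Sum>m. s (Suc m) / fact m * t ^ m) - exp (- t) * (\<Sum>m. s m / fact m * t ^ m))) (at t)"
    by (auto intro!: derivative_eq_intros)
  also have "exp (- t) * (\<Sum>m. s (Suc m) / fact m * t ^ m) - exp (- t) * (\<Sum>m. s m / fact m * t ^ m)
      = exp (- t) * (\<Sum>m. (s (Suc m) - s m) / fact m * t ^ m)"
    unfolding right_diff_distrib[symmetric] suminf_diff[OF sm' sm]
    by (simp add: diff_divide_distrib left_diff_distrib)
  finally show ?thesis by (simp add: eq)
qed

lemma poisson_mix_0 [simp]: "poisson_mix s 0 = s 0"
proof -
  have "(\<lambda>m. 0 ^ m / fact m * s m) = (\<lambda>m. if m = 0 then s 0 else 0)" by auto
  then show ?thesis
    using sums_single[of 0 "\<lambda>_. s 0"] by (simp add: poisson_mix_def sums_iff)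
qed

lemma poisson_mix_pos:
  fixes s :: "nat \<Rightarrow> real"
  assumes "\<And>m. norm (s m) \<le> B" "\<And>m. 0 < s m" "0 \<le> t"
  shows "0 < poisson_mix s t"
  unfolding poisson_mix_def using assms
  by (intro mult_pos_pos suminf_pos2[of _ 0] summable_norm_cancel[OF summable_poisson_mix]) (auto intro!: divide_nonneg_pos mult_nonneg_nonneg intro: less_imp_le)

lemma poisson_mix_scale:
  "poisson_mix (\<lambda>m. r ^ m * s m) t = exp ((r - 1) * t) * poisson_mix s (r * t)"
proof -
  have "exp (- t) = exp ((r - 1) * t) * exp (- (r * t))"
    by (simp add: exp_add[symmetric] algebra_simps)
  then show ?thesis by (simp add: poisson_mix_def power_mult_distrib mult_ac)
qed

lemma poisson_mix_cmult:
  fixes s :: "nat \<Rightarrow> 'a :: {banach, real_normed_field}"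
  assumes "\<And>m. norm (s m) \<le> B"
  shows "poisson_mix (\<lambda>m. c * s m) t = c * poisson_mix s t"
  unfolding poisson_mix_def
  using suminf_mult[OF summable_norm_cancel[OF summable_poisson_mix[of s B t, OF assms]], of c]
  by (simp add: mult_ac)

lemma norm_poisson_mix_le:
  fixes s :: "nat \<Rightarrow> 'a :: {banach, real_normed_field}" and t :: real
  assumes s: "\<And>m. norm (s m) \<le> u m" and u: "\<And>m. u m \<le> B" and t: "0 \<le> t"
  shows "norm (poisson_mix s (of_real t)) \<le> poisson_mix u t"
proof -
  have u': "norm (u m) \<le> B" for m using order_trans[OF norm_ge_zero s[of m]] u[of m] by simp
  have "norm (s m) \<le> B" for m using s[of m] u[of m] by linarith
  note summ = summable_poisson_mix[of s B, OF this, of "of_real t"]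
  have "norm (\<Sum>m. of_real t ^ m / fact m * s m) \<le> (\<Sum>m. t ^ m / fact m * u m)"
  proof (rule order_trans[OF summable_norm[OF summ] suminf_le[OF _ summ]])
    show "summable (\<lambda>m. t ^ m / fact m * u m)"
      by (rule summable_norm_cancel[OF summable_poisson_mix]) (rule u')
    show "norm (of_real t ^ m / fact m * s m) \<le> t ^ m / fact m * u m" for m
      using s[of m] t by (simp add: norm_mult norm_divide norm_power mult_left_mono divide_right_mono)
  qed
  moreover have "norm (exp (- of_real t) :: 'a) = exp (- t)"
    by (metis abs_exp_cancel exp_of_real norm_of_real of_real_minus)
  ultimately show ?thesis
    by (simp add: poisson_mix_def norm_mult mult_left_mono)
qed

lemma poisson_mix_const [simp]: "poisson_mix (\<lambda>_. c) t = (c :: 'a :: {banach, real_normed_field})"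
proof -
  have "(\<lambda>m. t ^ m / fact m) sums exp t"
    using exp_converges[of t] by (simp add: scaleR_conv_of_real field_simps)
  from sums_mult2[OF this, of c] show ?thesis
    by (simp add: poisson_mix_def sums_iff exp_minus)
qed

text \<open>A Poisson variable of large mean puts vanishing mass on every finite set, so only the
  tail of \<open>s\<close> counts.\<close>

lemma poisson_mix_tendsto:
  fixes s :: "nat \<Rightarrow> 'a :: {banach, real_normed_field}"
  assumes "s \<longlonglongrightarrow> l"
  shows "((\<lambda>t::real. poisson_mix s (of_real t)) \<longlongrightarrow> l) at_top"
proof (rule tendstoI)
  fix e :: real assume "e > 0"
  have lim: "(\<lambda>m. s m - l) \<longlonglongrightarrow> 0" using assms by (simp add: LIM_zero)
  then have "Bseq (\<lambda>m. s m - l)" using convergent_imp_Bseq convergent_def by blast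
  then obtain B where B: "B > 0" "\<And>m. norm (s m - l) \<le> B" by (auto elim: BseqE)
  from lim \<open>e > 0\<close> obtain N where N: "\<And>m. m \<ge> N \<Longrightarrow> norm (s m - l) < e / 2"
    unfolding LIMSEQ_iff by (metis diff_zero half_gt_zero)
  \<comment> \<open>Bounds the contribution of the indices below \<open>N\<close>; each of the
    finitely many Poisson weights tends to 0.\<close>
  define R where "R t = B * (\<Sum>m<N. t ^ m / exp t / fact m)" for t :: real
  have "(R \<longlongrightarrow> B * (\<Sum>m<N. 0 / fact m)) at_top"
    unfolding R_def by (intro tendsto_intros tendsto_power_div_exp_0) auto
  then have "\<forall>\<^sub>F t in at_top. R t < e / 2"
    using \<open>e > 0\<close> by (intro order_tendstoD) auto
  then show "\<forall>\<^sub>F t::real in at_top. dist (poisson_mix s (of_real t)) l < e"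
    using eventually_ge_at_top[of 0]
  proof eventually_elim
    case (elim t)
    define u where "u m = e / 2 + (if m < N then B else 0)" for m
    have "norm (s m) \<le> B + norm l" for m
      using B(2)[of m] norm_triangle_ineq2[of "s m" l] by linarith
    note summ = summable_norm_cancel[OF summable_poisson_mix[of s "B + norm l", OF this]]
    have summ_l: "summable (\<lambda>m. x ^ m / fact m * l)" for x :: 'a
      by (rule summable_norm_cancel[OF summable_poisson_mix[of "\<lambda>_. l" "norm l"]]) simp
    have "poisson_mix s (of_real t) - l = poisson_mix s (of_real t) - poisson_mix (\<lambda>_. l) (of_real t)" by simp
    also have "\<dots> = poisson_mix (\<lambda>m. s m - l) (of_real t)"
      unfolding poisson_mix_def right_diff_distrib[symmetric]
      by (subst suminf_diff[OF summ summ_l]) (simp add: right_diff_distrib)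
    finally have "norm (poisson_mix s (of_real t) - l) = norm (poisson_mix (\<lambda>m. s m - l) (of_real t))" by simp
    also have "\<dots> \<le> poisson_mix u t"
    proof (rule norm_poisson_mix_le)
      show "norm (s m - l) \<le> u m" for m
        using N[of m] B(2)[of m] \<open>e > 0\<close> by (auto simp: u_def not_less intro: less_imp_le)
      show "u m \<le> e / 2 + B" for m using B(1) by (simp add: u_def)
    qed (use elim in simp)
    also have "poisson_mix u t = e / 2 + R t"
    proof -
      have "(\<lambda>m. t ^ m / fact m) sums exp t"
        using exp_converges[of t] by (simp add: field_simps)
      from sums_mult2[OF this, of "e / 2"]
      have a: "(\<lambda>m. t ^ m / fact m * (e / 2)) sums (exp t * (e / 2))" .
      have "(\<lambda>m. if m \<in> {..<N} then t ^ m / fact m * B else 0) sums (\<Sum>m<N. t ^ m / fact m * B)"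
        by (rule sums_If_finite_set) simp
      from sums_add[OF a this] have "(\<lambda>m. t ^ m / fact m * u m) sums (exp t * (e / 2) + (\<Sum>m<N. t ^ m / fact m * B))"
        by (rule sums_cong[THEN iffD1, rotated]) (auto simp: u_def algebra_simps)
      then have "poisson_mix u t = exp (- t) * (exp t * (e / 2) + (\<Sum>m<N. t ^ m / fact m * B))"
        by (simp add: poisson_mix_def sums_iff)
      also have "\<dots> = e / 2 + exp (- t) * (\<Sum>m<N. t ^ m / fact m * B)"
        by (simp add: algebra_simps exp_minus)
      also have "exp (- t) * (\<Sum>m<N. t ^ m / fact m * B) = R t"
        unfolding R_def sum_distrib_left by (intro sum.cong) (auto simp: exp_minus field_simps)
      finally show ?thesis .
    qed
    also have "\<dots> < e" using elim by simp
    finally show ?case by (simp add: dist_norm)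
  qed
qed

text \<open>As \<open>r j \<ge> 0\<close>, on the closed negative half-line the terms are dominated
  by \<open>norm (c j)\<close> and those of the derivative by \<open>norm (c j) * r j\<close>, and
  the Weierstrass test applies. Termwise differentiation is done on the half-plane
  \<open>Re w \<le> 0\<close> and restricted to the real axis, at interior points only, hence for
  \<open>y < 0\<close>.\<close>

lemma exp_series:
  fixes c :: "nat \<Rightarrow> complex" and r :: "nat \<Rightarrow> real"
  assumes c: "summable (\<lambda>j. norm (c j))" and cr: "summable (\<lambda>j. norm (c j) * r j)" and r: "\<And>j. 0 \<le> r j"
  defines "f \<equiv> \<lambda>y::real. \<Sum>j. c j * of_real (exp (r j * y))"
  shows exp_series_deriv: "\<And>y. y < 0 \<Longrightarrow>
      (f has_vector_derivative (\<Sum>j. c j * of_real (r j) * of_real (exp (r j * y)))) (at y)"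
    and exp_series_cont: "continuous_on {..0} f"
    and exp_series_bound: "\<And>y. y \<le> 0 \<Longrightarrow> norm (f y) \<le> (\<Sum>j. norm (c j))"
    and exp_series_summable: "\<And>y. y \<le> 0 \<Longrightarrow> summable (\<lambda>j. norm (c j * of_real (exp (r j * y))))"
proof -
  show summ: "summable (\<lambda>j. norm (c j * of_real (exp (r j * y))))" if "y \<le> 0" for y
  proof (rule summable_comparison_test'[OF c, of 0])
    show "norm (norm (c j * of_real (exp (r j * y)))) \<le> norm (c j)" for j
      using that r[of j] by (auto simp: norm_mult mult_nonneg_nonpos intro!: mult_left_le)
  qed
  show "norm (f y) \<le> (\<Sum>j. norm (c j))" if "y \<le> 0" for y
    unfolding f_def
    by (rule order_trans[OF summable_norm[OF summ[OF that]] suminf_le[OF _ summ[OF that] c]])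
      (use that r in \<open>auto simp: norm_mult mult_nonneg_nonpos intro!: mult_left_le\<close>)
  have "uniform_limit {..0} (\<lambda>n y. \<Sum>j<n. c j * of_real (exp (r j * y))) f sequentially"
    unfolding f_def
    by (rule Weierstrass_m_test[OF _ c])
      (use r in \<open>auto simp: norm_mult mult_nonneg_nonpos intro!: mult_left_le\<close>)
  then show "continuous_on {..0} f"
    by (rule uniform_limit_theorem[rotated]) (auto intro!: always_eventually continuous_intros)
  fix y :: real assume y: "y < 0"
  define F where "F w = (\<Sum>j. c j * exp (of_real (r j) * w))" for w :: complex
  have "((\<lambda>w. \<Sum>j. c j * exp (of_real (r j) * w)) has_field_derivative
      (\<Sum>j. c j * of_real (r j) * exp (of_real (r j) * of_real y))) (at (of_real y))"
  proof (rule has_field_derivative_series'(2))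
    show "convex {w. Re w \<le> 0}" by (simp add: convex_halfspace_Re_le)
    show "((\<lambda>w. c n * exp (of_real (r n) * w)) has_field_derivative
        c n * of_real (r n) * exp (of_real (r n) * w)) (at w within {w. Re w \<le> 0})" for n w
      by (auto intro!: derivative_eq_intros)
    have "uniform_limit {w. Re w \<le> 0} (\<lambda>n w. \<Sum>i<n. c i * of_real (r i) * exp (of_real (r i) * w))
        (\<lambda>w. \<Sum>i. c i * of_real (r i) * exp (of_real (r i) * w)) sequentially"
      by (rule Weierstrass_m_test[OF _ cr])
        (use r in \<open>auto simp: norm_mult mult_nonneg_nonpos intro!: mult_left_le\<close>)
    then show "uniformly_convergent_on {w. Re w \<le> 0} (\<lambda>n w. \<Sum>i<n. c i * of_real (r i) * exp (of_real (r i) * w))"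
      by (auto simp: uniformly_convergent_on_def)
    show "0 \<in> {w. Re w \<le> 0}" by simp
    show "summable (\<lambda>n. c n * exp (of_real (r n) * 0))"
      using summable_norm_cancel[OF c] by simp
    have "{w. Re w < 0} \<subseteq> interior {w. Re w \<le> 0}"
      by (rule interior_maximal) (auto simp: open_halfspace_Re_lt)
    then show "complex_of_real y \<in> interior {w. Re w \<le> 0}" using y by auto
  qed
  from has_vector_derivative_real_field[OF this]
  show "(f has_vector_derivative (\<Sum>j. c j * of_real (r j) * of_real (exp (r j * y)))) (at y)"
    by (simp add: f_def exp_of_real[symmetric])
qed

section \<open>The q-exponential\<close>

lemma q_int_0 [simp]: "q_int q 0 = 0"
  by (simp add: q_int_def)

lemma q_int_Suc: "q \<noteq> 1 \<Longrightarrow> q_int q (Suc n) = 1 + q * q_int q n"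
  by (simp add: q_int_def field_simps)

lemma q_int_ge:
  assumes "1 < q" shows "real n \<le> q_int q n"
proof (induction n)
  case (Suc n)
  then have "real n \<le> q * q_int q n"
    using assms mult_mono[of 1 q "real n" "q_int q n"] by simp
  then show ?case using assms by (simp add: q_int_Suc)
qed simp

lemma q_fact_ge:
  assumes "1 \<le> q" shows "fact n \<le> q_fact q n"
proof (cases "q = 1")
  case False
  then have "1 < q" using assms by simp
  have "(fact n :: real) = (\<Prod>k=1..n. real k)" by (simp add: fact_prod)
  also have "\<dots> \<le> (\<Prod>k=1..n. q_int q k)"
    using q_int_ge[OF \<open>1 < q\<close>] by (intro prod_mono) auto
  finally show ?thesis using False by (simp add: q_fact_def)
qed (simp add: q_fact_def)

lemma q_fact_pos: "1 \<le> q \<Longrightarrow> 0 < q_fact q n"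
  using q_fact_ge[of q n] fact_gt_zero[of n, where 'a = real] by linarith

lemma summable_q_exp:
  fixes z :: "'a :: {banach, real_normed_field}"
  assumes "1 \<le> q"
  shows "summable (\<lambda>n. norm (z ^ n / of_real (q_fact q n)))"
proof (rule summable_comparison_test'[where N = 0])
  show "summable (\<lambda>n. norm z ^ n / fact n)"
    using summable_exp[of "norm z"] by (simp add: field_simps)
  show "norm (norm (z ^ n / of_real (q_fact q n))) \<le> norm z ^ n / fact n" for n
    using q_fact_ge[OF assms, of n] q_fact_pos[OF assms, of n]
    by (simp add: norm_divide norm_power divide_left_mono)
qed

lemma q_exp_series: "1 \<le> q \<Longrightarrow> (\<lambda>n. z ^ n / of_real (q_fact q n)) sums q_exp q z"
  unfolding q_exp_def using summable_norm_cancel[OF summable_q_exp[of q z]] by (simp add: summable_sums)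

lemma q_exp_0: "1 \<le> q \<Longrightarrow> q_exp q 0 = 1"
  by (rule sums_unique2[OF q_exp_series])
    (use powser_sums_zero[of "\<lambda>n. 1 / complex_of_real (q_fact q n)"] in \<open>simp_all add: q_fact_0\<close>)

lemma isCont_q_exp_0:
  assumes "1 \<le> q" shows "isCont (q_exp q) 0"
proof -
  have "isCont (\<lambda>z. \<Sum>n. (1 / of_real (q_fact q n)) * z ^ n) (0::complex)"
    using summable_norm_cancel[OF summable_q_exp[OF assms, of 1]]
    by (intro isCont_powser[of _ 1]) auto
  then show ?thesis using assms by (simp add: q_exp_def[abs_def])
qed

text \<open>The coefficients satisfy
  \<open>(q ^ Suc n - 1) / q_fact q (Suc n) = (q - 1) / q_fact q n\<close>. Iterating this
  q-difference equation towards 0 turns the series into a product of the factors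
  \<open>1 + (1 - 1 / q) * (1 / q) ^ n * z\<close>, from which arguments can be read off.\<close>

lemma q_exp_step_gt1:
  assumes "1 < q"
  shows "q_exp q (of_real q * z) = (1 + of_real (q - 1) * z) * q_exp q z"
proof -
  let ?c = "\<lambda>n. 1 / complex_of_real (q_fact q n)"
  have q: "1 \<le> q" using assms by simp
  have s: "(\<lambda>n. ?c n * w ^ n) sums q_exp q w" for w
    using q_exp_series[OF q, of w] by simp
  have "(\<lambda>n. ?c n * (of_real q * z) ^ n - ?c n * z ^ n) sums (q_exp q (of_real q * z) - q_exp q z)"
    by (intro sums_diff s)
  then have "(\<lambda>n. ?c (Suc n) * (of_real q * z) ^ Suc n - ?c (Suc n) * z ^ Suc n) sums (q_exp q (of_real q * z) - q_exp q z)"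
    by (subst sums_Suc_iff) simp
  moreover have "?c (Suc n) * (of_real q * z) ^ Suc n - ?c (Suc n) * z ^ Suc n
      = of_real (q - 1) * z * (?c n * z ^ n)" for n
  proof -
    have "q_fact q (Suc n) \<noteq> 0" "q_fact q n \<noteq> 0" using q_fact_pos[OF q] by (metis less_irrefl)+
    moreover have "q ^ Suc n - 1 = (q - 1) * q_int q (Suc n)"
      using assms by (simp add: q_int_def field_simps)
    ultimately have "(q ^ Suc n - 1) / q_fact q (Suc n) = (q - 1) / q_fact q n"
      using assms by (simp add: q_fact_Suc del: power_Suc)
    then have eq: "complex_of_real ((q ^ Suc n - 1) / q_fact q (Suc n)) = of_real ((q - 1) / q_fact q n)"
      by simp
    have "?c (Suc n) * (of_real q * z) ^ Suc n - ?c (Suc n) * z ^ Suc n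
        = of_real ((q ^ Suc n - 1) / q_fact q (Suc n)) * z ^ Suc n"
      by (simp add: power_mult_distrib diff_divide_distrib left_diff_distrib del: power_Suc)
    also have "\<dots> = of_real (q - 1) * z * (?c n * z ^ n)"
      unfolding eq by simp
    finally show ?thesis .
  qed
  ultimately have "(\<lambda>n. of_real (q - 1) * z * (?c n * z ^ n)) sums (q_exp q (of_real q * z) - q_exp q z)"
    by simp
  moreover have "(\<lambda>n. of_real (q - 1) * z * (?c n * z ^ n)) sums (of_real (q - 1) * z * q_exp q z)"
    by (intro sums_mult s)
  ultimately have "q_exp q (of_real q * z) - q_exp q z = of_real (q - 1) * z * q_exp q z"
    by (rule sums_unique2)
  then show ?thesis by (simp add: algebra_simps)
qed

lemma q_exp_partial_gt1:
  assumes "1 < q"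
  shows "q_exp q z = (\<Prod>n<N. 1 + of_real ((1 - 1 / q) * (1 / q) ^ n) * z) * q_exp q (of_real ((1 / q) ^ N) * z)"
proof (induction N)
  case (Suc N)
  have "q_exp q (of_real ((1 / q) ^ N) * z) = q_exp q (of_real q * (of_real ((1 / q) ^ Suc N) * z))"
    using assms by simp
  also have "\<dots> = (1 + of_real (q - 1) * (of_real ((1 / q) ^ Suc N) * z)) * q_exp q (of_real ((1 / q) ^ Suc N) * z)"
    by (rule q_exp_step_gt1[OF assms])
  also have "of_real (q - 1) * (of_real ((1 / q) ^ Suc N) * z) = of_real ((1 - 1 / q) * (1 / q) ^ N) * z"
    using assms by (simp add: field_simps)
  finally show ?case using Suc by (simp only: prod.lessThan_Suc mult.assoc)
qed simp

lemma q_exp_power_tendsto_gt1: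
  assumes "1 < q"
  shows "(\<lambda>N. q_exp q (of_real ((1 / q) ^ N) * z)) \<longlonglongrightarrow> 1"
proof -
  have "(\<lambda>N. of_real ((1 / q) ^ N) * z) \<longlonglongrightarrow> of_real 0 * z"
    using assms by (intro tendsto_intros LIMSEQ_realpow_zero) auto
  then have "(\<lambda>N. q_exp q (of_real ((1 / q) ^ N) * z)) \<longlonglongrightarrow> q_exp q 0"
    using assms by (intro isCont_tendsto_compose[OF isCont_q_exp_0]) auto
  then show ?thesis using assms by (simp add: q_exp_0)
qed

text \<open>Beyond the disc of convergence only the product is available, so the scaling relation
  comes from splitting off an initial segment of it. The poles have to be excluded: division by 0
  would make a factor 0 there.\<close>

lemma q_exp_lt1:
  assumes q: "0 < q" "q < 1" and z: "\<And>n. z * of_real ((1 - q) * q ^ n) \<noteq> 1"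
  shows q_exp_partial_lt1: "q_exp q (of_real (q ^ N) * z) = (\<Prod>n<N. 1 - of_real ((1 - q) * q ^ n) * z) * q_exp q z"
    and q_exp_power_tendsto_lt1: "(\<lambda>N. q_exp q (of_real (q ^ N) * z)) \<longlonglongrightarrow> 1"
proof -
  define f where "f w n = 1 / (1 - w * complex_of_real ((1 - q) * q ^ n))" for w n
  have conv: "convergent_prod (f w)" for w
  proof -
    have "summable (\<lambda>n. norm w * (1 - q) * q ^ n)"
      by (intro summable_mult summable_geometric) (use q in auto)
    then have "abs_convergent_prod (\<lambda>n. 1 - w * complex_of_real ((1 - q) * q ^ n))"
      using q by (simp add: abs_convergent_prod_conv_summable norm_mult norm_power mult.assoc)
    then have "convergent_prod (\<lambda>n. 1 - w * complex_of_real ((1 - q) * q ^ n))"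
      by (rule abs_convergent_prod_imp_convergent_prod)
    from convergent_prod_inverse[OF this] show ?thesis
      by (simp add: f_def[abs_def] divide_inverse)
  qed
  have e: "q_exp q w = prodinf (f w)" for w
    using q by (simp add: q_exp_def f_def[abs_def])
  have nz: "f z n \<noteq> 0" for n using z[of n] by (simp add: f_def)
  have e0: "q_exp q z \<noteq> 0"
    unfolding e by (rule prodinf_nonzero[OF conv nz])
  have step: "q_exp q z = (\<Prod>n<N. f z n) * q_exp q (of_real (q ^ N) * z)" for N
  proof -
    have "f (of_real (q ^ N) * z) = (\<lambda>n. f z (n + N))"
      by (simp add: f_def fun_eq_iff power_add mult_ac)
    then show ?thesis
      unfolding e using prodinf_split_initial_segment[OF conv[of z] nz, of N] by (simp add: mult.commute)
  qed
  have inv: "(\<Prod>n<N. f z n) * (\<Prod>n<N. 1 - of_real ((1 - q) * q ^ n) * z) = 1" for N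
    unfolding prod.distrib[symmetric]
  proof (rule prod.neutral, rule ballI)
    fix n show "f z n * (1 - of_real ((1 - q) * q ^ n) * z) = 1"
      using z[of n] by (simp add: f_def mult.commute)
  qed
  show part: "q_exp q (of_real (q ^ N) * z) = (\<Prod>n<N. 1 - of_real ((1 - q) * q ^ n) * z) * q_exp q z" for N
  proof -
    have "(\<Prod>n<N. 1 - of_real ((1 - q) * q ^ n) * z) * q_exp q z =
        ((\<Prod>n<N. f z n) * (\<Prod>n<N. 1 - of_real ((1 - q) * q ^ n) * z)) * q_exp q (of_real (q ^ N) * z)"
      by (subst step[of N]) (simp only: mult_ac)
    then show ?thesis unfolding inv by simp
  qed
  have "(\<lambda>N. \<Prod>n\<le>N. f z n) \<longlonglongrightarrow> q_exp q z"
    unfolding e by (rule convergent_prod_LIMSEQ[OF conv])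
  then have "(\<lambda>N. \<Prod>n<N. f z n) \<longlonglongrightarrow> q_exp q z"
    by (subst (asm) lessThan_Suc_atMost[symmetric]) (rule LIMSEQ_imp_Suc)
  then have "(\<lambda>N. q_exp q z / (\<Prod>n<N. f z n)) \<longlonglongrightarrow> q_exp q z / q_exp q z"
    by (intro tendsto_divide tendsto_const e0)
  moreover have "q_exp q z / (\<Prod>n<N. f z n) = q_exp q (of_real (q ^ N) * z)" for N
  proof -
    have "(\<Prod>n<N. f z n) \<noteq> 0" using inv[of N] by (metis mult_zero_left zero_neq_one)
    then show ?thesis by (subst step[of N]) simp
  qed
  ultimately show "(\<lambda>N. q_exp q (of_real (q ^ N) * z)) \<longlonglongrightarrow> 1"
    using e0 by simp
qed

lemma q_exp_1: "q_exp 1 z = exp z"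
proof -
  have "(\<lambda>n. z ^ n / of_real (q_fact 1 n)) sums exp z"
    using exp_converges[of z] by (simp add: q_fact_def scaleR_conv_of_real field_simps)
  then show ?thesis using q_exp_series[of 1 z] sums_unique2 by auto
qed

lemma abs_arctan_le: "\<bar>arctan x\<bar> \<le> \<bar>x\<bar>"
  using arctan_le_self[of x] arctan_le_self[of "- x"] by (cases "x \<ge> 0") (auto simp: arctan_minus)

section \<open>Argument of the q-exponential on the imaginary axis\<close>

text \<open>The terms are the arguments of the factors
  \<open>1 + \<i> * x * (1 - \<eta>) * \<eta> ^ n\<close>. The sum is the continuous branch
  vanishing at 0, not reduced modulo 2 pi, so that it is strictly monotone and open to the
  intermediate value theorem.\<close>

definition q_arg :: "real \<Rightarrow> real \<Rightarrow> real" where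
  "q_arg q x = (if q = 1 then x
     else (\<Sum>n. arctan (x * ((1 - min q (1 / q)) * min q (1 / q) ^ n))))"

lemma q_arg_inverse: "0 < q \<Longrightarrow> q_arg (1 / q) x = q_arg q x"
  by (simp add: q_arg_def min.commute)

context
  fixes q \<eta> :: real
  assumes q: "0 < q" "q \<noteq> 1"
  defines "\<eta> \<equiv> min q (1 / q)"
begin

lemma eta_bounds: "0 < \<eta>" "\<eta> < 1"
proof -
  have "0 < \<eta> \<and> \<eta> < 1"
    using q by (cases "q < 1") (auto simp: \<eta>_def min_less_iff_disj)
  then show "0 < \<eta>" "\<eta> < 1" by auto
qed

lemma q_arg_eq: "q_arg q x = (\<Sum>n. arctan (x * ((1 - \<eta>) * \<eta> ^ n)))"
  using q by (simp add: q_arg_def \<eta>_def)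

lemma weight_sums: "(\<lambda>n. (1 - \<eta>) * \<eta> ^ n) sums 1"
  using sums_mult[OF geometric_sums[of \<eta>], of "1 - \<eta>"] eta_bounds by simp

lemma summable_q_arg: "summable (\<lambda>n. arctan (x * ((1 - \<eta>) * \<eta> ^ n)))"
proof (rule summable_comparison_test'[where N = 0])
  show "summable (\<lambda>n. \<bar>x\<bar> * ((1 - \<eta>) * \<eta> ^ n))"
    by (intro summable_mult sums_summable[OF weight_sums])
  show "norm (arctan (x * ((1 - \<eta>) * \<eta> ^ n))) \<le> \<bar>x\<bar> * ((1 - \<eta>) * \<eta> ^ n)" for n
    using abs_arctan_le[of "x * ((1 - \<eta>) * \<eta> ^ n)"] eta_bounds by (simp add: abs_mult)
qed

lemma q_arg_strict_mono: assumes "x < y" shows "q_arg q x < q_arg q y"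
proof -
  have "0 < (\<Sum>n. arctan (y * ((1 - \<eta>) * \<eta> ^ n)) - arctan (x * ((1 - \<eta>) * \<eta> ^ n)))"
    using assms eta_bounds by (intro suminf_pos summable_diff summable_q_arg) (simp add: arctan_monotone)
  then show ?thesis by (simp add: q_arg_eq suminf_diff[OF summable_q_arg summable_q_arg, symmetric])
qed

lemma q_arg_cont: "continuous_on {0..b} (q_arg q)"
proof -
  have "uniform_limit {0..b} (\<lambda>n x. \<Sum>i<n. arctan (x * ((1 - \<eta>) * \<eta> ^ i))) (\<lambda>x. \<Sum>i. arctan (x * ((1 - \<eta>) * \<eta> ^ i))) sequentially"
  proof (rule Weierstrass_m_test)
    show "summable (\<lambda>n. b * ((1 - \<eta>) * \<eta> ^ n))"
      by (intro summable_mult sums_summable[OF weight_sums])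
    show "norm (arctan (x * ((1 - \<eta>) * \<eta> ^ n))) \<le> b * ((1 - \<eta>) * \<eta> ^ n)" if "x \<in> {0..b}" for n x
    proof -
      have "norm (arctan (x * ((1 - \<eta>) * \<eta> ^ n))) \<le> x * ((1 - \<eta>) * \<eta> ^ n)"
        using abs_arctan_le[of "x * ((1 - \<eta>) * \<eta> ^ n)"] eta_bounds that by (simp add: abs_mult)
      also have "\<dots> \<le> b * ((1 - \<eta>) * \<eta> ^ n)" using that eta_bounds by (intro mult_right_mono) auto
      finally show ?thesis .
    qed
  qed
  then show ?thesis unfolding q_arg_eq[abs_def]
    by (rule uniform_limit_theorem[rotated]) (auto intro!: always_eventually continuous_intros)
qed

lemma q_arg_large: "pi / 2 \<le> q_arg q (1 / ((1 - \<eta>) * \<eta>))"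
proof -
  \<comment> \<open>At this \<open>x\<close> the first two terms are
    \<open>arctan (1 / \<eta>)\<close> and \<open>arctan 1\<close>, each at least
    \<open>pi / 4\<close>, and the others are nonnegative.\<close>
  define x where "x = 1 / ((1 - \<eta>) * \<eta>)"
  have x: "x > 0" using eta_bounds by (simp add: x_def)
  have "1 \<le> x * ((1 - \<eta>) * \<eta> ^ n)" if "n < 2" for n
  proof -
    have "x * ((1 - \<eta>) * \<eta> ^ n) = \<eta> ^ n / \<eta>" using eta_bounds by (simp add: x_def)
    moreover have "n = 0 \<or> n = 1" using that by auto
    ultimately show ?thesis using eta_bounds by auto
  qed
  then have "(\<Sum>n<2::nat. pi / 4) \<le> (\<Sum>n<2. arctan (x * ((1 - \<eta>) * \<eta> ^ n)))"
    by (intro sum_mono) (metis arctan_le_iff arctan_one lessThan_iff)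
  also have "\<dots> \<le> q_arg q x"
    unfolding q_arg_eq using x eta_bounds by (intro sum_le_suminf summable_q_arg) auto
  finally show ?thesis by (simp add: x_def)
qed

end

text \<open>The moduli converge for free, since \<open>r N = norm w / norm (e N)\<close> as soon as
  \<open>e N\<close> is nonzero. What is left to check in applications is the convergence of the
  angles, a series of real arctangents.\<close>

lemma polar_limit:
  fixes w :: complex
  assumes w: "\<And>N. w = of_real (r N) * cis (A N) * e N" and r: "\<And>N. 0 < r N"
    and e: "e \<longlonglongrightarrow> 1" and A: "A \<longlonglongrightarrow> \<alpha>"
  shows "0 < norm w \<and> w = of_real (norm w) * cis \<alpha>"
proof -
  have e': "\<forall>\<^sub>F N in sequentially. e N \<noteq> 0"
    using tendsto_imp_eventually_ne[OF e] by simp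
  then obtain N where "e N \<noteq> 0" using eventually_happens' sequentially_bot by blast
  then have "w \<noteq> 0" using r[of N] by (subst w[of N]) simp
  have n: "norm w = r N * norm (e N)" for N
    using r[of N] by (subst w[of N]) (simp add: norm_mult)
  have "(\<lambda>N. norm w / norm (e N)) \<longlonglongrightarrow> norm w / norm (1 :: complex)"
    by (intro tendsto_intros e) auto
  moreover have "\<forall>\<^sub>F N in sequentially. norm w / norm (e N) = r N"
    by (rule eventually_mono[OF e']) (metis n nonzero_mult_div_cancel_right norm_eq_zero)
  ultimately have "r \<longlonglongrightarrow> norm w"
    by (simp add: tendsto_cong)
  moreover have "(\<lambda>N. cis (A N)) \<longlonglongrightarrow> cis \<alpha>"
    using A by (auto simp: cis_conv_exp intro!: tendsto_intros)
  ultimately have "(\<lambda>N. of_real (r N) * cis (A N) * e N) \<longlonglongrightarrow> of_real (norm w) * cis \<alpha> * 1"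
    by (intro tendsto_intros e A)
  then have "w = of_real (norm w) * cis \<alpha>"
    using w by (simp add: LIMSEQ_const_iff)
  with \<open>w \<noteq> 0\<close> show ?thesis by simp
qed

lemma one_plus_ii: "1 + \<i> * of_real x = of_real (sqrt (1 + x\<^sup>2)) * cis (arctan x)"
proof -
  have "0 < 1 + x\<^sup>2" by (simp add: add_pos_nonneg)
  then show ?thesis by (intro complex_eqI) (simp_all add: cos_arctan sin_arctan)
qed

lemma prod_one_plus_ii:
  fixes x :: "nat \<Rightarrow> real"
  shows "(\<Prod>n<N. 1 + \<i> * of_real (x n)) = of_real (\<Prod>n<N. sqrt (1 + (x n)\<^sup>2)) * cis (\<Sum>n<N. arctan (x n))"
  by (induction N) (simp_all only: prod.lessThan_Suc sum.lessThan_Suc one_plus_ii of_real_mult cis_mult[symmetric], simp_all add: mult_ac)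

lemma q_exp_imag_polar:
  assumes "0 < q"
  shows "0 < norm (q_exp q (\<i> * of_real x)) \<and>
    q_exp q (\<i> * of_real x) = of_real (norm (q_exp q (\<i> * of_real x))) * cis (q_arg q x)"
proof -
  consider "q = 1" | "q > 1" | "q < 1" by linarith
  then show ?thesis
  proof cases
    case 1
    show ?thesis using 1 by (simp add: q_exp_1 q_arg_def cis_conv_exp mult.commute)
  next
    case 2
    have "1 / q \<le> 1" using 2 by simp
    then have \<eta>: "min q (1 / q) = 1 / q" using 2 by (intro min_absorb2) linarith
    have f: "1 + of_real ((1 - 1 / q) * (1 / q) ^ n) * (\<i> * of_real x) = 1 + \<i> * of_real (x * ((1 - 1 / q) * (1 / q) ^ n))" for n
      by (simp add: mult_ac)
    show ?thesis
    proof (rule polar_limit)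
      show "q_exp q (\<i> * of_real x) =
        of_real (\<Prod>n<N. sqrt (1 + (x * ((1 - 1 / q) * (1 / q) ^ n))\<^sup>2)) *
        cis (\<Sum>n<N. arctan (x * ((1 - 1 / q) * (1 / q) ^ n))) * q_exp q (of_real ((1 / q) ^ N) * (\<i> * of_real x))" for N
        using q_exp_partial_gt1[OF 2, of "\<i> * of_real x" N] by (simp only: prod_one_plus_ii f)
      show "0 < (\<Prod>n<N. sqrt (1 + (x * ((1 - 1 / q) * (1 / q) ^ n))\<^sup>2))" for N
        by (intro prod_pos) (simp add: add_pos_nonneg)
      show "(\<lambda>N. \<Sum>n<N. arctan (x * ((1 - 1 / q) * (1 / q) ^ n))) \<longlonglongrightarrow> q_arg q x"
        using summable_LIMSEQ[OF summable_q_arg[of q x]] q_arg_eq[of q x] 2 by (simp add: \<eta>)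
    qed (rule q_exp_power_tendsto_gt1[OF 2])
  next
    case 3
    have \<eta>: "min q (1 / q) = q"
      using 3 assms mult_strict_mono[of q 1 q 1] by (auto simp: min_def field_simps)
    have z: "\<i> * of_real x * of_real ((1 - q) * q ^ n) \<noteq> 1" for n
      by (simp add: complex_eq_iff)
    have f: "1 - of_real ((1 - q) * q ^ n) * (\<i> * of_real x) = 1 + \<i> * of_real (- x * ((1 - q) * q ^ n))" for n
      by (simp add: mult_ac)
    show ?thesis
    proof (rule polar_limit)
      \<comment> \<open>For \<open>q < 1\<close> the factors stand in the denominator and carry a
        minus sign; inverting restores the angle with a plus, which is why the parameters
        \<open>q\<close> and \<open>1 / q\<close> lead to the same sum.\<close>
      show "q_exp q (\<i> * of_real x) =
        of_real (inverse (\<Prod>n<N. sqrt (1 + (- x * ((1 - q) * q ^ n))\<^sup>2))) *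
        cis (\<Sum>n<N. arctan (x * ((1 - q) * q ^ n))) * q_exp q (of_real (q ^ N) * (\<i> * of_real x))" for N
      proof -
        let ?P = "\<Prod>n<N. sqrt (1 + (- x * ((1 - q) * q ^ n))\<^sup>2)" and ?A = "\<Sum>n<N. arctan (x * ((1 - q) * q ^ n))"
        have "?P > 0" by (intro prod_pos) (simp add: add_pos_nonneg)
        have "(\<Sum>n<N. arctan (- x * ((1 - q) * q ^ n))) = - ?A"
          by (simp add: sum_negf arctan_minus)
        then have "q_exp q (of_real (q ^ N) * (\<i> * of_real x)) = of_real ?P * cis (- ?A) * q_exp q (\<i> * of_real x)"
          using q_exp_partial_lt1[OF assms 3 z, of N] by (simp only: prod_one_plus_ii f)
        moreover have "cis ?A * cis (- ?A) = 1" by (simp add: cis_mult)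
        moreover have "complex_of_real (inverse ?P) * of_real ?P = 1"
          unfolding of_real_mult[symmetric] left_inverse[OF less_imp_neq[OF \<open>?P > 0\<close>, symmetric]]
          by (rule of_real_1)
        moreover have "u * c * (P * c' * w) = (u * P) * (c * c') * w" for u c P c' w :: complex
          by (simp only: mult_ac)
        ultimately show ?thesis by (simp only: mult_1_left)
      qed
      show "0 < inverse (\<Prod>n<N. sqrt (1 + (- x * ((1 - q) * q ^ n))\<^sup>2))" for N
        by (intro positive_imp_inverse_positive prod_pos) (simp add: add_pos_nonneg)
      show "(\<lambda>N. \<Sum>n<N. arctan (x * ((1 - q) * q ^ n))) \<longlonglongrightarrow> q_arg q x"
        using summable_LIMSEQ[OF summable_q_arg[of q x]] q_arg_eq[of q x] 3 assms by (simp add: \<eta>)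
    qed (rule q_exp_power_tendsto_lt1[OF assms 3 z])
  qed
qed

section \<open>Cosine, sine and arctangent on the real axis\<close>

lemma i_power_sums:
  assumes "(\<lambda>n. \<i> ^ n * of_real (d n)) sums w"
  shows "(\<lambda>j. (-1) ^ j * d (2 * j)) sums Re w" and "(\<lambda>j. (-1) ^ j * d (2 * j + 1)) sums Im w"
proof -
  have even: "\<i> ^ (2 * j) = of_real ((-1) ^ j)" for j by (simp add: power_mult)
  have odd: "\<i> ^ (2 * j + 1) = \<i> * of_real ((-1) ^ j)" for j by (simp add: power_mult)
  have "(\<lambda>j. Re (\<i> ^ (2 * j) * of_real (d (2 * j)))) sums Re w"
  proof (subst sums_mono_reindex[of "\<lambda>j. 2 * j" "\<lambda>n. Re (\<i> ^ n * of_real (d n))"])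
    show "Re (\<i> ^ n * of_real (d n)) = 0" if "n \<notin> range (\<lambda>j. 2 * j)" for n
    proof -
      have "odd n" using that by (auto elim!: evenE)
      then obtain j where "n = 2 * j + 1" by (elim oddE)
      then show ?thesis using odd[of j] by simp
    qed
  qed (use sums_Re[OF assms] in \<open>auto simp: strict_mono_def\<close>)
  then show "(\<lambda>j. (-1) ^ j * d (2 * j)) sums Re w" by (simp add: even)
  have "(\<lambda>j. Im (\<i> ^ (2 * j + 1) * of_real (d (2 * j + 1)))) sums Im w"
  proof (subst sums_mono_reindex[of "\<lambda>j. 2 * j + 1" "\<lambda>n. Im (\<i> ^ n * of_real (d n))"])
    show "Im (\<i> ^ n * of_real (d n)) = 0" if "n \<notin> range (\<lambda>j. 2 * j + 1)" for n
    proof -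
      have "even n" using that by (metis oddE rangeI)
      then obtain j where "n = 2 * j" by (elim evenE)
      then show ?thesis using even[of j] by simp
    qed
  qed (use sums_Im[OF assms] in \<open>auto simp: strict_mono_def\<close>)
  then show "(\<lambda>j. (-1) ^ j * d (2 * j + 1)) sums Im w" by (simp only: odd) simp
qed

lemma imag_not_pole: "\<i> * of_real x * of_real r \<noteq> 1"
  by (simp add: complex_eq_iff)

text \<open>The two sides are compared at the points \<open>q ^ N * z\<close>: going there
  multiplies both by the same partial product, so their quotient does not depend on
  \<open>N\<close>, while both tend to 1.\<close>

lemma q_exp_cnj_lt1:
  assumes q: "0 < q" "q < 1"
  shows "q_exp q (- (\<i> * of_real x)) = cnj (q_exp q (\<i> * of_real x))"
proof -
  let ?z = "\<i> * complex_of_real x"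
  have m: "- ?z = \<i> * of_real (- x)" by simp
  have np: "?z * of_real ((1 - q) * q ^ n) \<noteq> 1" "- ?z * of_real ((1 - q) * q ^ n) \<noteq> 1" for n
    using imag_not_pole[of x "(1 - q) * q ^ n"] imag_not_pole[of "- x" "(1 - q) * q ^ n"] by auto
  note part = q_exp_partial_lt1[OF q np(1)] q_exp_partial_lt1[OF q np(2)]
  let ?p = "\<lambda>N. (\<Prod>n<N. 1 - of_real ((1 - q) * q ^ n) * ?z)"
  have "(\<lambda>N. q_exp q (of_real (q ^ N) * - ?z) / cnj (q_exp q (of_real (q ^ N) * ?z))) \<longlonglongrightarrow> 1 / cnj 1"
    by (intro tendsto_intros q_exp_power_tendsto_lt1[OF q np(1)] q_exp_power_tendsto_lt1[OF q np(2)]) auto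
  moreover have "q_exp q (of_real (q ^ N) * - ?z) / cnj (q_exp q (of_real (q ^ N) * ?z)) = q_exp q (- ?z) / cnj (q_exp q ?z)" for N
  proof -
    have "?p N \<noteq> 0"
      using np(1) by (auto simp: mult_ac)
    have "(\<Prod>n<N. 1 - of_real ((1 - q) * q ^ n) * - ?z) = cnj (?p N)"
      by simp
    then have "q_exp q (of_real (q ^ N) * - ?z) = cnj (?p N) * q_exp q (- ?z)"
      using part(2)[of N] by simp
    moreover have "cnj (q_exp q (of_real (q ^ N) * ?z)) = cnj (?p N) * cnj (q_exp q ?z)"
      unfolding part(1)[of N] by (rule complex_cnj_mult)
    moreover have "cnj (?p N) \<noteq> 0"
      using \<open>?p N \<noteq> 0\<close> by (simp only: complex_cnj_zero_iff not_False_eq_True)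
    moreover have "u' / v' = u / v" if "u' = c * u" "v' = c * v" "c \<noteq> 0" for u u' v v' c :: complex
      using that by simp
    ultimately show ?thesis by blast
  qed
  ultimately have "q_exp q (- ?z) / cnj (q_exp q ?z) = 1"
    by (simp only: LIMSEQ_const_iff) simp
  then show ?thesis by (simp add: divide_eq_1_iff)
qed

lemma q_trig_Re_Im:
  assumes "0 < q"
  shows "q_cos q (of_real x) = of_real (Re (q_exp q (\<i> * of_real x)))"
    and "q_sin q (of_real x) = of_real (Im (q_exp q (\<i> * of_real x)))"
proof -
  have "q_cos q (of_real x) = of_real (Re (q_exp q (\<i> * of_real x))) \<and>
      q_sin q (of_real x) = of_real (Im (q_exp q (\<i> * of_real x)))"
  proof (cases "q \<ge> 1")
    case True
    have "(\<lambda>n. \<i> ^ n * of_real (x ^ n / q_fact q n)) sums q_exp q (\<i> * of_real x)"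
      using q_exp_series[OF True, of "\<i> * of_real x"] by (simp add: power_mult_distrib)
    from i_power_sums[OF this, THEN sums_of_real[where 'a = complex], THEN sums_unique, symmetric] show ?thesis
      using True by (simp add: q_cos_def q_sin_def)
  next
    case False
    then show ?thesis
      using assms q_exp_cnj_lt1[of q x]
      by (simp add: q_cos_def q_sin_def complex_add_cnj complex_diff_cnj, simp add: complex_eq_iff)
  qed
  then show "q_cos q (of_real x) = of_real (Re (q_exp q (\<i> * of_real x)))"
    "q_sin q (of_real x) = of_real (Im (q_exp q (\<i> * of_real x)))" by auto
qed

lemma q_trig_polar:
  assumes "0 < q"
  obtains \<rho> where "\<rho> > 0" "q_cos q (of_real x) = of_real (\<rho> * cos (q_arg q x))"
    "q_sin q (of_real x) = of_real (\<rho> * sin (q_arg q x))"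
    "q_exp q (\<i> * of_real x) = of_real \<rho> * cis (q_arg q x)"
proof
  let ?\<rho> = "norm (q_exp q (\<i> * of_real x))"
  have *: "q_exp q (\<i> * of_real x) = of_real ?\<rho> * cis (q_arg q x)"
    using q_exp_imag_polar[OF assms, of x] by simp
  then show "q_exp q (\<i> * of_real x) = of_real ?\<rho> * cis (q_arg q x)" .
  show "?\<rho> > 0" using q_exp_imag_polar[OF assms, of x] by simp
  show "q_cos q (of_real x) = of_real (?\<rho> * cos (q_arg q x))"
    unfolding q_trig_Re_Im[OF assms] by (subst *) simp
  show "q_sin q (of_real x) = of_real (?\<rho> * sin (q_arg q x))"
    unfolding q_trig_Re_Im[OF assms] by (subst *) simp
qed

lemma q_arg_0 [simp]: "q_arg q 0 = 0"
  by (simp add: q_arg_def)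

lemma q_arg_less: "0 < q \<Longrightarrow> x < y \<Longrightarrow> q_arg q x < q_arg q y"
  using q_arg_strict_mono[of q x y] by (cases "q = 1") (auto simp: q_arg_def)

lemma q_arg_onto:
  assumes "0 < q" "0 \<le> \<alpha>" "\<alpha> \<le> pi / 2"
  obtains x where "0 \<le> x" "q_arg q x = \<alpha>"
proof (cases "q = 1")
  case True
  then show ?thesis using that[of \<alpha>] assms by (simp add: q_arg_def)
next
  case False
  let ?\<eta> = "min q (1 / q)"
  have "0 < ?\<eta>" "?\<eta> < 1" using eta_bounds[OF \<open>0 < q\<close> False] by auto
  then have "0 \<le> 1 / ((1 - ?\<eta>) * ?\<eta>)" by simp
  moreover have "\<alpha> \<le> q_arg q (1 / ((1 - ?\<eta>) * ?\<eta>))"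
    using q_arg_large[OF assms(1) False] assms by simp
  ultimately obtain x where "0 \<le> x" "q_arg q x = \<alpha>"
    using IVT'[of "q_arg q" 0 \<alpha> "1 / ((1 - ?\<eta>) * ?\<eta>)"] q_arg_cont[OF assms(1) False] assms by auto
  then show ?thesis by (rule that)
qed

text \<open>Up to a positive modulus, cosine and sine of parameter \<open>q\<close> at
  \<open>x\<close> are \<open>cos\<close> and \<open>sin\<close> of \<open>q_arg q x\<close>. So the
  first positive zero of the cosine is the point where the argument reaches \<open>pi / 2\<close>,
  and before it \<open>q_tan q\<close> is \<open>tan\<close> of a strictly increasing function with
  values in \<open>[0, pi / 2)\<close>. The \<open>LEAST\<close> over the reals has to be justified
  by exhibiting that zero.\<close>

lemma q_arctan_unique:
  assumes q: "0 < q" and t: "0 < t" and a: "0 \<le> a" "q_arg q a = arctan t"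
  shows "q_arctan q t = a"
proof -
  obtain Z where Z: "0 \<le> Z" "q_arg q Z = pi / 2"
    by (rule q_arg_onto[OF q, of "pi / 2"]) auto
  then have "Z \<noteq> 0" by (metis pi_half_neq_zero q_arg_0)
  have cos0: "q_cos q (of_real z) = 0 \<longleftrightarrow> cos (q_arg q z) = 0" for z
    using q_trig_polar[OF q, of z] by (metis less_irrefl mult_eq_0_iff of_real_eq_0_iff)
  have range: "0 \<le> q_arg q z \<and> q_arg q z < pi / 2" if "z \<in> {0..<Z}" for z
    using that q_arg_less[OF q, of 0 z] q_arg_less[OF q, of z Z] Z by (cases "z = 0") auto
  have "q_zc q = Z"
    unfolding q_zc_def
  proof (rule Least_equality)
    show "0 < Z \<and> q_cos q (of_real Z) = 0" using Z(1) \<open>Z \<noteq> 0\<close> by (simp only: cos0 Z(2) cos_pi_half) simp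
    fix z assume z: "0 < z \<and> q_cos q (of_real z) = 0"
    show "Z \<le> z"
    proof (rule ccontr)
      assume "\<not> Z \<le> z"
      with z have "cos (q_arg q z) > 0" using range[of z] by (intro cos_gt_zero_pi) auto
      with z show False by (simp add: cos0)
    qed
  qed
  have tan: "q_tan q z = tan (q_arg q z)" for z
  proof -
    obtain \<rho> where "\<rho> > 0" "q_cos q (of_real z) = of_real (\<rho> * cos (q_arg q z))"
      "q_sin q (of_real z) = of_real (\<rho> * sin (q_arg q z))" by (rule q_trig_polar[OF q])
    then show ?thesis by (simp add: q_tan_def tan_def flip: of_real_mult of_real_divide)
  qed
  have "inj_on (q_tan q) {0..<Z}"
  proof (rule linorder_inj_onI')
    fix x y assume "x \<in> {0..<Z}" "y \<in> {0..<Z}" "x < y"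
    then have "tan (q_arg q x) < tan (q_arg q y)"
      using range[of x] range[of y] q_arg_less[OF q] by (intro tan_monotone) auto
    then show "q_tan q x \<noteq> q_tan q y" by (simp add: tan)
  qed
  moreover have "a < Z"
  proof (rule ccontr)
    assume "\<not> a < Z"
    then have "q_arg q Z \<le> q_arg q a" using q_arg_less[OF q, of Z a] by (cases "a = Z") auto
    then show False using a Z arctan_ubound[of t] by simp
  qed
  ultimately show ?thesis
    unfolding q_arctan_def \<open>q_zc q = Z\<close> using a by (intro the_inv_into_f_eq) (auto simp: tan tan_arctan)
qed

lemma q_arctan_spec:
  assumes "0 < q" "0 < t"
  shows "0 < q_arctan q t" "q_arg q (q_arctan q t) = arctan t"
proof -
  have "0 < arctan t" using assms by simp
  then obtain a where a: "0 \<le> a" "q_arg q a = arctan t"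
    using arctan_ubound[of t] by (auto intro: q_arg_onto[OF assms(1), of "arctan t"])
  then have "a \<noteq> 0" using \<open>0 < arctan t\<close> by auto
  with a q_arctan_unique[OF assms a] show "0 < q_arctan q t" "q_arg q (q_arctan q t) = arctan t" by auto
qed

section \<open>The two-variable q-exponential\<close>

text \<open>For \<open>y \<le> 0\<close> the two-variable cosine and sine at real \<open>a\<close>
  are its real and imaginary parts at \<open>z = \<i> * a\<close>. For \<open>q < 1\<close> the
  mixture continues the series, because \<open>exp (q * q_int q n * y)\<close> is the Poisson
  expectation of \<open>(q ^ n) ^ m\<close> in \<open>m\<close> with mean
  \<open>- (q * y / (1 - q))\<close>.\<close>

definition q_exp2 :: "real \<Rightarrow> complex \<Rightarrow> real \<Rightarrow> complex" where
  "q_exp2 q z y =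
     (if q = 1 then exp (z * of_real (exp y))
      else if q > 1 then \<Sum>n. z ^ n / of_real (q_fact q n) * of_real (exp (q * q_int q n * y))
      else poisson_mix (\<lambda>m. q_exp q (of_real (q ^ m) * z)) (of_real (- (q * y / (1 - q)))))"

text \<open>
  The delay differential equation \<open>E' y = q z exp (q y) E (q y)\<close> on the negative half-line, with
  \<open>E (-\<infinity>) = 1\<close>, is all that is needed of \<open>q_exp2\<close> away from \<open>y = 0\<close>.
\<close>

definition q_flow :: "real \<Rightarrow> complex \<Rightarrow> (real \<Rightarrow> complex) \<Rightarrow> bool" where
  "q_flow q z E \<longleftrightarrow> continuous_on {..0} E \<and> bounded (E ` {..0}) \<and> (E \<longlongrightarrow> 1) at_bot \<and>
     (\<forall>y<0. (E has_vector_derivative of_real (q * exp (q * y)) * z * E (q * y)) (at y))"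

text \<open>By \<open>r (Suc n) = q + q * r n\<close> and
  \<open>c (Suc n) * r (Suc n) = q * z * c n\<close>, the derivative of term \<open>Suc n\<close> is
  \<open>q * z * exp (q * y)\<close> times term \<open>n\<close> at \<open>q * y\<close>; term 0 is
  constant.\<close>

lemma q_flow_q_exp2_gt1:
  assumes "1 < q" shows "q_flow q z (q_exp2 q z)"
proof -
  define c where "c n = z ^ n / of_real (q_fact q n)" for n
  define r where "r n = q * q_int q n" for n
  have f: "q_exp2 q z = (\<lambda>y. \<Sum>n. c n * of_real (exp (r n * y)))"
    using assms by (simp add: q_exp2_def c_def r_def fun_eq_iff)
  have c: "summable (\<lambda>n. norm (c n))"
    unfolding c_def using assms by (intro summable_q_exp) auto
  have rS: "r (Suc n) = q + q * r n" for n
    using assms by (simp add: r_def q_int_Suc algebra_simps)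
  have r0: "0 \<le> r n" for n
    using order_trans[OF of_nat_0_le_iff q_int_ge[OF assms, of n]] assms by (simp add: r_def)
  have cS: "c (Suc n) * of_real (r (Suc n)) = of_real q * z * c n" for n
  proof -
    have "q_fact q n > 0" "q_fact q (Suc n) > 0" using q_fact_pos assms by auto
    moreover have "q_fact q (Suc n) = q_int q (Suc n) * q_fact q n" using assms by (simp add: q_fact_Suc)
    moreover have "q_int q (Suc n) \<noteq> 0" using q_int_ge[OF assms, of "Suc n"] by auto
    ultimately show ?thesis by (simp add: c_def r_def)
  qed
  \<comment> \<open>The same index shift reduces the coefficients of the derivative to a multiple of
    those of the series.\<close>
  have cr: "summable (\<lambda>n. norm (c n) * r n)"
  proof -
    have "norm (c (Suc n)) * r (Suc n) = norm (of_real q * z) * norm (c n)" for n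
      using arg_cong[OF cS[of n], of norm] r0[of "Suc n"] by (simp add: norm_mult)
    then have "summable (\<lambda>n. norm (c (Suc n)) * r (Suc n))"
      using summable_mult[OF c, of "norm (of_real q * z)"] by simp
    then show ?thesis by (subst (asm) summable_Suc_iff)
  qed
  note es = exp_series_deriv[OF c cr r0] exp_series_cont[OF c cr r0] exp_series_bound[OF c cr r0]
    exp_series_summable[OF c cr r0]
  have der: "(\<Sum>n. c n * of_real (r n) * of_real (exp (r n * y))) = of_real (q * exp (q * y)) * z * (\<Sum>n. c n * of_real (exp (r n * (q * y))))"
    if "y < 0" for y
  proof -
    have "q * y \<le> 0" using that assms by (simp add: mult_le_0_iff)
    note s = summable_norm_cancel[OF es(4)[OF this]]
    have "(\<lambda>n. of_real (q * exp (q * y)) * z * (c n * of_real (exp (r n * (q * y))))) sums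
        (of_real (q * exp (q * y)) * z * (\<Sum>n. c n * of_real (exp (r n * (q * y)))))"
      by (intro sums_mult summable_sums s)
    moreover have "of_real (q * exp (q * y)) * z * (c n * of_real (exp (r n * (q * y))))
        = c (Suc n) * of_real (r (Suc n)) * of_real (exp (r (Suc n) * y))" for n
    proof -
      have "exp (r (Suc n) * y) = exp (q * y) * exp (r n * (q * y))"
        by (simp add: rS exp_add[symmetric] algebra_simps)
      then show ?thesis unfolding cS by (simp add: mult_ac)
    qed
    ultimately have "(\<lambda>n. c (Suc n) * of_real (r (Suc n)) * of_real (exp (r (Suc n) * y))) sums
        (of_real (q * exp (q * y)) * z * (\<Sum>n. c n * of_real (exp (r n * (q * y)))))" by simp
    then have "(\<lambda>n. c n * of_real (r n) * of_real (exp (r n * y))) sums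
        (of_real (q * exp (q * y)) * z * (\<Sum>n. c n * of_real (exp (r n * (q * y)))))"
      by (subst (asm) sums_Suc_iff) (simp add: r_def)
    then show ?thesis by (rule sums_unique[symmetric])
  qed
  \<comment> \<open>Term 0 equals 1 and every other exponent is at least \<open>q\<close>, so the
    remainder is at most a constant times \<open>exp (q * y)\<close>.\<close>
  have lim: "((\<lambda>y. \<Sum>n. c n * of_real (exp (r n * y))) \<longlongrightarrow> 1) at_bot"
  proof -
    let ?K = "\<Sum>n. norm (c (Suc n))"
    have cSuc: "summable (\<lambda>n. norm (c (Suc n)))" using c by (subst summable_Suc_iff)
    have ev: "\<forall>\<^sub>F y in at_bot. norm ((\<Sum>n. c n * of_real (exp (r n * y))) - 1) \<le> exp (q * y) * ?K"
      using eventually_le_at_bot[of 0]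
    proof eventually_elim
      case (elim y)
      note s = es(4)[OF elim]
      have sS: "summable (\<lambda>n. norm (c (Suc n) * of_real (exp (r (Suc n) * y))))"
        using s by (subst summable_Suc_iff)
      have "(\<Sum>n. c n * of_real (exp (r n * y))) - 1 = (\<Sum>n. c (Suc n) * of_real (exp (r (Suc n) * y)))"
        using suminf_split_head[OF summable_norm_cancel[OF s]] by (simp add: c_def r_def q_fact_0)
      also have "norm \<dots> \<le> (\<Sum>n. norm (c (Suc n) * of_real (exp (r (Suc n) * y))))"
        by (rule summable_norm[OF sS])
      also have "\<dots> \<le> (\<Sum>n. exp (q * y) * norm (c (Suc n)))"
      proof (rule suminf_le[OF _ sS])
        show "summable (\<lambda>n. exp (q * y) * norm (c (Suc n)))" by (intro summable_mult cSuc)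
        fix n
        have "r (Suc n) * y \<le> q * y"
          using elim r0[of n] assms by (intro mult_right_mono_neg) (auto simp: rS)
        then have "exp (r (Suc n) * y) \<le> exp (q * y)" by (simp only: exp_le_cancel_iff)
        then have "norm (c (Suc n)) * exp (r (Suc n) * y) \<le> norm (c (Suc n)) * exp (q * y)"
          by (rule mult_left_mono) (rule norm_ge_zero)
        then show "norm (c (Suc n) * of_real (exp (r (Suc n) * y))) \<le> exp (q * y) * norm (c (Suc n))"
          by (simp only: norm_mult norm_of_real abs_exp_cancel mult.commute)
      qed
      also have "\<dots> = exp (q * y) * ?K" by (rule suminf_mult[OF cSuc])
      finally show ?case .
    qed
    have "((\<lambda>y. exp (q * y) * ?K) \<longlongrightarrow> 0) at_bot"
    proof (rule tendsto_mult_left_zero)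
      have "filterlim (\<lambda>y. q * y) at_bot at_bot"
        using assms by (intro filterlim_tendsto_pos_mult_at_bot[OF tendsto_const _ filterlim_ident]) auto
      from filterlim_compose[OF exp_at_bot this] show "((\<lambda>y. exp (q * y)) \<longlongrightarrow> 0) at_bot" .
    qed
    from Lim_null_comparison[OF ev this] show ?thesis by (rule LIM_zero_cancel)
  qed
  have "bounded (q_exp2 q z ` {..0})"
    unfolding bounded_iff f using es(3) by (intro exI[of _ "\<Sum>n. norm (c n)"]) blast
  moreover have "(q_exp2 q z has_vector_derivative of_real (q * exp (q * y)) * z * q_exp2 q z (q * y)) (at y)"
    if "y < 0" for y
    unfolding f using es(1)[OF that] by (simp only: der[OF that])
  ultimately show ?thesis
    unfolding q_flow_def using es(2) lim by (simp only: f) blast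
qed

lemma q_flow_q_exp2_1: "q_flow 1 z (q_exp2 1 z)"
proof -
  have f: "q_exp2 1 z = (\<lambda>y. exp (z * of_real (exp y)))" by (simp add: q_exp2_def fun_eq_iff)
  have "norm (exp (z * of_real (exp y))) \<le> exp (norm z)" if "y \<le> 0" for y
  proof -
    have "norm (exp (z * of_real (exp y))) \<le> exp (norm (z * of_real (exp y)))" by (rule norm_exp)
    also have "\<dots> \<le> exp (norm z)" using that by (simp add: norm_mult mult_left_le)
    finally show ?thesis .
  qed
  moreover have "((\<lambda>y::real. exp (z * of_real (exp y))) \<longlongrightarrow> exp (z * of_real 0)) at_bot"
    by (intro tendsto_intros exp_at_bot)
  moreover have "((\<lambda>y::real. exp (z * of_real (exp y))) has_vector_derivative
      of_real (1 * exp (1 * y)) * z * exp (z * of_real (exp (1 * y)))) (at y)" for y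
  proof -
    have "((\<lambda>w. exp (z * exp w)) has_field_derivative z * exp (of_real y) * exp (z * exp (of_real y))) (at (of_real y))"
      by (auto intro!: derivative_eq_intros)
    from has_vector_derivative_real_field[OF this] show ?thesis
      by (simp add: exp_of_real mult_ac)
  qed
  ultimately show ?thesis
    unfolding q_flow_def f by (auto simp: bounded_iff intro!: continuous_intros)
qed

text \<open>The scaling relation gives \<open>s (Suc m) - s m = - (1 - q) * z * q ^ m * s m\<close>,
  so the derivative of the mixture is again a mixture of \<open>s\<close>, with its mean multiplied
  by \<open>q\<close>. The bound and the limit at minus infinity follow from convergence of
  \<open>s\<close> to 1, the mean being nonnegative for \<open>y \<le> 0\<close>.\<close>

lemma q_flow_q_exp2_lt1:
  assumes q: "0 < q" "q < 1" and z: "\<And>n. z * of_real ((1 - q) * q ^ n) \<noteq> 1"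
  shows "q_flow q z (q_exp2 q z)"
proof -
  define s where "s m = q_exp q (of_real (q ^ m) * z)" for m
  define k where "k = q / (1 - q)"
  have k: "k > 0" using q by (simp add: k_def)
  have f: "q_exp2 q z = (\<lambda>y. poisson_mix s (of_real (- k * y)))"
    using q by (simp add: q_exp2_def s_def[abs_def] k_def fun_eq_iff)
  have lim: "s \<longlonglongrightarrow> 1" unfolding s_def by (rule q_exp_power_tendsto_lt1[OF q z])
  then have "Bseq s" using convergent_imp_Bseq convergent_def by blast
  then obtain B where B: "\<And>m. norm (s m) \<le> B" unfolding Bseq_def by blast
  have sS: "s (Suc m) - s m = - of_real (1 - q) * z * (of_real q ^ m * s m)" for m
  proof -
    have "of_real (q ^ m) * z * of_real ((1 - q) * q ^ n) \<noteq> 1" for n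
      using z[of "m + n"] by (simp add: power_add mult_ac)
    from q_exp_partial_lt1[OF q this, of 1]
    have "q_exp q (of_real q * (of_real (q ^ m) * z)) = (1 - of_real (1 - q) * (of_real (q ^ m) * z)) * s m"
      by (simp add: s_def)
    moreover have "of_real q * (of_real (q ^ m) * z) = of_real (q ^ Suc m) * z" by simp
    ultimately have "s (Suc m) = (1 - of_real (1 - q) * (of_real (q ^ m) * z)) * s m"
      by (simp only: s_def)
    then show ?thesis by (simp add: algebra_simps)
  qed
  have Bq: "norm (of_real q ^ m * s m) \<le> B" for m
  proof -
    have "norm (of_real q ^ m * s m) \<le> 1 * norm (s m)"
      unfolding norm_mult using q by (intro mult_right_mono) (auto simp: norm_power power_le_one)
    then show ?thesis using B[of m] by simp
  qed
  have der: "(q_exp2 q z has_vector_derivative of_real (q * exp (q * y)) * z * q_exp2 q z (q * y)) (at y)" for y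
  proof -
    have "(poisson_mix s has_field_derivative poisson_mix (\<lambda>m. s (Suc m) - s m) (of_real (- k * y)))
        (at (- of_real k * of_real y))"
      using poisson_mix_deriv[of s B, OF B, of "of_real (- k * y)"] by simp
    then have "((\<lambda>w. poisson_mix s (- of_real k * w)) has_field_derivative
        poisson_mix (\<lambda>m. s (Suc m) - s m) (of_real (- k * y)) * - of_real k) (at (of_real y))"
      by (rule DERIV_chain2) (auto intro!: derivative_eq_intros)
    from has_vector_derivative_real_field[OF this]
    have "(q_exp2 q z has_vector_derivative poisson_mix (\<lambda>m. s (Suc m) - s m) (of_real (- k * y)) * - of_real k) (at y)"
      by (simp add: f)
    also have "poisson_mix (\<lambda>m. s (Suc m) - s m) (of_real (- k * y))
        = - of_real (1 - q) * z * poisson_mix (\<lambda>m. of_real q ^ m * s m) (of_real (- k * y))"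
      unfolding sS by (rule poisson_mix_cmult[of _ B]) (rule Bq)
    also have "poisson_mix (\<lambda>m. of_real q ^ m * s m) (of_real (- k * y))
        = exp ((of_real q - 1) * of_real (- k * y)) * poisson_mix s (of_real q * of_real (- k * y))"
      by (rule poisson_mix_scale)
    also have "exp ((of_real q - 1) * of_real (- k * y)) = complex_of_real (exp (q * y))"
    proof -
      have "(q - 1) * (- k * y) = q * y" using q by (simp add: k_def field_simps)
      then have "(of_real q - 1) * of_real (- k * y) = complex_of_real (q * y)"
        by (metis of_real_1 of_real_diff of_real_mult)
      then show ?thesis by (simp only: exp_of_real)
    qed
    also have "poisson_mix s (of_real q * of_real (- k * y)) = q_exp2 q z (q * y)"
      by (simp add: f mult_ac)
    also have "- of_real (1 - q) * z * (complex_of_real (exp (q * y)) * q_exp2 q z (q * y)) * - of_real k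
        = of_real (((1 - q) * k) * exp (q * y)) * z * q_exp2 q z (q * y)"
      by (simp add: algebra_simps)
    also have "(1 - q) * k = q" using q by (simp add: k_def)
    finally show ?thesis .
  qed
  have bound: "norm (q_exp2 q z y) \<le> B" if "y \<le> 0" for y
  proof -
    have "norm (q_exp2 q z y) \<le> poisson_mix (\<lambda>_. B) (- k * y)"
      unfolding f using that k norm_poisson_mix_le[of s "\<lambda>_. B" B "- k * y"] B by (simp add: mult_le_0_iff)
    then show ?thesis by simp
  qed
  have "filterlim (\<lambda>y. - k * y) at_top at_bot"
    using filterlim_tendsto_pos_mult_at_top[OF tendsto_const k filterlim_uminus_at_top_at_bot] by simp
  from filterlim_compose[OF poisson_mix_tendsto[OF lim] this]
  have l: "(q_exp2 q z \<longlongrightarrow> 1) at_bot" by (simp only: f)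
  have "continuous_on {..0} (q_exp2 q z)"
    by (intro continuous_at_imp_continuous_on ballI) (rule has_vector_derivative_continuous[OF der])
  moreover have "bounded (q_exp2 q z ` {..0})"
    unfolding bounded_iff using bound by (intro exI[of _ B]) blast
  ultimately show ?thesis
    unfolding q_flow_def using der l by blast
qed

lemma q_exp2_at_0: "0 < q \<Longrightarrow> q_exp2 q z 0 = q_exp q z"
  by (cases q "1::real" rule: linorder_cases) (simp_all add: q_exp2_def q_exp_1 q_exp_def[of q z])

lemma q_flow_q_exp2_imag: "0 < q \<Longrightarrow> q_flow q (\<i> * of_real a) (q_exp2 q (\<i> * of_real a))"
  using q_flow_q_exp2_gt1 q_flow_q_exp2_1 q_flow_q_exp2_lt1[OF _ _ imag_not_pole]
  by (cases q "1::real" rule: linorder_cases) auto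

lemma Re_Im_poisson_mix:
  fixes s :: "nat \<Rightarrow> complex" and t :: real
  assumes "\<And>m. norm (s m) \<le> B"
  shows "Re (poisson_mix s (of_real t)) = poisson_mix (\<lambda>m. Re (s m)) t"
    and "Im (poisson_mix s (of_real t)) = poisson_mix (\<lambda>m. Im (s m)) t"
proof -
  have "summable (\<lambda>m. of_real t ^ m / fact m * s m)"
    by (rule summable_norm_cancel[OF summable_poisson_mix]) (rule assms)
  then have s: "(\<lambda>m. of_real (t ^ m / fact m) * s m) sums (\<Sum>m. of_real t ^ m / fact m * s m)"
    by (simp add: summable_sums)
  have "(\<lambda>m. t ^ m / fact m * Re (s m)) sums Re (\<Sum>m. of_real t ^ m / fact m * s m)"
    using sums_Re[OF s] by (simp only: Re_complex_of_real Im_complex_of_real times_complex.simps) simp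
  moreover have "(\<lambda>m. t ^ m / fact m * Im (s m)) sums Im (\<Sum>m. of_real t ^ m / fact m * s m)"
    using sums_Im[OF s] by (simp only: Re_complex_of_real Im_complex_of_real times_complex.simps) simp
  moreover have "exp (- of_real t) = complex_of_real (exp (- t))"
    by (simp add: exp_of_real[symmetric])
  ultimately show "Re (poisson_mix s (of_real t)) = poisson_mix (\<lambda>m. Re (s m)) t"
    "Im (poisson_mix s (of_real t)) = poisson_mix (\<lambda>m. Im (s m)) t"
    unfolding poisson_mix_def by (simp_all add: sums_iff)
qed

lemma q_exp_imag_bounded:
  assumes "0 < q" "q < 1"
  obtains B where "\<And>m. norm (q_exp q (of_real (q ^ m) * (\<i> * of_real a))) \<le> B"
proof -
  have "Bseq (\<lambda>m. q_exp q (of_real (q ^ m) * (\<i> * of_real a)))"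
    using q_exp_power_tendsto_lt1[OF assms imag_not_pole] convergent_imp_Bseq convergent_def by blast
  then show ?thesis using that unfolding Bseq_def by blast
qed

lemma q_exp2_sums:
  assumes q: "1 < q" and y: "y \<le> 0"
  shows "(\<lambda>n. z ^ n / of_real (q_fact q n) * of_real (exp (q * q_int q n * y))) sums q_exp2 q z y"
proof -
  have r0: "0 \<le> q * q_int q n" for n
    using order_trans[OF of_nat_0_le_iff q_int_ge[OF q, of n]] q by simp
  have "summable (\<lambda>n. z ^ n / of_real (q_fact q n) * of_real (exp (q * q_int q n * y)))"
  proof (rule summable_comparison_test'[where N = 0])
    show "summable (\<lambda>n. norm (z ^ n / of_real (q_fact q n)))"
      using q by (intro summable_q_exp) auto
    show "norm (z ^ n / of_real (q_fact q n) * of_real (exp (q * q_int q n * y))) \<le> norm (z ^ n / of_real (q_fact q n))" for n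
      unfolding norm_mult[of _ "of_real (exp _)"]
      using r0[of n] y by (intro mult_left_le) (auto simp: mult_nonneg_nonpos)
  qed
  from summable_sums[OF this] show ?thesis using q by (simp add: q_exp2_def)
qed

lemma q_trig2_Re_Im:
  assumes q: "0 < q" and y: "y \<le> 0"
  shows "q_cos2 q (of_real a) y = of_real (Re (q_exp2 q (\<i> * of_real a) y))"
    and "q_sin2 q (of_real a) y = of_real (Im (q_exp2 q (\<i> * of_real a) y))"
proof -
  have "q_cos2 q (of_real a) y = of_real (Re (q_exp2 q (\<i> * of_real a) y)) \<and>
    q_sin2 q (of_real a) y = of_real (Im (q_exp2 q (\<i> * of_real a) y))"
  proof (cases q "1::real" rule: linorder_cases)
    case less
    let ?s = "\<lambda>m. q_exp q (of_real (q ^ m) * (\<i> * of_real a))"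
    obtain B where B: "\<And>m. norm (?s m) \<le> B" using q_exp_imag_bounded[OF q less] by blast
    define t where "t = - (q * y / (1 - q))"
    have e: "q_exp2 q (\<i> * of_real a) y = poisson_mix ?s (of_real t)"
      using less by (simp add: q_exp2_def t_def)
    have s: "?s m = q_exp q (\<i> * of_real (q ^ m * a))" for m by (simp add: mult_ac)
    have c: "q_cos q (of_real (q ^ m) * of_real a) = of_real (Re (?s m))"
      and n: "q_sin q (of_real (q ^ m) * of_real a) = of_real (Im (?s m))" for m
      using q_trig_Re_Im[OF q, of "q ^ m * a"] unfolding s by simp_all
    have sr: "summable (\<lambda>m. t ^ m / fact m * Re (?s m))"
      by (rule summable_norm_cancel[OF summable_poisson_mix[of _ B]])
        (use order_trans[OF abs_Re_le_cmod B] in simp)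
    have si: "summable (\<lambda>m. t ^ m / fact m * Im (?s m))"
      by (rule summable_norm_cancel[OF summable_poisson_mix[of _ B]])
        (use order_trans[OF abs_Im_le_cmod B] in simp)
    have "q_cos2 q (of_real a) y = of_real (exp (- t)) * (\<Sum>m. of_real (t ^ m / fact m * Re (?s m)))"
      using less by (simp only: q_cos2_def c of_real_mult) (simp add: t_def)
    also have "\<dots> = of_real (poisson_mix (\<lambda>m. Re (?s m)) t)"
      by (simp only: suminf_of_real[OF sr] of_real_mult poisson_mix_def)
    finally have 1: "q_cos2 q (of_real a) y = of_real (Re (q_exp2 q (\<i> * of_real a) y))"
      by (simp only: e Re_Im_poisson_mix[of ?s B, OF B])
    have "q_sin2 q (of_real a) y = of_real (exp (- t)) * (\<Sum>m. of_real (t ^ m / fact m * Im (?s m)))"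
      using less by (simp only: q_sin2_def n of_real_mult) (simp add: t_def)
    also have "\<dots> = of_real (poisson_mix (\<lambda>m. Im (?s m)) t)"
      by (simp only: suminf_of_real[OF si] of_real_mult poisson_mix_def)
    finally have 2: "q_sin2 q (of_real a) y = of_real (Im (q_exp2 q (\<i> * of_real a) y))"
      by (simp only: e Re_Im_poisson_mix[of ?s B, OF B])
    from 1 2 show ?thesis ..
  next
    case equal
    have "exp (\<i> * of_real a * of_real (exp y)) = cis (a * exp y)"
      by (simp add: cis_conv_exp mult_ac)
    then show ?thesis using equal
      by (simp add: q_cos2_def q_sin2_def q_exp2_def cos_of_real[symmetric] sin_of_real[symmetric])
  next
    case greater
    define d where "d n = a ^ n / q_fact q n * exp (q * q_int q n * y)" for n
    have "(\<lambda>n. \<i> ^ n * of_real (d n)) sums q_exp2 q (\<i> * of_real a) y"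
      using q_exp2_sums[OF greater y, of "\<i> * of_real a"] by (simp add: d_def power_mult_distrib mult_ac)
    from i_power_sums[OF this, THEN sums_of_real[where 'a = complex], THEN sums_unique, symmetric]
    show ?thesis using greater
      by (simp add: q_cos2_def q_sin2_def d_def q_int_def mult_ac)
  qed
  then show "q_cos2 q (of_real a) y = of_real (Re (q_exp2 q (\<i> * of_real a) y))"
    "q_sin2 q (of_real a) y = of_real (Im (q_exp2 q (\<i> * of_real a) y))" by auto
qed

lemma q_exp2_imag_pos_le1:
  assumes q: "0 < q" "q \<le> 1" and a: "0 < a" "q_arg q a < pi / 2" and y: "y \<le> 0"
  shows "0 < Re (q_exp2 q (\<i> * of_real a) y)" "0 < Im (q_exp2 q (\<i> * of_real a) y)"
proof -
  have "0 < Re (q_exp2 q (\<i> * of_real a) y) \<and> 0 < Im (q_exp2 q (\<i> * of_real a) y)"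
  proof (cases "q = 1")
    case True
    have c: "exp (\<i> * of_real a * of_real (exp y)) = cis (a * exp y)"
      by (simp add: cis_conv_exp mult_ac)
    have "0 < a * exp y" using a by simp
    moreover have "a * exp y \<le> a" using a y by (intro mult_left_le) auto
    moreover have "a < pi / 2" using a True by (simp add: q_arg_def)
    ultimately have "0 < a * exp y" "a * exp y < pi / 2" by linarith+
    moreover from this have "a * exp y < pi" using pi_gt_zero by linarith
    ultimately show ?thesis using True c
      by (auto simp: q_exp2_def intro!: cos_gt_zero_pi sin_gt_zero)
  next
    case False
    then have lt: "q < 1" using q by simp
    let ?s = "\<lambda>m. q_exp q (of_real (q ^ m) * (\<i> * of_real a))"
    obtain B where B: "\<And>m. norm (?s m) \<le> B" using q_exp_imag_bounded[OF q(1) lt] by blast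
    have t: "0 \<le> - (q * y / (1 - q))" using lt q y by (simp add: divide_nonpos_pos mult_nonneg_nonpos)
    have e: "q_exp2 q (\<i> * of_real a) y = poisson_mix ?s (of_real (- (q * y / (1 - q))))"
      using lt by (simp add: q_exp2_def)
    have pos: "0 < Re (?s m) \<and> 0 < Im (?s m)" for m
    proof -
      \<comment> \<open>Every sampling point lies in \<open>(0, a]\<close>, where the argument is
        strictly between 0 and \<open>pi / 2\<close>; the sampled values therefore lie in the open
        first quadrant, and the weights are nonnegative because \<open>y \<le> 0\<close>.\<close>
      have x: "0 < q ^ m * a" "q ^ m * a \<le> a"
        using q a by (auto intro: mult_left_le_one_le power_le_one)
      have A: "0 < q_arg q (q ^ m * a)" "q_arg q (q ^ m * a) < pi / 2"
        using q_arg_less[OF q(1), of 0 "q ^ m * a"] q_arg_less[OF q(1), of "q ^ m * a" a] x a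
        by (cases "q ^ m * a = a"; auto)+
      then have "q_arg q (q ^ m * a) < pi" using pi_gt_zero by linarith
      obtain \<rho> where "\<rho> > 0" "q_exp q (\<i> * of_real (q ^ m * a)) = of_real \<rho> * cis (q_arg q (q ^ m * a))"
        by (rule q_trig_polar[OF q(1)])
      moreover have "of_real (q ^ m) * (\<i> * of_real a) = \<i> * complex_of_real (q ^ m * a)" by (simp add: mult_ac)
      ultimately have "?s m = of_real \<rho> * cis (q_arg q (q ^ m * a))" by (simp only:)
      then show ?thesis using A \<open>\<rho> > 0\<close> \<open>q_arg q (q ^ m * a) < pi\<close>
        by (auto intro!: mult_pos_pos cos_gt_zero_pi sin_gt_zero)
    qed
    have Bre: "norm (Re (?s m)) \<le> B" "norm (Im (?s m)) \<le> B" for m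
      using order_trans[OF abs_Re_le_cmod B] order_trans[OF abs_Im_le_cmod B] by auto
    show ?thesis
      unfolding e Re_Im_poisson_mix[of ?s B, OF B]
      using pos by (intro conjI poisson_mix_pos[of _ B] t Bre) auto
  qed
  then show "0 < Re (q_exp2 q (\<i> * of_real a) y)" "0 < Im (q_exp2 q (\<i> * of_real a) y)" by auto
qed

text \<open>By the delay equation \<open>E (s / q) / z\<close> is an antiderivative of
  \<open>exp s * E s\<close> on the negative half-line: the dilation undoes the delay. The limit 1
  at minus infinity gives the constant, boundedness of \<open>E\<close> the integrability.\<close>

lemma q_flow_integral:
  assumes q: "0 < q" and z: "z \<noteq> 0" and E: "q_flow q z E" and y: "y \<le> 0"
  shows "has_bochner_integral lborel (\<lambda>s. indicator {..<y} s *\<^sub>R (of_real (exp s) * E s)) ((E (y / q) - 1) / z)"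
proof -
  have cont: "continuous_on {..0} E" and lim: "(E \<longlongrightarrow> 1) at_bot"
    and der: "\<And>y. y < 0 \<Longrightarrow> (E has_vector_derivative of_real (q * exp (q * y)) * z * E (q * y)) (at y)"
    using E by (auto simp: q_flow_def)
  obtain B where B: "\<And>y. y \<le> 0 \<Longrightarrow> norm (E y) \<le> B"
    using E by (auto simp: q_flow_def bounded_iff)
  have int_exp: "set_integrable lborel {..<y} (\<lambda>s. exp s)"
  proof -
    have "(exp \<longlongrightarrow> exp y) (at_left y)" by (intro tendsto_intros)
    then show ?thesis
      using interval_integral_FTC_nonneg(1)[of "- \<infinity>" "ereal y" exp exp 0 "exp y"]
      by (simp add: ereal_tendsto_simps exp_at_bot)
  qed
  have int: "set_integrable lborel {..<y} (\<lambda>s. of_real (exp s) * E s)"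
  proof (rule set_integrable_bound)
    show "set_integrable lborel {..<y} (\<lambda>s. B * exp s)"
      using int_exp by (rule set_integrable_mult_right)
    have "continuous_on {..<y} (\<lambda>s. of_real (exp s) * E s)"
      using y by (intro continuous_intros continuous_on_subset[OF cont]) auto
    then show "set_borel_measurable lborel {..<y} (\<lambda>s. of_real (exp s) * E s)"
      unfolding set_borel_measurable_def
      using borel_measurable_continuous_on_indicator[of "{..<y}"] by simp
    have "norm (of_real (exp s) * E s) \<le> norm (B * exp s)" if "s < y" for s
    proof -
      have "norm (E s) \<le> \<bar>B\<bar>" using B[of s] that y by simp
      then show ?thesis by (simp add: norm_mult abs_mult mult.commute)
    qed
    then show "AE s in lborel. s \<in> {..<y} \<longrightarrow> norm (of_real (exp s) * E s) \<le> norm (B * exp s)" by simp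
  qed
  have "(LBINT s=-\<infinity>..ereal y. of_real (exp s) * E s) = E (y / q) / z - 1 / z"
  proof (rule interval_integral_FTC_integrable[where F = "\<lambda>s. E (s / q) / z"])
    fix x assume "ereal x < ereal y"
    then have x: "x < 0" using y by simp
    have "((\<lambda>s. s / q) has_vector_derivative 1 / q) (at x)"
      using q by (auto intro!: derivative_eq_intros simp: has_real_derivative_iff_has_vector_derivative[symmetric])
    from vector_diff_chain_at[OF this der[of "x / q"]] x q
    have "((\<lambda>s. E (s / q)) has_vector_derivative (1 / q) *\<^sub>R (of_real (q * exp x) * z * E x)) (at x)"
      by (simp add: o_def divide_neg_pos)
    from has_vector_derivative_divide[OF this, of z]
    show "((\<lambda>s. E (s / q) / z) has_vector_derivative of_real (exp x) * E x) (at x)"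
      using q z by (simp add: scaleR_conv_of_real)
    have "isCont E x"
      using der[OF x] by (rule has_vector_derivative_continuous)
    then show "isCont (\<lambda>s. of_real (exp s) * E s) x" by (intro continuous_intros)
  next
    show "set_integrable lborel (einterval (-\<infinity>) (ereal y)) (\<lambda>s. of_real (exp s) * E s)"
      using int by simp
    have "filterlim (\<lambda>s. (1 / q) * s) at_bot at_bot"
      using q by (intro filterlim_tendsto_pos_mult_at_bot[OF tendsto_const _ filterlim_ident]) auto
    then have fl: "filterlim (\<lambda>s. s / q) at_bot at_bot" by simp
    show "(((\<lambda>s. E (s / q) / z) \<circ> real_of_ereal) \<longlongrightarrow> 1 / z) (at_right (-\<infinity>))"
      unfolding ereal_tendsto_simps using z by (intro tendsto_intros filterlim_compose[OF lim fl])
    have "continuous_on {..y} (\<lambda>s. E (s / q))"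
      using y q by (intro continuous_on_compose2[OF cont] continuous_intros) (auto simp: divide_nonpos_pos)
    then have "((\<lambda>s. E (s / q)) \<longlongrightarrow> E (y / q)) (at y within {..y})"
      by (auto simp: continuous_on_def)
    then have "((\<lambda>s. E (s / q)) \<longlongrightarrow> E (y / q)) (at_left y)"
      by (rule tendsto_within_subset) auto
    then show "(((\<lambda>s. E (s / q) / z) \<circ> real_of_ereal) \<longlongrightarrow> E (y / q) / z) (at_left (ereal y))"
      unfolding ereal_tendsto_simps using z by (intro tendsto_intros)
  qed auto
  then have "(LBINT s:{..<y}. of_real (exp s) * E s) = (E (y / q) - 1) / z"
    by (simp add: interval_lebesgue_integral_def diff_divide_distrib)
  with int show ?thesis
    by (simp add: has_bochner_integral_iff set_integrable_def set_lebesgue_integral_def)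
qed

text \<open>Division by \<open>\<i> * a\<close> exchanges real and imaginary parts, so the cosine
  part integrates to the sine part and conversely. This couples the two half-lines when \<theta> is
  negative.\<close>

lemma q_flow_integral_Re_Im:
  assumes q: "0 < q" and a: "0 < a" and E: "q_flow q (\<i> * of_real a) E" and y: "y \<le> 0"
  shows "has_bochner_integral lborel (\<lambda>s. indicator {..<y} s * (exp s * Re (E s))) (Im (E (y / q)) / a)"
    and "has_bochner_integral lborel (\<lambda>s. indicator {..<y} s * (exp s * Im (E s))) ((1 - Re (E (y / q))) / a)"
proof -
  have "\<i> * complex_of_real a \<noteq> 0" using a by simp
  note * = q_flow_integral[OF q this E y]
  have **: "(w - 1) / (\<i> * of_real a) = Complex (Im w / a) ((1 - Re w) / a)" for w
    using a by (simp add: complex_eq_iff Re_divide Im_divide power2_eq_square field_simps)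
  show "has_bochner_integral lborel (\<lambda>s. indicator {..<y} s * (exp s * Re (E s))) (Im (E (y / q)) / a)"
    using has_bochner_integral_Re[OF *] unfolding ** by simp
  show "has_bochner_integral lborel (\<lambda>s. indicator {..<y} s * (exp s * Im (E s))) ((1 - Re (E (y / q))) / a)"
    using has_bochner_integral_Im[OF *] unfolding ** by simp
qed

section \<open>Kernels built from eigenfunctions\<close>

lemma phi_measurable [measurable]: "phi \<xi> \<in> borel_measurable borel"
  unfolding phi_def[abs_def] by measurable

lemma phi_nonneg: "0 \<le> \<xi> \<Longrightarrow> \<xi> \<le> 1 \<Longrightarrow> 0 \<le> phi \<xi> x"
  by (simp add: phi_def)

lemma phi_integral_finite:
  assumes "0 \<le> \<xi>" "\<xi> \<le> 1" shows "(\<integral>\<^sup>+x. ennreal (phi \<xi> x) \<partial>lborel) < \<infinity>"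
proof -
  interpret e: prob_space "density lborel (exponential_density 1)"
    by (rule prob_space_exponential_density) simp
  have 1: "(\<integral>\<^sup>+x. ennreal (exponential_density 1 x) \<partial>lborel) = 1"
    using e.emeasure_space_1 by (simp add: emeasure_density)
  then have 2: "(\<integral>\<^sup>+x. ennreal (exponential_density 1 (- x)) \<partial>lborel) = 1"
    by (subst (asm) nn_integral_real_affine[of _ "-1" 0]) (auto simp: exponential_density_def)
  have "(\<integral>\<^sup>+x. ennreal (phi \<xi> x) \<partial>lborel)
      \<le> (\<integral>\<^sup>+x. ennreal (exponential_density 1 x) + ennreal (exponential_density 1 (- x)) \<partial>lborel)"
  proof (rule nn_integral_mono)
    fix x :: real
    have "phi \<xi> x \<le> exponential_density 1 x + exponential_density 1 (- x)"
      using assms mult_right_mono[of \<xi> 1 "exp x"] mult_right_mono[of "1 - \<xi>" 1 "exp (- x)"]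
      by (auto simp: phi_def exponential_density_def)
    then show "ennreal (phi \<xi> x) \<le> ennreal (exponential_density 1 x) + ennreal (exponential_density 1 (- x))"
      by (subst ennreal_plus[symmetric]) (auto simp del: ennreal_plus intro: exponential_density_nonneg ennreal_leI)
  qed
  also have "\<dots> = 2"
    by (subst nn_integral_add) (simp_all add: 1 2)
  finally show ?thesis by (rule le_less_trans) simp
qed

text \<open>The kernel is the Doob transform by \<open>h\<close> of the kernel with density
  \<open>phi \<xi>\<close> above the threshold \<open>\<theta> * x\<close>, and \<open>eig\<close>
  is its normalisation. With nonnegative integrals, finiteness is part of the equation.\<close>

locale pker_eigen =
  fixes \<Omega> :: "real set" and \<theta> \<xi> lam :: real and h :: "real \<Rightarrow> real"
  assumes \<Omega>: "\<Omega> \<in> sets borel" and h_measurable [measurable]: "h \<in> borel_measurable borel"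
    and h_pos: "\<And>x. x \<in> \<Omega> \<Longrightarrow> 0 < h x" and lam_pos: "0 < lam" and \<xi>: "0 \<le> \<xi>" "\<xi> \<le> 1"
    and eig: "\<And>x. x \<in> \<Omega> \<Longrightarrow>
      (\<integral>\<^sup>+y. ennreal (indicator {\<theta> * x<..} y * (h y * phi \<xi> y)) * indicator \<Omega> y \<partial>lborel) = ennreal (lam * h x)"
begin

definition k :: "real \<Rightarrow> real \<Rightarrow> ennreal" where
  "k x y = ennreal (indicator {\<theta> * x<..} y * (h y / h x) * (1 / lam) * phi \<xi> y)"

lemma k_measurable_borel: "case_prod k \<in> borel_measurable (borel \<Otimes>\<^sub>M borel)"
proof -
  have "indicator {\<theta> * x<..} y = (if \<theta> * x < y then 1 else (0::real))" for x y
    by (simp add: indicator_def)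
  then show ?thesis unfolding k_def by (simp only:) measurable
qed

lemma pker_eq: "pker \<Omega> \<theta> \<xi> lam h = (\<lambda>x. density (restrict_space lborel \<Omega>) (k x))"
  by (simp only: pker_def[abs_def] k_def[abs_def])

lemma k_factor: "x \<in> \<Omega> \<Longrightarrow> y \<in> \<Omega> \<Longrightarrow>
    k x y = ennreal (1 / (lam * h x)) * ennreal (indicator {\<theta> * x<..} y * (h y * phi \<xi> y))"
  using h_pos[of x] h_pos[of y] lam_pos phi_nonneg[OF \<xi>, of y]
  by (simp add: k_def ennreal_mult[symmetric] mult_ac)

sublocale markov_density "restrict_space lborel \<Omega>" k
proof (intro markov_density.intro markov_density_axioms.intro)
  show "sigma_finite_measure (restrict_space (lborel :: real measure) \<Omega>)"
    using \<Omega> by (intro sigma_finite_measure_restrict_space lborel.sigma_finite_measure_axioms) auto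
  show "case_prod k \<in> borel_measurable (restrict_space lborel \<Omega> \<Otimes>\<^sub>M restrict_space lborel \<Omega>)"
  proof -
    have "(\<lambda>x. x) \<in> restrict_space lborel \<Omega> \<rightarrow>\<^sub>M (borel :: real measure)"
      by (intro measurable_restrict_space1) simp
    then have "(\<lambda>z. (fst z, snd z)) \<in> restrict_space lborel \<Omega> \<Otimes>\<^sub>M restrict_space lborel \<Omega> \<rightarrow>\<^sub>M (borel \<Otimes>\<^sub>M borel :: (real \<times> real) measure)"
      by (intro measurable_Pair measurable_compose[OF measurable_fst] measurable_compose[OF measurable_snd])
    from measurable_compose[OF this k_measurable_borel] show ?thesis by simp
  qed
  fix x assume "x \<in> space (restrict_space lborel \<Omega>)"
  then have x: "x \<in> \<Omega>" by (simp add: space_restrict_space)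
  have "(\<integral>\<^sup>+y. k x y \<partial>restrict_space lborel \<Omega>) = (\<integral>\<^sup>+y. k x y * indicator \<Omega> y \<partial>lborel)"
    using \<Omega> by (intro nn_integral_restrict_space) simp
  also have "\<dots> = (\<integral>\<^sup>+y. ennreal (1 / (lam * h x)) * (ennreal (indicator {\<theta> * x<..} y * (h y * phi \<xi> y)) * indicator \<Omega> y) \<partial>lborel)"
    by (intro nn_integral_cong) (auto simp: k_factor[OF x] indicator_def mult.assoc)
  also have "\<dots> = ennreal (1 / (lam * h x)) * ennreal (lam * h x)"
    using \<Omega> by (subst nn_integral_cmult) (auto simp: eig[OF x])
  also have "\<dots> = 1"
    using h_pos[OF x] lam_pos by (simp add: ennreal_mult[symmetric])
  finally show "(\<integral>\<^sup>+y. k x y \<partial>restrict_space lborel \<Omega>) = 1" .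
qed

lemma sets_eq: "sets (restrict_space lborel \<Omega>) = sets (restrict_space borel \<Omega>)"
  by (rule sets_restrict_space_cong) simp

lemma invariant_prob_iff: "invariant_prob \<Omega> (pker \<Omega> \<theta> \<xi> lam h) \<mu> \<longleftrightarrow> invariant \<mu>"
  by (simp add: invariant_prob_def invariant_def pker_eq sets_eq)

lemma markov_kernel_pker: "markov_kernel_on \<Omega> (pker \<Omega> \<theta> \<xi> lam h)"
proof -
  have "prob_algebra (restrict_space lborel \<Omega>) = prob_algebra (restrict_space borel \<Omega>)"
    unfolding prob_algebra_def using subprob_algebra_cong[OF sets_eq] by simp
  then show ?thesis
    using kernel_in_prob_algebra measurable_cong_sets[OF sets_eq refl]
    unfolding markov_kernel_on_def pker_eq by metis
qed

text \<open>From a point with \<open>\<theta> * x \<le> c n\<close> the whole interval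
  \<open>{c n<..<d n}\<close> lies above the threshold and is charged by the kernel.\<close>

lemma unique_invariant_probI:
  fixes c d :: "nat \<Rightarrow> real"
  assumes c: "incseq c" "\<And>n. c n < d n" "\<And>x. x \<in> \<Omega> \<Longrightarrow> \<exists>n. \<theta> * x \<le> c n"
    and sub: "\<And>n. {c n<..<d n} \<subseteq> \<Omega>" and pos: "\<And>n y. y \<in> {c n<..<d n} \<Longrightarrow> 0 < phi \<xi> y"
    and inv: "invariant_prob \<Omega> (pker \<Omega> \<theta> \<xi> lam h) \<pi>"
  shows "unique_invariant_prob \<Omega> (pker \<Omega> \<theta> \<xi> lam h) \<pi>"
  unfolding unique_invariant_prob_def
proof (intro conjI allI impI markov_kernel_pker inv)
  fix \<mu> assume "invariant_prob \<Omega> (pker \<Omega> \<theta> \<xi> lam h) \<mu>"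
  show "\<mu> = \<pi>"
  proof (rule invariant_unique[of "\<lambda>n. {x \<in> \<Omega>. \<theta> * x \<le> c n}" "\<lambda>n. {c n<..<d n}"])
    show "incseq (\<lambda>n. {x \<in> \<Omega>. \<theta> * x \<le> c n})"
      using c(1) by (fastforce simp: incseq_def intro: order_trans)
    show "space (restrict_space lborel \<Omega>) \<subseteq> (\<Union>n. {x \<in> \<Omega>. \<theta> * x \<le> c n})"
      using c(3) by (auto simp: space_restrict_space)
    have "{x \<in> \<Omega>. \<theta> * x \<le> c n} = \<Omega> \<inter> {x. \<theta> * x \<le> c n}" for n by auto
    then show "{x \<in> \<Omega>. \<theta> * x \<le> c n} \<in> sets (restrict_space lborel \<Omega>)" for n
      by (auto simp: sets_restrict_space)
    have Bs: "{c n<..<d n} \<in> sets (restrict_space lborel \<Omega>)" for n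
      using sub[of n] \<Omega> by (simp add: sets_restrict_space_iff)
    then show "{c n<..<d n} \<in> sets (restrict_space lborel \<Omega>)" for n .
    show "emeasure (restrict_space lborel \<Omega>) {c n<..<d n} \<noteq> 0" for n
      using sub[of n] \<Omega> c(2)[of n] by (subst emeasure_restrict_space) auto
    show "k x y \<noteq> 0" if "x \<in> {x \<in> \<Omega>. \<theta> * x \<le> c n}" "y \<in> {c n<..<d n}" for n x y
    proof -
      have y: "y \<in> \<Omega>" "0 < phi \<xi> y" "\<theta> * x < y" using that sub[of n] pos[of y n] by auto
      then have "0 < indicator {\<theta> * x<..} y * (h y / h x) * (1 / lam) * phi \<xi> y"
        using that h_pos[of x] h_pos[of y] lam_pos by simp
      then show ?thesis unfolding k_def by (simp add: ennreal_eq_0_iff)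
    qed
  qed (use inv \<open>invariant_prob \<Omega> (pker \<Omega> \<theta> \<xi> lam h) \<mu>\<close> in \<open>simp_all add: invariant_prob_iff\<close>)
qed

end

lemma pker_eigen_unique_UNIV:
  assumes "pker_eigen UNIV \<theta> \<xi> lam h" "\<xi> < 1" "invariant_prob UNIV (pker UNIV \<theta> \<xi> lam h) \<pi>"
  shows "unique_invariant_prob UNIV (pker UNIV \<theta> \<xi> lam h) \<pi>"
proof -
  interpret pker_eigen UNIV \<theta> \<xi> lam h by fact
  show ?thesis
  proof (rule unique_invariant_probI[OF _ _ _ _ _ assms(3)])
    show "incseq real" by (simp add: incseq_def)
    show "\<exists>n. \<theta> * x \<le> real n" for x by (rule real_arch_simple)
    show "0 < phi \<xi> y" if "y \<in> {real n<..<real n + 1}" for n y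
      using that assms(2) by (auto simp: phi_def)
  qed auto
qed

section \<open>The eigenfunction for negative parameter\<close>

text \<open>With \<open>t = sqrt (\<xi> / (1 - \<xi>))\<close> and \<open>E\<close> the two-variable
  q-exponential at \<open>\<i> * a\<close>, this is the eigenfunction for negative \<theta>. The two
  pieces join continuously at 0 exactly when \<open>Im (E 0) = t * Re (E 0)\<close>.\<close>

definition flow_eigen :: "real \<Rightarrow> (real \<Rightarrow> complex) \<Rightarrow> real \<Rightarrow> real" where
  "flow_eigen t E x = (if x > 0 then Re (E (- x)) else 1 / t * Im (E x))"

lemma flow_eigen_measurable:
  assumes "continuous_on {..0} E" shows "flow_eigen t E \<in> borel_measurable borel"
proof -
  have "continuous_on {0<..} (\<lambda>x. Re (E (- x)))"
    by (intro continuous_intros continuous_on_compose2[OF assms]) auto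
  then have [measurable]: "(\<lambda>x. indicator {0<..} x *\<^sub>R Re (E (- x))) \<in> borel_measurable borel"
    by (rule borel_measurable_continuous_on_indicator[rotated]) simp
  have "continuous_on {..0} (\<lambda>x. 1 / t * Im (E x))"
    by (intro continuous_intros assms)
  then have [measurable]: "(\<lambda>x. indicator {..0} x *\<^sub>R (1 / t * Im (E x))) \<in> borel_measurable borel"
    by (rule borel_measurable_continuous_on_indicator[rotated]) simp
  have "flow_eigen t E = (\<lambda>x. indicator {0<..} x *\<^sub>R Re (E (- x)) + indicator {..0} x *\<^sub>R (1 / t * Im (E x)))"
    by (auto simp: flow_eigen_def fun_eq_iff)
  then show ?thesis by (simp only:) measurable
qed

lemma flow_eigen_bounded:
  assumes "q_flow q z E" "0 < t" obtains B where "\<And>x. \<bar>flow_eigen t E x\<bar> \<le> B"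
proof -
  obtain B where B: "\<And>y. y \<le> 0 \<Longrightarrow> norm (E y) \<le> B"
    using assms(1) by (auto simp: q_flow_def bounded_iff)
  have "0 \<le> B" using order_trans[OF norm_ge_zero B[of 0]] by simp
  show ?thesis
  proof
    fix x
    have "\<bar>Re (E (- x))\<bar> \<le> B" if "x > 0" using order_trans[OF abs_Re_le_cmod B] that by simp
    moreover have "\<bar>Im (E x)\<bar> / t \<le> B / t" if "x \<le> 0"
      using order_trans[OF abs_Im_le_cmod B] that assms(2) by (simp add: divide_right_mono)
    moreover have "0 \<le> B / t" using \<open>0 \<le> B\<close> assms(2) by simp
    ultimately show "\<bar>flow_eigen t E x\<bar> \<le> B + B / t"
      using \<open>0 \<le> B\<close> assms(2) by (auto simp: flow_eigen_def abs_mult not_less intro: add_increasing add_increasing2)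
  qed
qed

text \<open>
  The two normalising conditions on \<open>lam\<close> encode \<open>t\<^sup>2 = \<xi> / (1 - \<xi>)\<close> and
  \<open>lam = sqrt (\<xi> (1 - \<xi>)) / a\<close>.
\<close>

locale eigen_flow =
  fixes q a t \<xi> lam :: real and E :: "real \<Rightarrow> complex"
  assumes q: "0 < q" and a: "0 < a" and t: "0 < t" and \<xi>: "0 < \<xi>" "\<xi> < 1" and lam: "0 < lam"
    and lam1: "(1 - \<xi>) / (a * lam) = 1 / t" and lam2: "\<xi> / (t * a * lam) = 1"
    and E: "q_flow q (\<i> * of_real a) E" and match: "Im (E 0) = t * Re (E 0)"
begin

lemma E_cont: "continuous_on {..0} E" and E_lim: "(E \<longlongrightarrow> 1) at_bot"
  using E by (auto simp: q_flow_def)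

lemma h_measurable [measurable]: "flow_eigen t E \<in> borel_measurable borel"
  by (rule flow_eigen_measurable[OF E_cont])

lemma positive_half_line:
  assumes "v \<le> 0"
  shows "has_bochner_integral lborel (\<lambda>y. indicator {- v<..} y * (exp (- y) * Re (E (- y)))) (Im (E (v / q)) / a)"
proof -
  have "(\<lambda>x. indicator {- v<..} (0 + - 1 * x) * (exp (- (0 + - 1 * x)) * Re (E (- (0 + - 1 * x))))) =
      (\<lambda>s. indicator {..<v} s * (exp s * Re (E s)))"
    by (auto simp: indicator_def fun_eq_iff)
  then show ?thesis
    using q_flow_integral_Re_Im(1)[OF q a E assms]
    by (subst lborel_has_bochner_integral_real_affine_iff[of "- 1" _ _ 0]) auto
qed

text \<open>For \<open>x \<le> 0\<close> the threshold \<open>- q * x\<close> is nonnegative, and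
  the cosine above it integrates to the sine. For \<open>x > 0\<close> the positive half-line
  contributes \<open>Re (E 0)\<close>, thanks to \<open>match\<close>, and the strip from
  \<open>- q * x\<close> to 0 contributes \<open>Re (E (- x)) - Re (E 0)\<close>, so the boundary
  terms cancel.\<close>

lemma eigen: "has_bochner_integral lborel
  (\<lambda>y. indicator {- q * x<..} y * (flow_eigen t E y * (phi \<xi> y / lam))) (flow_eigen t E x)"
proof (cases "x \<le> 0")
  case True
  then have v: "q * x \<le> 0" using q by (simp add: mult_nonneg_nonpos)
  have "(\<lambda>y. indicator {- q * x<..} y * (flow_eigen t E y * (phi \<xi> y / lam))) =
      (\<lambda>y. (1 - \<xi>) / lam * (indicator {- (q * x)<..} y * (exp (- y) * Re (E (- y)))))"
  proof
    fix y
    show "indicator {- q * x<..} y * (flow_eigen t E y * (phi \<xi> y / lam)) =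
      (1 - \<xi>) / lam * (indicator {- (q * x)<..} y * (exp (- y) * Re (E (- y))))"
    proof (cases "- (q * x) < y")
      case True
      then have "y > 0" using v by linarith
      with True show ?thesis by (simp add: flow_eigen_def phi_def)
    qed simp
  qed
  moreover have "(1 - \<xi>) / lam * (Im (E x) / a) = flow_eigen t E x"
  proof -
    have "(1 - \<xi>) / lam * (Im (E x) / a) = (1 - \<xi>) / (a * lam) * Im (E x)" by simp
    then show ?thesis unfolding lam1 using True by (simp add: flow_eigen_def)
  qed
  ultimately show ?thesis
    using has_bochner_integral_mult_right[OF positive_half_line[OF v], of "(1 - \<xi>) / lam"] q by simp
next
  case False
  then have x: "x > 0" by simp
  then have u: "- q * x < 0" using q by simp
  let ?P = "\<lambda>y. indicator {- 0<..} y * (exp (- y) * Re (E (- y)))"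
  let ?G = "\<lambda>v y. indicator {..<v} y * (exp y * Im (E y))"
  have G: "has_bochner_integral lborel (?G v) ((1 - Re (E (v / q))) / a)" if "v \<le> 0" for v
    using q_flow_integral_Re_Im(2)[OF q a E that] .
  have sum: "has_bochner_integral lborel (\<lambda>y. (1 - \<xi>) / lam * ?P y + \<xi> / (t * lam) * (?G 0 y - ?G (- q * x) y))
      ((1 - \<xi>) / lam * (Im (E (0 / q)) / a) +
       \<xi> / (t * lam) * ((1 - Re (E (0 / q))) / a - (1 - Re (E (- q * x / q))) / a))"
    using u by (intro has_bochner_integral_add has_bochner_integral_diff has_bochner_integral_mult_right G
        positive_half_line) auto
  have val: "(1 - \<xi>) / lam * (Im (E (0 / q)) / a) +
       \<xi> / (t * lam) * ((1 - Re (E (0 / q))) / a - (1 - Re (E (- q * x / q))) / a) = flow_eigen t E x"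
  proof -
    have "(1 - \<xi>) / lam * (Im (E (0 / q)) / a) = (1 - \<xi>) / (a * lam) * (t * Re (E 0))"
      by (simp add: match)
    also have "\<dots> = Re (E 0)" unfolding lam1 using t by simp
    finally have 1: "(1 - \<xi>) / lam * (Im (E (0 / q)) / a) = Re (E 0)" .
    have "\<xi> / (t * lam) * ((1 - Re (E (0 / q))) / a - (1 - Re (E (- q * x / q))) / a)
        = \<xi> / (t * a * lam) * (Re (E (- x)) - Re (E 0))"
      using q by (simp add: diff_divide_distrib[symmetric] mult_ac)
    then show ?thesis unfolding 1 using x by (simp add: lam2 flow_eigen_def)
  qed
  have "AE y in lborel. (1 - \<xi>) / lam * ?P y + \<xi> / (t * lam) * (?G 0 y - ?G (- q * x) y)
      = indicator {- q * x<..} y * (flow_eigen t E y * (phi \<xi> y / lam))"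
    using AE_lborel_singleton[of "- q * x"]
  proof eventually_elim
    case (elim y)
    consider "y < - q * x" | "- q * x < y" "y < 0" | "y = 0" | "y > 0" using elim by linarith
    then show ?case using u by cases (auto simp: flow_eigen_def phi_def indicator_def)
  qed
  then show ?thesis
    using sum borel_measurable_has_bochner_integral[OF sum] unfolding val
    by (subst (asm) has_bochner_integral_cong_AE[where g =
        "\<lambda>y. indicator {- q * x<..} y * (flow_eigen t E y * (phi \<xi> y / lam))"]) auto
qed

lemma nn_eigen:
  assumes "\<And>x. 0 < flow_eigen t E x"
  shows "(\<integral>\<^sup>+y. ennreal (indicator {- q * x<..} y * (flow_eigen t E y * (phi \<xi> y / lam))) \<partial>lborel) = ennreal (flow_eigen t E x)"
proof -
  have "0 \<le> flow_eigen t E y" for y using assms[of y] by simp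
  then have "0 \<le> indicator {- q * x<..} y * (flow_eigen t E y * (phi \<xi> y / lam))" for y
    using phi_nonneg[of \<xi> y] \<xi> lam by simp
  then show ?thesis
    using eigen[of x] by (subst nn_integral_eq_integral) (auto simp: has_bochner_integral_iff)
qed

end

text \<open>
  For \<open>q > 1\<close> the series defining the eigenfunction alternates. Positivity is transferred from
  \<open>1 / q\<close>, whose eigenfunction is the positive eigenvector of the adjoint operator.
\<close>

lemma eigen_flow_positive:
  assumes "eigen_flow q a t \<xi> lam E" "eigen_flow (1 / q) a t \<xi> lam E'"
    and pos': "\<And>x. 0 < flow_eigen t E' x"
  shows "0 < flow_eigen t E x"
proof -
  interpret F: eigen_flow q a t \<xi> lam E by fact
  interpret G: eigen_flow "1 / q" a t \<xi> lam E' by fact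
  let ?h = "flow_eigen t E" and ?g = "flow_eigen t E'"
  let ?w = "\<lambda>y. phi \<xi> y / lam"
  have w0: "0 \<le> ?w y" for y using phi_nonneg[of \<xi> y] F.\<xi> F.lam by simp
  obtain B where B: "\<And>x. \<bar>?h x\<bar> \<le> B" using flow_eigen_bounded[OF F.E F.t] by blast
  obtain B' where B': "\<And>x. \<bar>?g x\<bar> \<le> B'" using flow_eigen_bounded[OF G.E G.t] by blast
  have B0: "0 \<le> B" "0 \<le> B'" using order_trans[OF abs_ge_zero B[of 0]] order_trans[OF abs_ge_zero B'[of 0]] by auto
  have fin: "(\<integral>\<^sup>+x. ennreal (?w x * ?g x * \<bar>?h x\<bar>) \<partial>lborel) < \<infinity>"
  proof -
    have "(\<integral>\<^sup>+x. ennreal (?w x * ?g x * \<bar>?h x\<bar>) \<partial>lborel) \<le> (\<integral>\<^sup>+x. ennreal (B' * B / lam) * ennreal (phi \<xi> x) \<partial>lborel)"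
    proof (rule nn_integral_mono)
      fix x
      have "?w x * ?g x * \<bar>?h x\<bar> = ?w x * (?g x * \<bar>?h x\<bar>)" by simp
      also have "\<dots> \<le> ?w x * (B' * B)"
        using B[of x] B'[of x] pos'[of x] B0 by (intro mult_left_mono mult_mono w0) auto
      finally have "?w x * ?g x * \<bar>?h x\<bar> \<le> B' * B / lam * phi \<xi> x" by (simp add: mult_ac)
      then show "ennreal (?w x * ?g x * \<bar>?h x\<bar>) \<le> ennreal (B' * B / lam) * ennreal (phi \<xi> x)"
        using B0 F.lam phi_nonneg[of \<xi> x] F.\<xi> by (subst ennreal_mult[symmetric]) (auto intro: ennreal_leI)
    qed
    also have "\<dots> = ennreal (B' * B / lam) * (\<integral>\<^sup>+x. ennreal (phi \<xi> x) \<partial>lborel)"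
      by (rule nn_integral_cmult) simp
    also have "\<dots> < \<infinity>"
      using phi_integral_finite[of \<xi>] F.\<xi> by (simp add: ennreal_mult_less_top)
    finally show ?thesis .
  qed
  have lim: "((\<lambda>y. Re (E y)) \<longlongrightarrow> 1) at_bot" using tendsto_Re[OF F.E_lim] by simp
  then have "\<forall>\<^sub>F y in at_bot. 0 < Re (E y)" by (rule order_tendstoD) simp
  then obtain N where N: "\<And>y. y \<le> N \<Longrightarrow> 0 < Re (E y)" by (auto simp: eventually_at_bot_linorder)
  have nz: "?h z \<noteq> 0" for z
  proof
    assume hz: "?h z = 0"
    \<comment> \<open>The multiplier \<open>- q\<close> being negative, the limit is taken from the
      right. At \<open>z = 0\<close> this approaches the cosine branch, whose limit
      \<open>Re (E 0)\<close> equals the value of the sine branch by \<open>match\<close>.\<close>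
    have cont: "(?h \<longlongrightarrow> ?h z) (at z within {x. - q * x < - q * z})"
    proof -
      have "{x. - q * x < - q * z} = {z<..}" using F.q by auto
      moreover have "(?h \<longlongrightarrow> ?h z) (at_right z)"
      proof (cases "z \<ge> 0")
        case True
        have hz': "?h z = Re (E (- z))"
          using True F.match F.t by (cases "z = 0") (auto simp: flow_eigen_def)
        have "continuous_on {z..} (\<lambda>x. Re (E (- x)))"
          using True by (intro continuous_intros continuous_on_compose2[OF F.E_cont]) auto
        then have "((\<lambda>x. Re (E (- x))) \<longlongrightarrow> Re (E (- z))) (at z within {z..})"
          by (auto simp: continuous_on_def)
        then have "((\<lambda>x. Re (E (- x))) \<longlongrightarrow> ?h z) (at_right z)"
          unfolding hz' by (rule tendsto_within_subset) auto
        moreover have "\<forall>\<^sub>F x in at_right z. Re (E (- x)) = ?h x"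
          using True by (auto simp: eventually_at_filter flow_eigen_def)
        ultimately show ?thesis by (rule Lim_transform_eventually)
      next
        case False
        have "continuous_on {..<0} (\<lambda>x. 1 / t * Im (E x))"
          by (intro continuous_intros continuous_on_subset[OF F.E_cont]) auto
        then have "isCont (\<lambda>x. 1 / t * Im (E x)) z"
          using False by (simp add: continuous_on_eq_continuous_at)
        moreover have "\<forall>\<^sub>F x in nhds z. x \<in> {..<0::real}"
          using False by (intro eventually_nhds_in_open) auto
        then have "\<forall>\<^sub>F x in nhds z. 1 / t * Im (E x) = ?h x"
          by eventually_elim (auto simp: flow_eigen_def)
        ultimately have "isCont ?h z" by (simp add: isCont_cong)
        then show ?thesis by (simp add: isCont_def filterlim_at_split)
      qed
      ultimately show ?thesis by simp
    qed
    interpret P: eigen_pair ?h ?w ?g "- q"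
    proof
      show "integral\<^sup>L lborel (\<lambda>y. indicator {- q * x<..} y * (?h y * ?w y)) = ?h x" for x
        using F.eigen[of x] by (simp add: has_bochner_integral_iff)
      show "(\<integral>\<^sup>+x. ennreal (indicator {- q * x<..} y * (?g x * ?w x)) \<partial>lborel) = ennreal (?g y)" for y
      proof -
        have "indicator {- q * x<..} y = (indicator {- (1 / q) * y<..} x :: real)" for x
          using F.q by (auto simp: indicator_def field_simps)
        then show ?thesis using G.nn_eigen[OF pos', of y] by simp
      qed
      show "0 \<le> ?g x" for x using pos'[of x] by simp
    qed (use fin w0 in auto)
    have "AE x in lborel. x \<in> UNIV \<longrightarrow> 0 < ?w x * ?g x"
      using AE_lborel_singleton[of 0]
      by eventually_elim (use pos' F.\<xi> F.lam in \<open>auto simp: phi_def not_less_iff_gr_or_eq\<close>)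
    from P.zero_propagates[OF _ open_UNIV UNIV_I this cont hz]
    have zero: "AE y in lborel. - q * z < y \<longrightarrow> ?h y * ?w y = 0" using F.q by simp
    \<comment> \<open>The zero has spread over everything above \<open>- q * z\<close>; but beyond
      \<open>m\<close> the eigenfunction is \<open>Re (E (- y))\<close> with \<open>- y < N\<close>,
      positive since \<open>E\<close> tends to 1 at minus infinity.\<close>
    define m where "m = max (max 0 (- q * z)) (- N)"
    from zero have "AE y in lborel. y \<notin> {m<..<m + 1}"
    proof eventually_elim
      case (elim y)
      show ?case
      proof
        assume "y \<in> {m<..<m + 1}"
        then have y: "0 < y" "- q * z < y" "- N < y" by (auto simp: m_def)
        then have "0 < ?h y" "0 < ?w y"
          using N[of "- y"] F.\<xi> F.lam by (auto simp: flow_eigen_def phi_def)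
        then have "0 < ?h y * ?w y" by (rule mult_pos_pos)
        moreover have "- q * z < y" using y by simp
        ultimately show False using elim by (metis less_irrefl)
      qed
    qed
    then show False using AE_meets_interval[of m "m + 1"] by simp
  qed
  have Re0: "Re (E y) \<noteq> 0" if "y \<le> 0" for y
  proof (cases "y = 0")
    case True
    have "?h 0 = Re (E 0)" using F.match F.t by (simp add: flow_eigen_def)
    then show ?thesis using nz[of 0] True by simp
  next
    case False
    then show ?thesis using nz[of "- y"] that by (simp add: flow_eigen_def)
  qed
  have Im0: "Im (E y) \<noteq> 0" if "y \<le> 0" for y
    using nz[of y] that by (auto simp: flow_eigen_def)
  have Re_pos: "0 < Re (E y)" if "y \<le> 0" for y
    using that Re0 lim
    by (intro positive_if_nonzero[of y "\<lambda>y. Re (E y)"] continuous_intros continuous_on_subset[OF F.E_cont]) auto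
  \<comment> \<open>\<open>Im E\<close> tends to 0 at minus infinity, so its sign cannot be read off
    there; it is taken from 0, where \<open>match\<close> ties it to \<open>Re E\<close>.\<close>
  have Im_pos: "0 < Im (E y)" if y: "y \<le> 0" for y
  proof (rule ccontr)
    assume "\<not> ?thesis"
    then have neg: "Im (E y) \<le> 0" by simp
    have "0 \<le> Im (E 0)" unfolding F.match using Re_pos[of 0] F.t by simp
    moreover have "continuous_on {y..0} (\<lambda>y. Im (E y))"
      using y by (intro continuous_intros continuous_on_subset[OF F.E_cont]) auto
    ultimately obtain x where "y \<le> x" "x \<le> 0" "Im (E x) = 0"
      using IVT'[of "\<lambda>y. Im (E y)" y 0 0] neg y by auto
    then show False using Im0[of x] by simp
  qed
  show ?thesis using Re_pos[of "- x"] Im_pos[of x] F.t by (simp add: flow_eigen_def)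
qed

section \<open>Laws on the whole line and exponential tails\<close>

lemma restrict_space_UNIV_eq: "sets M = sets (borel :: 'b::topological_space measure) \<Longrightarrow> restrict_space M UNIV = M"
  by (rule measure_eqI) (auto simp: sets_restrict_space emeasure_restrict_space dest: sets_eq_imp_space_eq)

lemma law_on_UNIV: "law_on UNIV M X = distr M borel X"
  by (simp add: law_on_def restrict_space_UNIV_eq)

lemma nn_integral_exp_tail:
  assumes "0 < c"
  shows "(\<integral>\<^sup>+y. ennreal (indicator {v<..} y * (c * exp (- c * y))) \<partial>lborel) = ennreal (exp (- c * v))"
proof -
  have "(\<integral>\<^sup>+y. ennreal (indicator {v<..} y * (c * exp (- c * y))) \<partial>lborel)
      = (\<integral>\<^sup>+y. ennreal (c * exp (- c * y)) * indicator {v..} y \<partial>lborel)"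
    using AE_lborel_singleton[of v]
    by (intro nn_integral_cong_AE, eventually_elim) (auto simp: indicator_def)
  also have "\<dots> = ennreal (0 - (- exp (- c * v)))"
  proof (rule nn_integral_FTC_atLeast)
    show "DERIV (\<lambda>y. - exp (- c * y)) x :> c * exp (- c * x)" for x
      by (auto intro!: derivative_eq_intros)
    have "filterlim (\<lambda>y. (- c) * y) at_bot at_top"
      using assms by (intro filterlim_tendsto_neg_mult_at_bot[OF tendsto_const _ filterlim_ident]) auto
    from tendsto_minus[OF filterlim_compose[OF exp_at_bot this]]
    show "((\<lambda>y. - exp (- c * y)) \<longlongrightarrow> 0) at_top" by simp
  qed (use assms in auto)
  finally show ?thesis by simp
qed

lemma nn_integral_exp_tail_neg:
  assumes "0 < c"
  shows "(\<integral>\<^sup>+x. ennreal (indicator {..<v} x * (c * exp (c * x))) \<partial>lborel) = ennreal (exp (c * v))"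
proof -
  have "(\<integral>\<^sup>+x. ennreal (indicator {..<v} x * (c * exp (c * x))) \<partial>lborel)
      = (\<integral>\<^sup>+y. ennreal (indicator {- v<..} y * (c * exp (- c * y))) \<partial>lborel)"
    by (subst nn_integral_real_affine[of _ "-1" 0]) (auto simp: indicator_def intro!: nn_integral_cong)
  then show ?thesis using nn_integral_exp_tail[OF assms, of "- v"] by simp
qed

section \<open>Negative parameter\<close>

text \<open>At \<open>y = 0\<close> the two-variable function is \<open>q_exp q (\<i> * a)\<close>,
  whose argument is \<open>arctan t\<close>; this boundary condition is the reason for the choice of
  \<open>a\<close>.\<close>

lemma q_exp2_match:
  assumes "0 < q" "q_arg q a = arctan t"
  shows "Im (q_exp2 q (\<i> * of_real a) 0) = t * Re (q_exp2 q (\<i> * of_real a) 0)"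
proof -
  obtain \<rho> where "q_exp q (\<i> * of_real a) = of_real \<rho> * cis (q_arg q a)"
    by (rule q_trig_polar[OF assms(1)])
  then show ?thesis
    using assms by (simp add: q_exp2_at_0 cos_arctan sin_arctan)
qed

locale negative_parameter =
  fixes \<theta> \<xi> :: real
  assumes \<theta>: "\<theta> < 0" and \<xi>: "0 < \<xi>" "\<xi> < 1"
begin

definition "t = sqrt (\<xi> / (1 - \<xi>))"
definition "E q = q_exp2 q (\<i> * of_real (a_iii \<theta> \<xi>))"
definition "H q = flow_eigen t (E q)"

lemma t_pos: "0 < t" using \<xi> by (simp add: t_def)

lemma t_sq: "t * t = \<xi> / (1 - \<xi>)"
  using \<xi> by (simp add: t_def)

lemma a_pos: "0 < a_iii \<theta> \<xi>" and arg_a: "q_arg (- \<theta>) (a_iii \<theta> \<xi>) = arctan t"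
  using q_arctan_spec[of "- \<theta>" t] \<theta> t_pos by (simp_all add: a_iii_def t_def)

lemma arg_a_inv: "q_arg (- (1 / \<theta>)) (a_iii \<theta> \<xi>) = arctan t"
  using q_arg_inverse[of "- \<theta>"] arg_a \<theta> by simp

lemma lam_pos: "0 < lam_iii \<theta> \<xi>"
  using a_pos \<xi> by (simp add: lam_iii_def)

lemma eigen_flow_E:
  assumes "0 < q" "q_arg q (a_iii \<theta> \<xi>) = arctan t"
  shows "eigen_flow q (a_iii \<theta> \<xi>) t \<xi> (lam_iii \<theta> \<xi>) (E q)"
proof
  have al: "a_iii \<theta> \<xi> * lam_iii \<theta> \<xi> = sqrt (\<xi> * (1 - \<xi>))"
    using a_pos by (simp add: lam_iii_def)
  have tt: "t * sqrt (\<xi> * (1 - \<xi>)) = \<xi>"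
  proof -
    have "t * sqrt (\<xi> * (1 - \<xi>)) = sqrt (\<xi> * \<xi>)"
      unfolding t_def real_sqrt_mult[symmetric] using \<xi> by simp
    then show ?thesis using \<xi> by simp
  qed
  show "\<xi> / (t * a_iii \<theta> \<xi> * lam_iii \<theta> \<xi>) = 1"
    using \<xi> by (simp add: mult.assoc al tt)
  have "sqrt (\<xi> * (1 - \<xi>)) = (1 - \<xi>) * t"
  proof -
    have "t * sqrt (\<xi> * (1 - \<xi>)) = t * ((1 - \<xi>) * t)"
      using \<xi> by (simp add: tt mult.left_commute[of t] t_sq)
    then show ?thesis using t_pos by simp
  qed
  then show "(1 - \<xi>) / (a_iii \<theta> \<xi> * lam_iii \<theta> \<xi>) = 1 / t"
    using \<xi> t_pos by (simp add: al)
  show "q_flow q (\<i> * of_real (a_iii \<theta> \<xi>)) (E q)"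
    unfolding E_def by (rule q_flow_q_exp2_imag) fact
  show "Im (E q 0) = t * Re (E q 0)"
    unfolding E_def by (rule q_exp2_match) fact+
qed (use assms a_pos t_pos \<xi> lam_pos in auto)

lemma eigen_flows:
  "eigen_flow (- \<theta>) (a_iii \<theta> \<xi>) t \<xi> (lam_iii \<theta> \<xi>) (E (- \<theta>))"
  "eigen_flow (- (1 / \<theta>)) (a_iii \<theta> \<xi>) t \<xi> (lam_iii \<theta> \<xi>) (E (- (1 / \<theta>)))"
  using \<theta> arg_a arg_a_inv by (auto intro!: eigen_flow_E)

lemma H_pos_le1:
  assumes "0 < q" "q \<le> 1" "q_arg q (a_iii \<theta> \<xi>) = arctan t" shows "0 < H q x"
proof -
  have "q_arg q (a_iii \<theta> \<xi>) < pi / 2" using arctan_ubound[of t] assms by simp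
  from q_exp2_imag_pos_le1[OF assms(1,2) a_pos this] t_pos show ?thesis
    by (simp add: H_def E_def flow_eigen_def)
qed

lemma H_pos: "0 < H (- \<theta>) x" "0 < H (- (1 / \<theta>)) x"
proof -
  have "0 < H (- \<theta>) x \<and> 0 < H (- (1 / \<theta>)) x" for x
  proof (cases "- \<theta> \<le> 1")
    case True
    have 1: "0 < H (- \<theta>) x" for x using True \<theta> arg_a by (intro H_pos_le1) auto
    moreover have "0 < H (- (1 / \<theta>)) x"
      unfolding H_def
      by (rule eigen_flow_positive[OF eigen_flows(2), of "E (- \<theta>)"]) (use eigen_flows(1) 1 in \<open>simp_all add: H_def\<close>)
    ultimately show ?thesis by simp
  next
    case False
    then have "- (1 / \<theta>) \<le> 1" using \<theta> by (simp add: field_simps)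
    then have 1: "0 < H (- (1 / \<theta>)) x" for x using \<theta> arg_a_inv by (intro H_pos_le1) auto
    moreover have "0 < H (- \<theta>) x"
      unfolding H_def
      by (rule eigen_flow_positive[OF eigen_flows(1), of "E (- (1 / \<theta>))"]) (use eigen_flows(2) 1 in \<open>simp_all add: H_def\<close>)
    ultimately show ?thesis by simp
  qed
  then show "0 < H (- \<theta>) x" "0 < H (- (1 / \<theta>)) x" by auto
qed

lemma H_measurable [measurable]: "H (- \<theta>) \<in> borel_measurable borel" "H (- (1 / \<theta>)) \<in> borel_measurable borel"
  unfolding H_def using eigen_flow.h_measurable[OF eigen_flows(1)] eigen_flow.h_measurable[OF eigen_flows(2)] by auto

lemma nn_eigen_H:
  "(\<integral>\<^sup>+y. ennreal (indicator {\<theta> * x<..} y * (H (- \<theta>) y * (phi \<xi> y / lam_iii \<theta> \<xi>))) \<partial>lborel) = ennreal (H (- \<theta>) x)"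
  "(\<integral>\<^sup>+y. ennreal (indicator {1 / \<theta> * x<..} y * (H (- (1 / \<theta>)) y * (phi \<xi> y / lam_iii \<theta> \<xi>))) \<partial>lborel) = ennreal (H (- (1 / \<theta>)) x)"
  using eigen_flow.nn_eigen[OF eigen_flows(1), of x] eigen_flow.nn_eigen[OF eigen_flows(2), of x] H_pos
  by (simp_all add: H_def)

lemma h_iii_eq: "h_iii \<theta> \<xi> = H (- \<theta>)"
proof
  fix x
  have "1 / t = sqrt (1 - \<xi>) / sqrt \<xi>" by (simp add: t_def real_sqrt_divide)
  then show "h_iii \<theta> \<xi> x = H (- \<theta>) x"
    using q_trig2_Re_Im[of "- \<theta>" "- x" "a_iii \<theta> \<xi>"] q_trig2_Re_Im[of "- \<theta>" x "a_iii \<theta> \<xi>"] \<theta>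
    by (simp add: h_iii_def H_def E_def flow_eigen_def)
qed

definition "F x = (if x > 0 then pos_iii \<theta> \<xi> x else neg_iii \<theta> \<xi> x)"

lemma F_eq:
  "F x = exp (- \<bar>x\<bar>) * (if x > 0 then 1 else t * t) * (H (- \<theta>) x * H (- (1 / \<theta>)) x)"
proof -
  have "0 < - \<theta>" "0 < - (1 / \<theta>)" using \<theta> by auto
  then show ?thesis
    using q_trig2_Re_Im[of "- \<theta>" "- x" "a_iii \<theta> \<xi>"] q_trig2_Re_Im[of "- \<theta>" x "a_iii \<theta> \<xi>"]
      q_trig2_Re_Im[of "- (1 / \<theta>)" "- x" "a_iii \<theta> \<xi>"] q_trig2_Re_Im[of "- (1 / \<theta>)" x "a_iii \<theta> \<xi>"] t_pos
    by (simp add: F_def pos_iii_def neg_iii_def H_def E_def flow_eigen_def)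
qed

text \<open>On the negative side each of the two eigenfunctions carries a division by
  \<open>t\<close>; the resulting factor \<open>t * t = \<xi> / (1 - \<xi>)\<close> brings both
  branches to one form with the same constant. At 0 the formula fails because \<open>phi\<close> is
  0 there.\<close>

lemma F_phi: "x \<noteq> 0 \<Longrightarrow> F x = 1 / (1 - \<xi>) * (phi \<xi> x * H (- \<theta>) x * H (- (1 / \<theta>)) x)"
  using \<xi> by (auto simp: F_eq phi_def t_sq)

lemma F_pos: "0 < F x"
  unfolding F_eq using H_pos[of x] t_pos by simp

lemma F_measurable [measurable]: "F \<in> borel_measurable borel"
  unfolding F_eq[abs_def] by measurable

lemma F_integrable: "integrable lborel F"
proof (rule integrableI_bounded)
  obtain B where B: "\<And>x. \<bar>H (- \<theta>) x\<bar> \<le> B"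
    using flow_eigen_bounded[OF eigen_flow.E[OF eigen_flows(1)] t_pos] unfolding H_def by blast
  obtain B' where B': "\<And>x. \<bar>H (- (1 / \<theta>)) x\<bar> \<le> B'"
    using flow_eigen_bounded[OF eigen_flow.E[OF eigen_flows(2)] t_pos] unfolding H_def by blast
  have B0: "0 \<le> B" "0 \<le> B'"
    using order_trans[OF abs_ge_zero B[of 0]] order_trans[OF abs_ge_zero B'[of 0]] by auto
  have "AE x in lborel. ennreal (norm (F x)) \<le> ennreal (B * B' / (1 - \<xi>)) * ennreal (phi \<xi> x)"
    using AE_lborel_singleton[of 0]
  proof eventually_elim
    case (elim x)
    have "norm (F x) = 1 / (1 - \<xi>) * phi \<xi> x * (\<bar>H (- \<theta>) x\<bar> * \<bar>H (- (1 / \<theta>)) x\<bar>)"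
      using F_phi[OF elim] phi_nonneg[of \<xi> x] \<xi> by (simp add: abs_mult)
    also have "\<dots> \<le> 1 / (1 - \<xi>) * phi \<xi> x * (B * B')"
      using B B' B0 phi_nonneg[of \<xi> x] \<xi> by (intro mult_left_mono mult_mono) auto
    finally have "norm (F x) \<le> B * B' / (1 - \<xi>) * phi \<xi> x" by (simp add: mult_ac)
    then show ?case
      using B0 \<xi> phi_nonneg[of \<xi> x] by (subst ennreal_mult[symmetric]) (auto intro: ennreal_leI)
  qed
  then have "(\<integral>\<^sup>+x. ennreal (norm (F x)) \<partial>lborel) \<le> (\<integral>\<^sup>+x. ennreal (B * B' / (1 - \<xi>)) * ennreal (phi \<xi> x) \<partial>lborel)"
    by (rule nn_integral_mono_AE)
  also have "\<dots> = ennreal (B * B' / (1 - \<xi>)) * (\<integral>\<^sup>+x. ennreal (phi \<xi> x) \<partial>lborel)"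
    by (rule nn_integral_cmult) simp
  also have "\<dots> < \<infinity>"
    using phi_integral_finite[of \<xi>] \<xi> by (simp add: ennreal_mult_less_top)
  finally show "(\<integral>\<^sup>+x. ennreal (norm (F x)) \<partial>lborel) < \<infinity>" .
qed simp

lemma b_eq: "b_iii \<theta> \<xi> = integral\<^sup>L lborel F"
proof -
  have "integral\<^sup>L lborel F = (LBINT x. indicator {0<..} x *\<^sub>R F x + indicator {..0} x *\<^sub>R F x)"
    by (intro Bochner_Integration.integral_cong) (auto simp: indicator_def)
  also have "\<dots> = (LBINT x. indicator {0<..} x *\<^sub>R F x) + (LBINT x. indicator {..0} x *\<^sub>R F x)"
    by (intro Bochner_Integration.integral_add integrable_mult_indicator F_integrable) auto
  also have "\<dots> = b_iii \<theta> \<xi>"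
    unfolding b_iii_def set_lebesgue_integral_def
    by (intro arg_cong2[where f = "(+)"] Bochner_Integration.integral_cong) (auto simp: F_def indicator_def)
  finally show ?thesis ..
qed

lemma b_pos: "0 < b_iii \<theta> \<xi>"
proof -
  have "\<not> (AE x in lborel. F x = 0)"
    using F_pos by (simp add: less_imp_neq[symmetric] AE_iff_null null_sets_def emeasure_lborel_UNIV)
  then have "integral\<^sup>L lborel F \<noteq> 0"
    using integral_nonneg_eq_0_iff_AE[OF F_integrable] F_pos by (auto simp: less_imp_le)
  moreover have "0 \<le> integral\<^sup>L lborel F" using F_pos by (intro Bochner_Integration.integral_nonneg) (simp add: less_imp_le)
  ultimately show ?thesis by (simp add: b_eq)
qed

sublocale K: pker_eigen UNIV \<theta> \<xi> "lam_iii \<theta> \<xi>" "h_iii \<theta> \<xi>"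
proof
  fix x
  have "(\<integral>\<^sup>+y. ennreal (indicator {\<theta> * x<..} y * (h_iii \<theta> \<xi> y * phi \<xi> y)) * indicator UNIV y \<partial>lborel)
      = (\<integral>\<^sup>+y. ennreal (lam_iii \<theta> \<xi>) * ennreal (indicator {\<theta> * x<..} y * (H (- \<theta>) y * (phi \<xi> y / lam_iii \<theta> \<xi>))) \<partial>lborel)"
    using lam_pos H_pos phi_nonneg[of \<xi>] \<xi>
    by (intro nn_integral_cong) (auto simp: h_iii_eq ennreal_mult[symmetric] less_imp_le)
  also have "\<dots> = ennreal (lam_iii \<theta> \<xi>) * ennreal (h_iii \<theta> \<xi> x)"
  proof -
    have "(\<integral>\<^sup>+y. ennreal (lam_iii \<theta> \<xi>) * ennreal (indicator {\<theta> * x<..} y * (H (- \<theta>) y * (phi \<xi> y / lam_iii \<theta> \<xi>))) \<partial>lborel)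
        = ennreal (lam_iii \<theta> \<xi>) * (\<integral>\<^sup>+y. ennreal (indicator {\<theta> * x<..} y * (H (- \<theta>) y * (phi \<xi> y / lam_iii \<theta> \<xi>))) \<partial>lborel)"
      by (rule nn_integral_cmult) measurable
    then show ?thesis by (simp only: nn_eigen_H h_iii_eq)
  qed
  finally show "(\<integral>\<^sup>+y. ennreal (indicator {\<theta> * x<..} y * (h_iii \<theta> \<xi> y * phi \<xi> y)) * indicator UNIV y \<partial>lborel)
      = ennreal (lam_iii \<theta> \<xi> * h_iii \<theta> \<xi> x)"
    using lam_pos H_pos[of x] by (simp add: ennreal_mult h_iii_eq)
qed (use lam_pos H_pos \<xi> in \<open>auto simp: h_iii_eq\<close>)

text \<open>The kernel divides by \<open>H (- \<theta>) x\<close>, which is a factor of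
  \<open>F x\<close>. What remains under the integral is the eigenvalue equation for
  \<open>1 / \<theta>\<close>, because \<open>\<theta> * x < y\<close> means
  \<open>1 / \<theta> * y < x\<close>; the other factors depend on \<open>y\<close> alone and form
  \<open>C\<close>.\<close>

lemma pi_invariant: "invariant_prob UNIV (pker UNIV \<theta> \<xi> (lam_iii \<theta> \<xi>) (h_iii \<theta> \<xi>)) (pi_iii \<theta> \<xi>)"
proof -
  let ?b = "b_iii \<theta> \<xi>" and ?l = "lam_iii \<theta> \<xi>"
  have L: "restrict_space lborel UNIV = (lborel :: real measure)"
    by (simp add: restrict_space_UNIV_eq)
  have "K.invariant (density (restrict_space lborel UNIV) (\<lambda>x. ennreal (1 / ?b * F x)))"
  proof (rule K.invariant_densityI)
    show "(\<lambda>x. ennreal (1 / ?b * F x)) \<in> borel_measurable (restrict_space lborel UNIV)"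
      unfolding L by simp
    have "(\<integral>\<^sup>+x. ennreal (1 / ?b * F x) \<partial>lborel) = ennreal (integral\<^sup>L lborel (\<lambda>x. 1 / ?b * F x))"
      using F_integrable F_pos b_pos by (intro nn_integral_eq_integral) (auto simp: less_imp_le)
    also have "\<dots> = 1" using b_pos by (simp add: b_eq[symmetric])
    finally show "(\<integral>\<^sup>+x. ennreal (1 / ?b * F x) \<partial>restrict_space lborel UNIV) = 1" unfolding L .
    have "AE y in lborel. K.push (\<lambda>x. ennreal (1 / ?b * F x)) y = ennreal (1 / ?b * F y)"
      using AE_lborel_singleton[of 0]
    proof eventually_elim
      case (elim y)
      define C where "C = 1 / ?b * (1 / (1 - \<xi>) * (phi \<xi> y * H (- \<theta>) y))"
      have C: "0 \<le> C" using b_pos \<xi> phi_nonneg[of \<xi> y] H_pos(1)[of y] by (simp add: C_def)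
      have "K.push (\<lambda>x. ennreal (1 / ?b * F x)) y
          = (\<integral>\<^sup>+x. ennreal C * ennreal (indicator {1 / \<theta> * y<..} x * (H (- (1 / \<theta>)) x * (phi \<xi> x / ?l))) \<partial>lborel)"
        unfolding K.push_def unfolding L
      proof (rule nn_integral_cong_AE)
        show "AE x in lborel. ennreal (1 / ?b * F x) * K.k x y
            = ennreal C * ennreal (indicator {1 / \<theta> * y<..} x * (H (- (1 / \<theta>)) x * (phi \<xi> x / ?l)))"
          using AE_lborel_singleton[of 0]
        proof eventually_elim
          case (elim x)
          have i: "indicator {\<theta> * x<..} y = (indicator {1 / \<theta> * y<..} x :: real)"
            using \<theta> by (auto simp: indicator_def field_simps)
          have "1 / ?b * F x * (indicator {\<theta> * x<..} y * (h_iii \<theta> \<xi> y / h_iii \<theta> \<xi> x) * (1 / ?l) * phi \<xi> y)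
            = C * (indicator {1 / \<theta> * y<..} x * (H (- (1 / \<theta>)) x * (phi \<xi> x / ?l)))"
            unfolding F_phi[OF elim] h_iii_eq C_def i using H_pos(1)[of x] by (simp add: mult_ac)
          moreover have "0 \<le> 1 / ?b * F x" using b_pos F_pos[of x] by simp
          ultimately show ?case
            unfolding K.k_def
            by (simp only: ennreal_mult'[OF C, symmetric] ennreal_mult'[symmetric])
        qed
      qed
      also have "\<dots> = ennreal C * ennreal (H (- (1 / \<theta>)) y)"
      proof -
        have "(\<integral>\<^sup>+x. ennreal C * ennreal (indicator {1 / \<theta> * y<..} x * (H (- (1 / \<theta>)) x * (phi \<xi> x / ?l))) \<partial>lborel)
            = ennreal C * (\<integral>\<^sup>+x. ennreal (indicator {1 / \<theta> * y<..} x * (H (- (1 / \<theta>)) x * (phi \<xi> x / ?l))) \<partial>lborel)"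
          by (rule nn_integral_cmult) measurable
        then show ?thesis by (simp only: nn_eigen_H)
      qed
      also have "\<dots> = ennreal (1 / ?b * F y)"
        unfolding F_phi[OF elim] using C H_pos(2)[of y] by (simp add: ennreal_mult[symmetric] C_def mult_ac)
      finally show ?case .
    qed
    then show "AE y in restrict_space lborel UNIV. K.push (\<lambda>x. ennreal (1 / ?b * F x)) y = ennreal (1 / ?b * F y)"
      unfolding L .
  qed
  moreover have "density (restrict_space lborel UNIV) (\<lambda>x. ennreal (1 / ?b * F x)) = pi_iii \<theta> \<xi>"
    unfolding L pi_iii_def F_def ..
  ultimately show ?thesis by (simp add: K.invariant_prob_iff)
qed

lemma unique_invariant:
  "unique_invariant_prob UNIV (pker UNIV \<theta> \<xi> (lam_iii \<theta> \<xi>) (h_iii \<theta> \<xi>)) (pi_iii \<theta> \<xi>)"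
  by (rule pker_eigen_unique_UNIV[OF K.pker_eigen_axioms \<xi>(2) pi_invariant])

end

section \<open>Positive chains driven by exponential steps\<close>

text \<open>The kernel has to agree with the affine one only from nonnegative starting points, since
  the discounted sum is almost surely nonnegative.\<close>

lemma (in prob_space) discounted_law_invariant_prob:
  fixes E :: "nat \<Rightarrow> 'a \<Rightarrow> real"
  assumes ind: "indep_vars (\<lambda>_. borel) E {1..}"
    and E: "\<And>k. k \<ge> 1 \<Longrightarrow> distributed M lborel (E k) (exponential_density 1)"
    and \<eta>: "0 \<le> \<eta>" "\<eta> < 1" and K: "pker_eigen UNIV \<theta> \<xi> lam h"
    and eq: "\<And>x. 0 \<le> x \<Longrightarrow> AE y in lborel. pker_eigen.k \<theta> \<xi> lam h x y = exp_kernel \<eta> x y"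
  shows "invariant_prob UNIV (pker UNIV \<theta> \<xi> lam h)
    (law_on UNIV M (\<lambda>\<omega>. (1 - \<eta>) * (\<Sum>k. \<eta> ^ k * E (k + 1) \<omega>)))"
proof -
  interpret K: pker_eigen UNIV \<theta> \<xi> lam h by fact
  interpret X: markov_density lborel "exp_kernel \<eta>" by (rule markov_density_exp_kernel) fact
  let ?S = "\<lambda>\<omega>. (1 - \<eta>) * (\<Sum>k. \<eta> ^ k * E (k + 1) \<omega>)"
  note S = discounted_sum_invariant[OF ind E \<eta>]
  have L: "restrict_space lborel UNIV = (lborel :: real measure)"
    by (simp add: restrict_space_UNIV_eq)
  have rv: "random_variable borel ?S" by (rule S(1))
  have nonneg: "AE x in distr M borel ?S. 0 \<le> x"
    using S(2) by (subst AE_distr_iff[OF rv]) auto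
  have X: "X.invariant (distr M borel ?S)" by (rule S(3))
  have "K.invariant (distr M borel ?S)"
    unfolding K.invariant_def unfolding L
  proof (intro conjI ballI)
    show "prob_space (distr M borel ?S)" "sets (distr M borel ?S) = sets lborel"
      using X by (auto simp: X.invariant_def)
    fix B assume B: "B \<in> sets (lborel :: real measure)"
    have "(\<integral>\<^sup>+x. emeasure (density lborel (K.k x)) B \<partial>distr M borel ?S)
        = (\<integral>\<^sup>+x. emeasure (density lborel (exp_kernel \<eta> x)) B \<partial>distr M borel ?S)"
    proof (rule nn_integral_cong_AE)
      show "AE x in distr M borel ?S. emeasure (density lborel (K.k x)) B = emeasure (density lborel (exp_kernel \<eta> x)) B"
        using nonneg
      proof eventually_elim
        case (elim x)
        have "density lborel (K.k x) = density lborel (exp_kernel \<eta> x)"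
          using eq[OF elim] K.k_measurable_fst[of x] X.k_measurable_fst[of x]
          by (intro density_cong) (auto simp: L)
        then show ?case by simp
      qed
    qed
    then show "(\<integral>\<^sup>+x. emeasure (density lborel (K.k x)) B \<partial>distr M borel ?S) = emeasure (distr M borel ?S) B"
      using X B by (simp add: X.invariant_def)
  qed
  then show ?thesis by (simp add: K.invariant_prob_iff law_on_UNIV)
qed

lemma exp_kernel_eq: "\<eta> < 1 \<Longrightarrow> y \<noteq> \<eta> * x \<Longrightarrow>
    exp_kernel \<eta> x y = ennreal (indicator {\<eta> * x<..} y * (1 / (1 - \<eta>) * exp (- (y - \<eta> * x) / (1 - \<eta>))))"
  by (auto simp: exp_kernel_def exponential_density_def indicator_def)

lemma phi_tail:
  assumes "0 \<le> v" "\<xi> \<le> 1"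
  shows "(\<integral>\<^sup>+y. ennreal (indicator {v<..} y * phi \<xi> y) \<partial>lborel) = ennreal ((1 - \<xi>) * exp (- v))"
proof -
  have "(\<integral>\<^sup>+y. ennreal (indicator {v<..} y * phi \<xi> y) \<partial>lborel)
      = (\<integral>\<^sup>+y. ennreal (1 - \<xi>) * ennreal (indicator {v<..} y * (1 * exp (- 1 * y))) \<partial>lborel)"
    using assms by (intro nn_integral_cong) (auto simp: phi_def indicator_def ennreal_mult[symmetric])
  also have "\<dots> = ennreal (1 - \<xi>) * ennreal (exp (- 1 * v))"
    by (subst nn_integral_cmult) (simp_all only: nn_integral_exp_tail[of 1] zero_less_one, measurable)
  finally show ?thesis using assms by (simp add: ennreal_mult)
qed

lemma pker_eigen_v:
  assumes "0 \<le> \<xi>" "\<xi> < 1" shows "pker_eigen UNIV 0 \<xi> (1 - \<xi>) (\<lambda>_. 1)"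
proof
  show "(\<integral>\<^sup>+y. ennreal (indicator {0 * x<..} y * (1 * phi \<xi> y)) * indicator UNIV y \<partial>lborel) = ennreal ((1 - \<xi>) * 1)" for x
    using phi_tail[of 0 \<xi>] assms by simp
qed (use assms in auto)

lemma pker_eigen_iv:
  assumes "\<theta> < 0" shows "pker_eigen UNIV \<theta> 0 1 (h_iv \<theta>)"
proof
  show "h_iv \<theta> \<in> borel_measurable borel" unfolding h_iv_def[abs_def] by measurable
  show "0 < h_iv \<theta> x" for x by (simp add: h_iv_def)
  fix x
  have "(\<integral>\<^sup>+y. ennreal (indicator {\<theta> * x<..} y * (h_iv \<theta> y * phi 0 y)) * indicator UNIV y \<partial>lborel)
      = (\<integral>\<^sup>+y. ennreal (indicator {max 0 (\<theta> * x)<..} y * phi 0 y) \<partial>lborel)"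
    by (intro nn_integral_cong) (auto simp: phi_def indicator_def h_iv_def)
  \<comment> \<open>For \<xi> = 0 the density \<open>phi\<close> lives on the positive half-line,
    where \<open>h_iv\<close> is 1. The maximum is 0 for \<open>x \<ge> 0\<close> and
    \<open>\<theta> * x\<close> for \<open>x < 0\<close>, which are the two branches of
    \<open>h_iv\<close>.\<close>
  also have "\<dots> = ennreal (exp (- max 0 (\<theta> * x)))"
    using phi_tail[of "max 0 (\<theta> * x)" 0] by simp
  also have "\<dots> = ennreal (1 * h_iv \<theta> x)"
    using assms by (auto simp: h_iv_def max_def mult_le_0_iff zero_le_mult_iff)
  finally show "(\<integral>\<^sup>+y. ennreal (indicator {\<theta> * x<..} y * (h_iv \<theta> y * phi 0 y)) * indicator UNIV y \<partial>lborel) = ennreal (1 * h_iv \<theta> x)" .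
qed auto

lemma (in prob_space) unique_invariant_exponential:
  fixes E :: "nat \<Rightarrow> 'a \<Rightarrow> real"
  assumes ind: "indep_vars (\<lambda>_. borel) E {1..}"
    and E: "\<And>k. k \<ge> 1 \<Longrightarrow> distributed M lborel (E k) (exponential_density 1)"
  shows "\<theta> < 0 \<Longrightarrow> unique_invariant_prob UNIV (pker UNIV \<theta> 0 1 (h_iv \<theta>)) (law_on UNIV M (E 1))"
    and "0 \<le> \<xi> \<Longrightarrow> \<xi> < 1 \<Longrightarrow> unique_invariant_prob UNIV (pker UNIV 0 \<xi> (1 - \<xi>) (\<lambda>_. 1)) (law_on UNIV M (E 1))"
proof -
  \<comment> \<open>\<open>0 ^ 0 = 1\<close> keeps the term \<open>k = 0\<close>, so
    \<open>E 1\<close> is the discounted sum for \<eta> = 0: from nonnegative points both chains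
    draw a fresh exponential at each step.\<close>
  have S: "(\<lambda>\<omega>. (1 - 0) * (\<Sum>k. 0 ^ k * E (k + 1) \<omega>)) = E 1"
  proof
    fix \<omega>
    have "(\<lambda>k. 0 ^ k * E (k + 1) \<omega>) = (\<lambda>k. if k = 0 then E 1 \<omega> else 0)" by (auto simp: fun_eq_iff)
    then show "(1 - 0) * (\<Sum>k. 0 ^ k * E (k + 1) \<omega>) = E 1 \<omega>"
      using sums_single[of 0 "\<lambda>_. E 1 \<omega>"] by (simp add: sums_iff)
  qed
  show "unique_invariant_prob UNIV (pker UNIV \<theta> 0 1 (h_iv \<theta>)) (law_on UNIV M (E 1))" if "\<theta> < 0"
  proof (rule pker_eigen_unique_UNIV[OF pker_eigen_iv[OF that]])
    interpret K: pker_eigen UNIV \<theta> 0 1 "h_iv \<theta>" by (rule pker_eigen_iv[OF that])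
    have eq: "AE y in lborel. K.k x y = exp_kernel 0 x y" if "0 \<le> x" for x
      using AE_lborel_singleton[of 0]
    proof eventually_elim
      case (elim y)
      have "\<theta> * x \<le> 0" using that \<open>\<theta> < 0\<close> by (simp add: mult_nonpos_nonneg)
      then show ?case using elim that
        by (auto simp: K.k_def exp_kernel_def exponential_density_def phi_def h_iv_def indicator_def)
    qed
    show "invariant_prob UNIV (pker UNIV \<theta> 0 1 (h_iv \<theta>)) (law_on UNIV M (E 1))"
      using discounted_law_invariant_prob[OF ind E order_refl _ K.pker_eigen_axioms eq] unfolding S by simp
  qed simp
  show "unique_invariant_prob UNIV (pker UNIV 0 \<xi> (1 - \<xi>) (\<lambda>_. 1)) (law_on UNIV M (E 1))" if \<xi>: "0 \<le> \<xi>" "\<xi> < 1"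
  proof (rule pker_eigen_unique_UNIV[OF pker_eigen_v[OF that]])
    interpret K: pker_eigen UNIV 0 \<xi> "1 - \<xi>" "\<lambda>_. 1" by (rule pker_eigen_v[OF that])
    have eq: "AE y in lborel. K.k x y = exp_kernel 0 x y" for x
      using AE_lborel_singleton[of 0]
    proof eventually_elim
      case (elim y)
      show ?case using elim \<xi>
        by (auto simp: K.k_def exp_kernel_def exponential_density_def phi_def indicator_def)
    qed
    show "invariant_prob UNIV (pker UNIV 0 \<xi> (1 - \<xi>) (\<lambda>_. 1)) (law_on UNIV M (E 1))"
      using discounted_law_invariant_prob[OF ind E order_refl _ K.pker_eigen_axioms eq] unfolding S by simp
  qed (use that in auto)
qed

section \<open>Contracting parameter on the whole line\<close>

locale contracting_parameter =
  fixes \<theta> \<xi> :: real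
  assumes \<theta>: "0 < \<theta>" "\<theta> < 1" and \<xi>: "0 \<le> \<xi>" "\<xi> < 1"
begin

definition "c = \<theta> / (1 - \<theta>)"
definition "r = \<xi> / (1 - \<xi>)"
text \<open>Since \<open>- \<xi> / lam_i \<theta> \<xi> * (1 - \<theta>) = - r\<close>, these are
  the q-Pochhammer symbols in \<open>h_i\<close>: products of \<open>1 + r * \<theta> ^ k\<close>,
  positive and bounded, so their Poisson mixture \<open>H\<close> is positive for
  \<open>x \<le> 0\<close>.\<close>

definition "P = q_poch (- r) \<theta>"
definition "H x = poisson_mix P (- (c * x))"

lemma c_pos: "0 < c" and r_nonneg: "0 \<le> r"
  using \<theta> \<xi> by (auto simp: c_def r_def)

lemma P_Suc: "P (Suc m) = P m * (1 + r * \<theta> ^ m)"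
  by (simp add: P_def q_poch_def)

lemma P_pos: "0 < P m"
  unfolding P_def q_poch_def using \<theta> r_nonneg by (intro prod_pos) (simp add: add_pos_nonneg)

lemma P_bound: "norm (P m) \<le> exp (r / (1 - \<theta>))"
proof -
  have "P m \<le> (\<Prod>k<m. exp (r * \<theta> ^ k))"
    unfolding P_def q_poch_def using \<theta> r_nonneg by (intro prod_mono) auto
  also have "\<dots> = exp (r * (\<Sum>k<m. \<theta> ^ k))" by (simp add: exp_sum sum_distrib_left)
  also have "\<dots> \<le> exp (r * (1 / (1 - \<theta>)))"
  proof -
    have "(\<Sum>k<m. \<theta> ^ k) \<le> (\<Sum>k. \<theta> ^ k)"
      using \<theta> by (intro sum_le_suminf summable_geometric) auto
    then have "(\<Sum>k<m. \<theta> ^ k) \<le> 1 / (1 - \<theta>)" using \<theta> by (simp add: suminf_geometric)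
    from mult_left_mono[OF this r_nonneg] show ?thesis by simp
  qed
  finally show ?thesis using P_pos[of m] by simp
qed

text \<open>From \<open>P (Suc m) - P m = r * \<theta> ^ m * P m\<close>, by the mechanism that
  gives the delay equation of the q-exponential.\<close>

lemma H_deriv: "(H has_real_derivative - (c * r) * exp (\<theta> * x) * H (\<theta> * x)) (at x)"
proof -
  have "(H has_real_derivative poisson_mix (\<lambda>m. P (Suc m) - P m) (- (c * x)) * - c) (at x)"
    unfolding H_def[abs_def] by (rule DERIV_chain2[OF poisson_mix_deriv[of P, OF P_bound]]) (auto intro!: derivative_eq_intros)
  also have "(\<lambda>m. P (Suc m) - P m) = (\<lambda>m. r * (\<theta> ^ m * P m))"
    by (simp add: P_Suc algebra_simps)
  also have "poisson_mix (\<lambda>m. r * (\<theta> ^ m * P m)) (- (c * x)) = r * poisson_mix (\<lambda>m. \<theta> ^ m * P m) (- (c * x))"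
  proof (rule poisson_mix_cmult)
    show "norm (\<theta> ^ m * P m) \<le> exp (r / (1 - \<theta>))" for m
      using mult_mono[of "\<theta> ^ m" 1 "norm (P m)" "exp (r / (1 - \<theta>))"] P_bound[of m] \<theta>
      by (simp add: abs_mult power_le_one)
  qed
  also have "poisson_mix (\<lambda>m. \<theta> ^ m * P m) (- (c * x)) = exp ((\<theta> - 1) * - (c * x)) * poisson_mix P (\<theta> * - (c * x))"
    by (rule poisson_mix_scale)
  also have "(\<theta> - 1) * - (c * x) = \<theta> * x" using \<theta> by (simp add: c_def field_simps)
  also have "\<theta> * - (c * x) = - (c * (\<theta> * x))" by simp
  finally show ?thesis by (simp add: H_def[abs_def] mult_ac)
qed

lemma H_pos: "x \<le> 0 \<Longrightarrow> 0 < H x"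
  unfolding H_def using c_pos by (intro poisson_mix_pos[of _ "exp (r / (1 - \<theta>))"] P_bound P_pos) (simp add: mult_nonneg_nonpos)

lemma H_0: "H 0 = 1"
  by (simp add: H_def P_def q_poch_def)

lemma H_cont: "continuous_on UNIV H"
  by (intro continuous_at_imp_continuous_on ballI) (rule DERIV_isCont[OF H_deriv])

lemma h_eq: "h_i \<theta> \<xi> x = (if x > 0 then exp (- c * x) else H x)"
proof -
  have "- \<xi> / lam_i \<theta> \<xi> * (1 - \<theta>) = - r"
    using \<theta> by (simp add: lam_i_def r_def)
  moreover have "\<theta> / (\<theta> - 1) * x = - c * x"
    using \<theta> by (simp add: c_def divide_simps) (simp add: algebra_simps)
  ultimately show ?thesis
    by (simp add: h_i_def H_def P_def poisson_mix_def c_def)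
qed

lemma lam_pos: "0 < lam_i \<theta> \<xi>" using \<theta> \<xi> by (simp add: lam_i_def)

lemma H_measurable [measurable]: "H \<in> borel_measurable borel"
  by (rule borel_measurable_continuous_onI[OF H_cont])

lemma h_measurable [measurable]: "h_i \<theta> \<xi> \<in> borel_measurable borel"
  unfolding h_eq[abs_def] by measurable

lemma exp_tail_h:
  assumes "0 \<le> v"
  shows "(\<integral>\<^sup>+y. ennreal (indicator {v<..} y * (h_i \<theta> \<xi> y * phi \<xi> y)) \<partial>lborel) = ennreal (lam_i \<theta> \<xi> * exp (- v / (1 - \<theta>)))"
proof -
  let ?c = "1 / (1 - \<theta>)"
  have "(\<integral>\<^sup>+y. ennreal (indicator {v<..} y * (h_i \<theta> \<xi> y * phi \<xi> y)) \<partial>lborel)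
      = (\<integral>\<^sup>+y. ennreal (lam_i \<theta> \<xi>) * ennreal (indicator {v<..} y * (?c * exp (- ?c * y))) \<partial>lborel)"
  proof (rule nn_integral_cong)
    fix y
    have "indicator {v<..} y * (h_i \<theta> \<xi> y * phi \<xi> y) = lam_i \<theta> \<xi> * (indicator {v<..} y * (?c * exp (- ?c * y)))"
    proof (cases "v < y")
      case True
      have "- c * y + - y = - ?c * y" using \<theta> by (simp add: c_def field_simps)
      then have "exp (- c * y) * exp (- y) = exp (- ?c * y)" by (simp only: exp_add[symmetric])
      moreover have "h_i \<theta> \<xi> y * phi \<xi> y = lam_i \<theta> \<xi> * (?c * (exp (- c * y) * exp (- y)))"
        using True assms \<theta> by (simp add: h_eq phi_def lam_i_def)
      ultimately show ?thesis using True by simp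
    qed simp
    then show "ennreal (indicator {v<..} y * (h_i \<theta> \<xi> y * phi \<xi> y))
        = ennreal (lam_i \<theta> \<xi>) * ennreal (indicator {v<..} y * (?c * exp (- ?c * y)))"
      by (simp only: ennreal_mult'[OF less_imp_le[OF lam_pos]])
  qed
  also have "\<dots> = ennreal (lam_i \<theta> \<xi>) * (\<integral>\<^sup>+y. ennreal (indicator {v<..} y * (?c * exp (- ?c * y))) \<partial>lborel)"
    by (rule nn_integral_cmult) measurable
  also have "\<dots> = ennreal (lam_i \<theta> \<xi>) * ennreal (exp (- ?c * v))"
    using \<theta> by (subst nn_integral_exp_tail) auto
  finally show ?thesis using lam_pos by (simp add: ennreal_mult)
qed

sublocale K: pker_eigen UNIV \<theta> \<xi> "lam_i \<theta> \<xi>" "h_i \<theta> \<xi>"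
proof
  show "0 < h_i \<theta> \<xi> x" for x using H_pos[of x] by (simp add: h_eq)
  fix x
  have "(\<integral>\<^sup>+y. ennreal (indicator {\<theta> * x<..} y * (h_i \<theta> \<xi> y * phi \<xi> y)) \<partial>lborel) = ennreal (lam_i \<theta> \<xi> * h_i \<theta> \<xi> x)"
  proof (cases "x \<ge> 0")
    case True
    have "h_i \<theta> \<xi> x = exp (- (\<theta> * x) / (1 - \<theta>))"
      using True H_0 by (cases "x = 0") (auto simp: h_eq c_def)
    then show ?thesis using exp_tail_h[of "\<theta> * x"] True \<theta> by simp
  next
    case False
    then have neg: "\<theta> * x < 0" using \<theta> by (simp add: mult_pos_neg)
    let ?f = "\<lambda>y. H y * (\<xi> * exp y)"
    have "(\<integral>\<^sup>+y. ennreal (indicator {\<theta> * x<..} y * (h_i \<theta> \<xi> y * phi \<xi> y)) \<partial>lborel)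
        = (\<integral>\<^sup>+y. ennreal (?f y) * indicator {\<theta> * x..0} y + ennreal (indicator {0<..} y * (h_i \<theta> \<xi> y * phi \<xi> y)) \<partial>lborel)"
    proof (rule nn_integral_cong_AE)
      show "AE y in lborel. ennreal (indicator {\<theta> * x<..} y * (h_i \<theta> \<xi> y * phi \<xi> y))
          = ennreal (?f y) * indicator {\<theta> * x..0} y + ennreal (indicator {0<..} y * (h_i \<theta> \<xi> y * phi \<xi> y))"
        using AE_lborel_singleton[of 0] AE_lborel_singleton[of "\<theta> * x"]
        by eventually_elim (use neg in \<open>auto simp: indicator_def phi_def h_eq\<close>)
    qed
    also have "\<dots> = (\<integral>\<^sup>+y. ennreal (?f y) * indicator {\<theta> * x..0} y \<partial>lborel) + ennreal (lam_i \<theta> \<xi>)"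
      using exp_tail_h[of 0] by (subst nn_integral_add) auto
    also have "(\<integral>\<^sup>+y. ennreal (?f y) * indicator {\<theta> * x..0} y \<partial>lborel)
        = ennreal (- (lam_i \<theta> \<xi> * H (0 / \<theta>)) - - (lam_i \<theta> \<xi> * H (\<theta> * x / \<theta>)))"
    \<comment> \<open>The delay equation makes
      \<open>- lam_i \<theta> \<xi> * H (y / \<theta>)\<close> an antiderivative, as
      \<open>lam_i \<theta> \<xi> * c * r / \<theta> = \<xi>\<close>. The lower end returns
      \<open>lam_i \<theta> \<xi> * H x\<close>; the boundary term at 0 is compensated by the mass
      of the positive half-line.\<close>
    proof (rule nn_integral_FTC_Icc[where F = "\<lambda>y. - (lam_i \<theta> \<xi> * H (y / \<theta>))"])
      fix y assume "y \<in> {\<theta> * x..0}"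
      then have "y \<le> 0" by simp
      have "((\<lambda>y. - (lam_i \<theta> \<xi> * H (y / \<theta>))) has_real_derivative
          - (lam_i \<theta> \<xi> * (- (c * r) * exp (\<theta> * (y / \<theta>)) * H (\<theta> * (y / \<theta>)) * (1 / \<theta>)))) (at y)"
        using \<theta> by (intro DERIV_minus DERIV_cmult DERIV_chain2[OF H_deriv]) (auto intro!: derivative_eq_intros)
      moreover have l: "lam_i \<theta> \<xi> * c * r / \<theta> = \<xi>"
        using \<theta> \<xi> by (simp add: lam_i_def c_def r_def)
      have "- (lam_i \<theta> \<xi> * (- (c * r) * exp (\<theta> * (y / \<theta>)) * H (\<theta> * (y / \<theta>)) * (1 / \<theta>))) = (lam_i \<theta> \<xi> * c * r / \<theta>) * (H y * exp y)"
        using \<theta> by (simp add: mult_ac)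
      then have "- (lam_i \<theta> \<xi> * (- (c * r) * exp (\<theta> * (y / \<theta>)) * H (\<theta> * (y / \<theta>)) * (1 / \<theta>))) = ?f y"
        unfolding l by (simp add: mult_ac)
      ultimately show "((\<lambda>y. - (lam_i \<theta> \<xi> * H (y / \<theta>))) has_real_derivative ?f y) (at y)" by simp
      show "0 \<le> ?f y" using H_pos[OF \<open>y \<le> 0\<close>] \<xi> by simp
    qed (use neg in auto)
    also have "\<dots> + ennreal (lam_i \<theta> \<xi>) = ennreal (lam_i \<theta> \<xi> * h_i \<theta> \<xi> x)"
    proof -
      \<comment> \<open>\<open>ennreal\<close> truncates negative numbers, so the sign must be known
        before adding; the delay equation shows that \<open>H\<close> is nonincreasing on the
        negative half-line.\<close>
      have "0 \<le> lam_i \<theta> \<xi> * H x - lam_i \<theta> \<xi>"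
      proof -
        have "H 0 \<le> H x"
          using False \<theta> c_pos r_nonneg H_pos
          by (intro DERIV_nonpos_imp_nonincreasing[of x 0 H])
            (auto intro!: exI[of _ "- (c * r) * exp (\<theta> * _) * H (\<theta> * _)"] H_deriv simp: less_imp_le mult_nonneg_nonpos)
        then show ?thesis using lam_pos H_0 by simp
      qed
      then show ?thesis using False \<theta> lam_pos H_0
        by (subst ennreal_plus[symmetric]) (auto simp: h_eq)
    qed
    finally show ?thesis .
  qed
  then show "(\<integral>\<^sup>+y. ennreal (indicator {\<theta> * x<..} y * (h_i \<theta> \<xi> y * phi \<xi> y)) * indicator UNIV y \<partial>lborel)
    = ennreal (lam_i \<theta> \<xi> * h_i \<theta> \<xi> x)" by simp
qed (use lam_pos \<xi> in auto)

text \<open>On nonnegative points \<open>h_i\<close> is \<open>exp (- c * x)\<close>, which tilts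
  the exponential of rate 1 to rate \<open>1 + c = 1 / (1 - \<theta>)\<close>.\<close>

lemma kernel_eq:
  assumes "0 \<le> x" shows "AE y in lborel. K.k x y = exp_kernel \<theta> x y"
  using AE_lborel_singleton[of "\<theta> * x"]
proof eventually_elim
  case (elim y)
  have x0: "0 \<le> \<theta> * x" using assms \<theta> by simp
  have hx: "h_i \<theta> \<xi> x = exp (- c * x)" using assms H_0 by (cases "x = 0") (auto simp: h_eq)
  show ?case
  proof (cases "\<theta> * x < y")
    case True
    then have "y > 0" using x0 by linarith
    have c1: "c + 1 = 1 / (1 - \<theta>)" using \<theta> by (simp add: c_def field_simps)
    have "- c * y - - c * x + - y = - ((c + 1) * y) + c * x" by (simp add: algebra_simps)
    also have "\<dots> = - (y - \<theta> * x) / (1 - \<theta>)" unfolding c1 by (simp add: c_def diff_divide_distrib)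
    finally have "- c * y - - c * x + - y = - (y - \<theta> * x) / (1 - \<theta>)" .
    then have "exp (- c * y) / exp (- c * x) * exp (- y) = exp (- (y - \<theta> * x) / (1 - \<theta>))"
      by (simp only: exp_diff[symmetric] exp_add[symmetric])
    moreover have "1 / lam_i \<theta> \<xi> * (1 - \<xi>) = 1 / (1 - \<theta>)" using \<xi> by (simp add: lam_i_def)
    moreover have "h_i \<theta> \<xi> y / h_i \<theta> \<xi> x * (1 / lam_i \<theta> \<xi>) * phi \<xi> y
        = (1 / lam_i \<theta> \<xi> * (1 - \<xi>)) * (exp (- c * y) / exp (- c * x) * exp (- y))"
      using \<open>y > 0\<close> hx by (simp add: h_eq phi_def mult_ac)
    ultimately show ?thesis
      using True by (simp add: K.k_def exp_kernel_eq[OF \<theta>(2) elim])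
  qed (simp add: K.k_def exp_kernel_eq[OF \<theta>(2) elim])
qed

end

section \<open>Expanding parameter on the negative half-line\<close>

locale expanding_parameter =
  fixes \<theta> \<xi> :: real
  assumes \<theta>: "1 < \<theta>" and \<xi>: "0 < \<xi>" "\<xi> \<le> 1"
begin

text \<open>This equals \<xi> / \<lambda>. It is at once minus the argument of the q-exponential,
  the rate \<open>1 / (1 - 1 / \<theta>)\<close> of the reversed affine chain, and the exponent in
  the invariant density.\<close>

definition "c = \<theta> / (\<theta> - 1)"
definition "H y = Re (q_exp2 \<theta> (of_real (- c)) y)"
definition "h0 x = indicator {..<0} x * H x"
definition "w x = indicator {..<0} x * (c * exp x)"

lemma c_pos: "0 < c" and c_step: "c * (1 / \<theta>) = c - 1"
  using \<theta> by (auto simp: c_def field_simps)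

lemma flow: "q_flow \<theta> (of_real (- c)) (q_exp2 \<theta> (of_real (- c)))"
  by (rule q_flow_q_exp2_gt1[OF \<theta>])

lemma H_cont: "continuous_on {..0} H"
  unfolding H_def[abs_def] using flow by (intro continuous_intros) (simp add: q_flow_def)

lemma H_lim: "(H \<longlongrightarrow> 1) at_bot"
  unfolding H_def[abs_def] using tendsto_Re[of _ 1] flow by (fastforce simp: q_flow_def)

lemma H_bounded: obtains B where "\<And>y. y \<le> 0 \<Longrightarrow> \<bar>H y\<bar> \<le> B" "0 \<le> B"
proof -
  obtain B where B: "\<And>y. y \<le> 0 \<Longrightarrow> norm (q_exp2 \<theta> (of_real (- c)) y) \<le> B"
    using flow by (auto simp: q_flow_def bounded_iff)
  have "0 \<le> B" using order_trans[OF norm_ge_zero B[of 0]] by simp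
  moreover have "\<bar>H y\<bar> \<le> B" if "y \<le> 0" for y
    unfolding H_def using order_trans[OF abs_Re_le_cmod B[OF that]] .
  ultimately show ?thesis using that by blast
qed

text \<open>\<open>- c\<close> is the zero of the q-exponential nearest to the origin, where the
  factor \<open>1 + (1 - 1 / \<theta>) * z\<close> of its product vanishes. This boundary condition
  is the reason for the value of \<open>lam_ii\<close>.\<close>

lemma H_0: "H 0 = 0"
proof -
  have "(\<theta> - 1) * (- c / \<theta>) = - 1" using \<theta> by (simp add: c_def field_simps)
  then have "of_real (\<theta> - 1) * of_real (- c / \<theta>) = (- 1 :: complex)"
    by (metis of_real_1 of_real_minus of_real_mult)
  moreover have "of_real \<theta> * of_real (- c / \<theta>) = complex_of_real (- c)" using \<theta> by simp
  ultimately have "q_exp \<theta> (of_real (- c)) = 0"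
    using q_exp_step_gt1[OF \<theta>, of "of_real (- c / \<theta>)"] by (simp only: add.right_inverse mult_zero_left)
  then show ?thesis using \<theta> by (simp add: H_def q_exp2_at_0)
qed

lemma h0_measurable [measurable]: "h0 \<in> borel_measurable borel"
proof -
  have "continuous_on {..<0} H" by (rule continuous_on_subset[OF H_cont]) auto
  then have "(\<lambda>x. indicator {..<0} x *\<^sub>R H x) \<in> borel_measurable borel"
    by (rule borel_measurable_continuous_on_indicator[rotated]) simp
  then show ?thesis by (simp add: h0_def[abs_def])
qed

lemma w_measurable [measurable]: "w \<in> borel_measurable borel"
  unfolding w_def[abs_def] by measurable

lemma w_nonneg: "0 \<le> w x" using c_pos by (simp add: w_def)

lemma H_integral:
  assumes "y \<le> 0"
  shows "has_bochner_integral lborel (\<lambda>s. indicator {..<y} s * (exp s * H s)) ((1 - H (y / \<theta>)) / c)"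
proof -
  have "complex_of_real (- c) \<noteq> 0" using c_pos by simp
  from has_bochner_integral_Re[OF q_flow_integral[OF _ this flow assms]] \<theta>
  have "has_bochner_integral lborel (\<lambda>s. indicator {..<y} s * (exp s * H s))
      (Re ((q_exp2 \<theta> (of_real (- c)) (y / \<theta>) - 1) / of_real (- c)))"
    by (simp add: H_def)
  also have "Re ((q_exp2 \<theta> (of_real (- c)) (y / \<theta>) - 1) / of_real (- c)) = (1 - H (y / \<theta>)) / c"
    unfolding Re_divide_of_real using c_pos by (simp add: H_def field_simps)
  finally show ?thesis .
qed

text \<open>For \<open>x < 0\<close> the flow identity gives \<open>H x - H 0\<close> for the
  integral over the interval from \<open>\<theta> * x\<close> to 0, and
  \<open>H 0 = 0\<close>.\<close>

lemma eigen: "has_bochner_integral lborel (\<lambda>y. indicator {\<theta> * x<..} y * (h0 y * w y)) (h0 x)"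
proof (cases "x < 0")
  case True
  then have neg: "\<theta> * x \<le> 0" using \<theta> by (simp add: mult_nonneg_nonpos)
  have "has_bochner_integral lborel
      (\<lambda>s. c * (indicator {..<0} s * (exp s * H s) - indicator {..<\<theta> * x} s * (exp s * H s)))
      (c * ((1 - H (0 / \<theta>)) / c - (1 - H (\<theta> * x / \<theta>)) / c))"
    by (intro has_bochner_integral_mult_right has_bochner_integral_diff H_integral neg order_refl)
  moreover have "c * ((1 - H (0 / \<theta>)) / c - (1 - H (\<theta> * x / \<theta>)) / c) = h0 x"
    using c_pos \<theta> True by (simp add: h0_def H_0 diff_divide_distrib[symmetric])
  ultimately have int: "has_bochner_integral lborel
      (\<lambda>s. c * (indicator {..<0} s * (exp s * H s) - indicator {..<\<theta> * x} s * (exp s * H s))) (h0 x)" by simp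
  have "AE s in lborel. c * (indicator {..<0} s * (exp s * H s) - indicator {..<\<theta> * x} s * (exp s * H s))
      = indicator {\<theta> * x<..} s * (h0 s * w s)"
    using AE_lborel_singleton[of "\<theta> * x"]
    by eventually_elim (use neg in \<open>auto simp: indicator_def h0_def w_def\<close>)
  then show ?thesis
    using int borel_measurable_has_bochner_integral[OF int]
    by (subst (asm) has_bochner_integral_cong_AE[where g = "\<lambda>y. indicator {\<theta> * x<..} y * (h0 y * w y)"]) auto
next
  case False
  then have nn: "0 \<le> \<theta> * x" using \<theta> by simp
  have "(\<lambda>y. indicator {\<theta> * x<..} y * (h0 y * w y)) = (\<lambda>_. 0)"
    using nn by (auto simp: indicator_def h0_def)
  moreover have "h0 x = 0" using False by (simp add: h0_def)
  ultimately show ?thesis by (simp add: has_bochner_integral_zero)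
qed

text \<open>The negative \<open>y\<close> is reached exactly from the half-line below
  \<open>y / \<theta>\<close>, over which an exponential integrates to an exponential; it reproduces
  itself because \<open>c / \<theta> = c - 1\<close>.\<close>

lemma adjoint_eigen:
  assumes "y < 0"
  shows "(\<integral>\<^sup>+x. ennreal (indicator {\<theta> * x<..} y * (exp ((c - 1) * x) * w x)) \<partial>lborel) = ennreal (exp ((c - 1) * y))"
proof -
  have "(\<integral>\<^sup>+x. ennreal (indicator {\<theta> * x<..} y * (exp ((c - 1) * x) * w x)) \<partial>lborel)
      = (\<integral>\<^sup>+x. ennreal (indicator {..<y / \<theta>} x * (c * exp (c * x))) \<partial>lborel)"
  proof (intro nn_integral_cong arg_cong[where f = ennreal])
    fix x
    show "indicator {\<theta> * x<..} y * (exp ((c - 1) * x) * w x) = indicator {..<y / \<theta>} x * (c * exp (c * x))"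
    proof (cases "\<theta> * x < y")
      case True
      then have x: "x < y / \<theta>" using \<theta> by (simp add: field_simps)
      moreover have "y / \<theta> < 0" using assms \<theta> by (simp add: divide_neg_pos)
      ultimately have "x < 0" by linarith
      have "exp ((c - 1) * x) * exp x = exp (c * x)"
        by (simp only: exp_add[symmetric]) (simp add: algebra_simps)
      then show ?thesis using True x \<open>x < 0\<close> by (simp add: w_def mult.left_commute)
    next
      case False
      then have "\<not> x < y / \<theta>" using \<theta> by (simp add: field_simps)
      with False show ?thesis by simp
    qed
  qed
  also have "\<dots> = ennreal (exp (c * (y / \<theta>)))" by (rule nn_integral_exp_tail_neg[OF c_pos])
  also have "c * (y / \<theta>) = (c - 1) * y" unfolding c_step[symmetric] by simp
  finally show ?thesis .
qed

lemma exp_h0_integral_finite: "(\<integral>\<^sup>+x. ennreal (norm (exp (c * x) * h0 x)) \<partial>lborel) < \<infinity>"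
proof -
  obtain B where B: "\<And>y. y \<le> 0 \<Longrightarrow> \<bar>H y\<bar> \<le> B" "0 \<le> B" using H_bounded by blast
  have "(\<integral>\<^sup>+x. ennreal (norm (exp (c * x) * h0 x)) \<partial>lborel)
      \<le> (\<integral>\<^sup>+x. ennreal (B / c) * ennreal (indicator {..<0} x * (c * exp (c * x))) \<partial>lborel)"
  proof (rule nn_integral_mono)
    fix x
    have "norm (exp (c * x) * h0 x) \<le> B / c * (indicator {..<0} x * (c * exp (c * x)))"
      using B(1)[of x] c_pos by (auto simp: h0_def indicator_def abs_mult)
    then show "ennreal (norm (exp (c * x) * h0 x)) \<le> ennreal (B / c) * ennreal (indicator {..<0} x * (c * exp (c * x)))"
      using B(2) c_pos by (subst ennreal_mult[symmetric]) (auto intro: ennreal_leI)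
  qed
  also have "\<dots> = ennreal (B / c) * (\<integral>\<^sup>+x. ennreal (indicator {..<0} x * (c * exp (c * x))) \<partial>lborel)"
    by (rule nn_integral_cmult) measurable
  also have "\<dots> < \<infinity>"
    unfolding nn_integral_exp_tail_neg[OF c_pos] by (simp add: ennreal_mult_less_top)
  finally show ?thesis .
qed

text \<open>If there were a zero, there would be a leftmost one \<open>z0\<close>, since
  \<open>H\<close> tends to 1 at minus infinity. By the Perron-Frobenius step \<open>H\<close> would
  vanish almost everywhere between \<open>\<theta> * z0\<close> and 0; but
  \<open>\<theta> * z0 < z0\<close>, so zeros would occur to the left of \<open>z0\<close>.\<close>

lemma H_nonzero:
  assumes z: "z < 0" shows "H z \<noteq> 0"
proof
  assume "H z = 0"
  have "\<forall>\<^sub>F y in at_bot. 0 < H y" using H_lim by (rule order_tendstoD) simp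
  then obtain N where N: "\<And>y. y \<le> N \<Longrightarrow> 0 < H y" by (auto simp: eventually_at_bot_linorder)
  define S where "S = {x \<in> {N..z}. H x = 0}"
  have "N < z" using N[of z] \<open>H z = 0\<close> by (cases "z \<le> N") auto
  have "continuous_on {N..z} H" using z by (intro continuous_on_subset[OF H_cont]) auto
  then have "closed S" unfolding S_def by (intro continuous_closed_preimage_constant) auto
  moreover have "bounded S" unfolding S_def by (rule bounded_subset[of "{N..z}"]) auto
  ultimately have "compact S" by (simp add: compact_eq_bounded_closed)
  moreover have "z \<in> S" using \<open>N < z\<close> \<open>H z = 0\<close> by (simp add: S_def)
  ultimately obtain z0 where z0: "z0 \<in> S" "\<And>y. y \<in> S \<Longrightarrow> z0 \<le> y"
    using compact_attains_inf[of S] by blast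
  have left: "H y \<noteq> 0" if "y < z0" for y
  proof (cases "y \<le> N")
    case True then show ?thesis using N by fastforce
  next
    case False
    moreover have "y \<le> z" using that z0(1) by (simp add: S_def)
    ultimately show ?thesis using that z0(2)[of y] by (auto simp: S_def)
  qed
  have neg: "z0 < 0" "H z0 = 0" using z0(1) z by (auto simp: S_def)
  interpret P: eigen_pair h0 w "\<lambda>x. exp ((c - 1) * x)" \<theta>
  proof
    show "integral\<^sup>L lborel (\<lambda>y. indicator {\<theta> * x<..} y * (h0 y * w y)) = h0 x" for x
      using eigen[of x] by (simp add: has_bochner_integral_iff)
    show "(\<integral>\<^sup>+x. ennreal (indicator {\<theta> * x<..} y * (exp ((c - 1) * x) * w x)) \<partial>lborel) = ennreal (exp ((c - 1) * y))"
      if "w y \<noteq> 0" for y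
      using that by (intro adjoint_eigen) (auto simp: w_def indicator_def split: if_splits)
    have "w x * exp ((c - 1) * x) * \<bar>h0 x\<bar> = c * norm (exp (c * x) * h0 x)" for x
    proof (cases "x < 0")
      case True
      have "exp x * exp ((c - 1) * x) = exp (c * x)"
        by (simp only: exp_add[symmetric]) (simp add: algebra_simps)
      then show ?thesis using True by (simp add: w_def abs_mult)
    qed (simp add: h0_def)
    then show "(\<integral>\<^sup>+x. ennreal (w x * exp ((c - 1) * x) * \<bar>h0 x\<bar>) \<partial>lborel) < \<infinity>"
      using exp_h0_integral_finite c_pos
      by (simp only: ennreal_mult'[OF less_imp_le[OF c_pos]])
        (subst nn_integral_cmult, auto simp: ennreal_mult_less_top)
  qed (use w_nonneg in auto)
  have U: "AE x in lborel. x \<in> {..<0} \<longrightarrow> 0 < w x * exp ((c - 1) * x)"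
    using c_pos by (auto simp: w_def)
  have "continuous_on {..<0} H" by (rule continuous_on_subset[OF H_cont]) auto
  then have "isCont H z0"
    using neg by (simp add: continuous_on_eq_continuous_at)
  moreover have "\<forall>\<^sub>F x in nhds z0. x \<in> {..<0}" using neg by (intro eventually_nhds_in_open) auto
  then have "\<forall>\<^sub>F x in nhds z0. H x = h0 x" by eventually_elim (simp add: h0_def)
  ultimately have "isCont h0 z0" by (simp add: isCont_cong)
  then have "(h0 \<longlongrightarrow> h0 z0) (at z0 within {x. \<theta> * x < \<theta> * z0})"
    unfolding isCont_def by (rule tendsto_within_subset) auto
  from P.zero_propagates[OF _ _ _ U this]
  have zero: "AE y in lborel. \<theta> * z0 < y \<longrightarrow> h0 y * w y = 0"
    using neg \<theta> by (simp add: h0_def)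
  have lt: "\<theta> * z0 < z0" using neg \<theta> mult_strict_right_mono_neg[of 1 \<theta> z0] by simp
  from zero have "AE y in lborel. y \<notin> {\<theta> * z0<..<z0}"
  proof eventually_elim
    case (elim y)
    show ?case
    proof
      assume y: "y \<in> {\<theta> * z0<..<z0}"
      then have "h0 y * w y \<noteq> 0" using left[of y] neg c_pos by (simp add: h0_def w_def)
      with elim y show False by simp
    qed
  qed
  then show False using AE_meets_interval[OF lt] by simp
qed

lemma H_pos: "x < 0 \<Longrightarrow> 0 < H x"
  by (rule positive_if_nonzero[OF continuous_on_subset[OF H_cont] H_nonzero H_lim]) auto

lemma h0_nonneg: "0 \<le> h0 x"
  using H_pos[of x] by (auto simp: h0_def indicator_def less_imp_le)

lemma nn_eigen: "(\<integral>\<^sup>+y. ennreal (indicator {\<theta> * x<..} y * (h0 y * w y)) \<partial>lborel) = ennreal (h0 x)"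
  using eigen[of x] h0_nonneg w_nonneg
  by (subst nn_integral_eq_integral) (auto simp: has_bochner_integral_iff)

lemma lam_eq: "lam_ii \<theta> \<xi> = \<xi> / c" and lam_pos: "0 < lam_ii \<theta> \<xi>"
  using \<theta> \<xi> by (auto simp: lam_ii_def c_def field_simps)

definition "K0 = Re (q_exp \<theta> (of_real ((1 - \<xi>) / lam_ii \<theta> \<xi>)))"

lemma K0_pos: "0 < K0"
proof -
  let ?v = "(1 - \<xi>) / lam_ii \<theta> \<xi>"
  have "0 \<le> ?v" using \<xi> lam_pos by simp
  have "(\<lambda>n. complex_of_real (?v ^ n / q_fact \<theta> n)) sums q_exp \<theta> (of_real ?v)"
    using q_exp_series[of \<theta> "of_real ?v"] \<theta> by simp
  from sums_Re[OF this] have s: "(\<lambda>n. ?v ^ n / q_fact \<theta> n) sums K0" by (simp only: K0_def Re_complex_of_real)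
  have nn: "0 \<le> ?v ^ n / q_fact \<theta> n" for n
    using zero_le_power[OF \<open>0 \<le> ?v\<close>, of n] q_fact_pos[of \<theta> n] \<theta> by (intro divide_nonneg_pos) auto
  have "0 < (\<Sum>n. ?v ^ n / q_fact \<theta> n)"
    by (rule suminf_pos2[OF sums_summable[OF s] nn, of 0]) (simp add: q_fact_0)
  then show ?thesis using s by (simp add: sums_iff)
qed

lemma h_eq: "h_ii \<theta> \<xi> x = K0 * h0 x"
proof (cases "x \<le> 0")
  case True
  have z: "- \<xi> / lam_ii \<theta> \<xi> = - c" using \<xi> c_pos by (simp add: lam_eq)
  have "(\<lambda>n. complex_of_real ((- c) ^ n / q_fact \<theta> n * exp (\<theta> * q_int \<theta> n * x))) sums q_exp2 \<theta> (of_real (- c)) x"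
    using q_exp2_sums[OF \<theta> True, of "of_real (- c)"] by simp
  from sums_Re[OF this] have "(\<lambda>n. (- c) ^ n / q_fact \<theta> n * exp (\<theta> * q_int \<theta> n * x)) sums H x"
    by (simp only: H_def Re_complex_of_real)
  then have "(\<Sum>j. (- \<xi> / lam_ii \<theta> \<xi>) ^ j / q_fact \<theta> j * exp (\<theta> * (1 - \<theta> ^ j) / (1 - \<theta>) * x)) = H x"
    unfolding z by (simp add: sums_iff q_int_def)
  \<comment> \<open>\<open>h_ii\<close> uses the series also at 0, where \<open>h0\<close> is cut
    off; the values agree because \<open>H 0 = 0\<close>.\<close>
  moreover have "h0 x = H x" using True H_0 by (cases "x = 0") (auto simp: h0_def)
  ultimately show ?thesis using True by (simp add: h_ii_def K0_def)
qed (simp add: h_ii_def h0_def)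

sublocale K: pker_eigen "{..<0}" \<theta> \<xi> "lam_ii \<theta> \<xi>" "h_ii \<theta> \<xi>"
proof
  show "h_ii \<theta> \<xi> \<in> borel_measurable borel" unfolding h_eq[abs_def] by measurable
  show "0 < h_ii \<theta> \<xi> x" if "x \<in> {..<0}" for x
    using that K0_pos H_pos[of x] by (simp add: h_eq h0_def)
  fix x :: real assume x: "x \<in> {..<0}"
  have nn: "0 \<le> K0 * lam_ii \<theta> \<xi>" using K0_pos lam_pos by simp
  have "(\<integral>\<^sup>+y. ennreal (indicator {\<theta> * x<..} y * (h_ii \<theta> \<xi> y * phi \<xi> y)) * indicator {..<0} y \<partial>lborel)
      = (\<integral>\<^sup>+y. ennreal (K0 * lam_ii \<theta> \<xi>) * ennreal (indicator {\<theta> * x<..} y * (h0 y * w y)) \<partial>lborel)"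
  proof (rule nn_integral_cong)
    fix y
    have eq: "indicator {\<theta> * x<..} y * (h_ii \<theta> \<xi> y * phi \<xi> y) = (K0 * lam_ii \<theta> \<xi>) * (indicator {\<theta> * x<..} y * (h0 y * w y))"
      if "y < 0"
      using that c_pos by (simp add: h_eq phi_def w_def lam_eq)
    show "ennreal (indicator {\<theta> * x<..} y * (h_ii \<theta> \<xi> y * phi \<xi> y)) * indicator {..<0} y
        = ennreal (K0 * lam_ii \<theta> \<xi>) * ennreal (indicator {\<theta> * x<..} y * (h0 y * w y))"
    proof (cases "y < 0")
      case True
      then have "indicator {..<0} y = (1 :: ennreal)" by simp
      then show ?thesis unfolding ennreal_mult'[OF nn, symmetric] eq[OF True] by simp
    qed (simp add: h0_def)
  qed
  also have "\<dots> = ennreal (K0 * lam_ii \<theta> \<xi>) * (\<integral>\<^sup>+y. ennreal (indicator {\<theta> * x<..} y * (h0 y * w y)) \<partial>lborel)"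
    by (rule nn_integral_cmult) measurable
  also have "\<dots> = ennreal (lam_ii \<theta> \<xi> * h_ii \<theta> \<xi> x)"
    unfolding nn_eigen ennreal_mult'[OF nn, symmetric] by (simp add: h_eq mult_ac)
  finally show "(\<integral>\<^sup>+y. ennreal (indicator {\<theta> * x<..} y * (h_ii \<theta> \<xi> y * phi \<xi> y)) * indicator {..<0} y \<partial>lborel)
      = ennreal (lam_ii \<theta> \<xi> * h_ii \<theta> \<xi> x)" .
qed (use lam_pos \<xi> in auto)

definition "Z = integral\<^sup>L lborel (\<lambda>x. exp (c * x) * h0 x)"
text \<open>Up to normalisation the product of the adjoint eigenfunction
  \<open>exp ((c - 1) * x)\<close>, the eigenfunction \<open>h0\<close> and the weight
  \<open>exp x\<close>.\<close>

definition "f x = exp (c * x) * h0 x / Z"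

lemma exp_h0_integrable: "integrable lborel (\<lambda>x. exp (c * x) * h0 x)"
  by (rule integrableI_bounded[OF _ exp_h0_integral_finite]) measurable

lemma Z_pos: "0 < Z"
proof -
  have "\<not> (AE x in lborel. exp (c * x) * h0 x = 0)"
  proof
    assume "AE x in lborel. exp (c * x) * h0 x = 0"
    then have "AE x in lborel. x \<notin> {-1<..<0::real}"
      by eventually_elim (use H_pos in \<open>force simp: h0_def\<close>)
    then show False using AE_meets_interval[of "-1" 0] by simp
  qed
  then have "Z \<noteq> 0"
    unfolding Z_def using integral_nonneg_eq_0_iff_AE[OF exp_h0_integrable] h0_nonneg by auto
  moreover have "0 \<le> Z"
    unfolding Z_def using h0_nonneg by (intro Bochner_Integration.integral_nonneg) simp
  ultimately show ?thesis by simp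
qed

lemma f_measurable [measurable]: "f \<in> borel_measurable borel"
  unfolding f_def[abs_def] by measurable

lemma f_nonneg: "0 \<le> f x" using Z_pos h0_nonneg by (simp add: f_def)

lemma f_integral: "(\<integral>\<^sup>+x. ennreal (f x) \<partial>lborel) = 1"
proof -
  have "(\<integral>\<^sup>+x. ennreal (f x) \<partial>lborel) = ennreal (integral\<^sup>L lborel f)"
    using f_nonneg exp_h0_integrable by (intro nn_integral_eq_integral) (auto simp: f_def[abs_def])
  also have "integral\<^sup>L lborel f = 1"
    using Z_pos by (simp add: f_def[abs_def] Z_def[symmetric])
  finally show ?thesis by simp
qed

text \<open>Reversing time exchanges the roles of the two eigenfunctions: the original kernel fixes
  \<open>f\<close> by the adjoint equation, whereas the affine kernel fixes its reflection by the
  equation for \<open>h0\<close>.\<close>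

lemma reflected_invariant:
  "markov_density.invariant lborel (exp_kernel (1 / \<theta>)) (density lborel (\<lambda>s. ennreal (f (- s))))"
proof -
  have \<eta>: "1 / \<theta> < 1" using \<theta> by simp
  interpret X: markov_density lborel "exp_kernel (1 / \<theta>)" by (rule markov_density_exp_kernel[OF \<eta>])
  have rate: "1 / (1 - 1 / \<theta>) = c" using \<theta> by (simp add: c_def field_simps)
  have push: "X.push (\<lambda>s. ennreal (f (- s))) y = ennreal (f (- y))" for y
  proof -
    define C where "C = exp (- c * y) / Z"
    have C: "0 \<le> C" using Z_pos by (simp add: C_def)
    have "X.push (\<lambda>s. ennreal (f (- s))) y = (\<integral>\<^sup>+x. ennreal (f x) * exp_kernel (1 / \<theta>) (- x) y \<partial>lborel)"
    proof -
      have [measurable]: "(\<lambda>x. exp_kernel (1 / \<theta>) x y) \<in> borel_measurable borel"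
        using measurable_compose[OF measurable_Pair2'[of y borel borel] exp_kernel_measurable] by simp
      show ?thesis unfolding X.push_def by (subst nn_integral_real_affine[of _ "-1" 0]) auto
    qed
    also have "\<dots> = (\<integral>\<^sup>+x. ennreal C * ennreal (indicator {\<theta> * (- y)<..} x * (h0 x * w x)) \<partial>lborel)"
    proof (rule nn_integral_cong_AE)
      show "AE x in lborel. ennreal (f x) * exp_kernel (1 / \<theta>) (- x) y
          = ennreal C * ennreal (indicator {\<theta> * (- y)<..} x * (h0 x * w x))"
        using AE_lborel_singleton[of "\<theta> * (- y)"]
      proof eventually_elim
        case (elim x)
        have iff: "y + x / \<theta> < 0 \<longleftrightarrow> x < \<theta> * (- y)" using \<theta> by (simp add: field_simps) linarith
        have "f x * exponential_density c (y + x / \<theta>) = C * (indicator {\<theta> * (- y)<..} x * (h0 x * w x))"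
        proof (cases "\<theta> * (- y) < x \<and> x < 0")
          case True
          \<comment> \<open>Because \<open>c - c / \<theta> = 1\<close>, the dependence on
            \<open>x\<close> collapses to \<open>exp x\<close>, the weight in the equation for
            \<open>h0\<close>.\<close>
          have "c * x + - (y + x / \<theta>) * c = - c * y + (c - c * (1 / \<theta>)) * x"
            by (simp add: algebra_simps)
          also have "\<dots> = - c * y + x" unfolding c_step by simp
          finally have "exp (c * x) * exp (- (y + x / \<theta>) * c) = exp (- c * y) * exp x"
            by (simp only: exp_add[symmetric])
          moreover have "f x * exponential_density c (y + x / \<theta>) = (exp (c * x) * exp (- (y + x / \<theta>) * c)) * (h0 x * c / Z)"
            using True iff by (simp add: f_def exponential_density_def)
          ultimately show ?thesis using True by (simp add: C_def w_def mult_ac)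
        next
          case False
          then show ?thesis using elim iff
            by (auto simp: f_def h0_def exponential_density_def indicator_def)
        qed
        moreover have "0 \<le> exponential_density c (y + x / \<theta>)" by (rule exponential_density_nonneg[OF c_pos])
        ultimately show ?case
          unfolding exp_kernel_def rate using f_nonneg[of x] C
          by (simp add: ennreal_mult'[symmetric])
      qed
    qed
    also have "\<dots> = ennreal C * (\<integral>\<^sup>+x. ennreal (indicator {\<theta> * (- y)<..} x * (h0 x * w x)) \<partial>lborel)"
      by (rule nn_integral_cmult) measurable
    also have "\<dots> = ennreal (f (- y))"
      unfolding nn_eigen ennreal_mult'[OF C, symmetric] by (simp add: C_def f_def)
    finally show ?thesis .
  qed
  show ?thesis
  proof (rule X.invariant_densityI)
    show "(\<integral>\<^sup>+s. ennreal (f (- s)) \<partial>lborel) = 1"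
      using f_integral by (subst (asm) nn_integral_real_affine[of _ "-1" 0]) auto
  qed (use push in auto)
qed

lemma density_invariant: "K.invariant (density (restrict_space lborel {..<0}) (\<lambda>x. ennreal (f x)))"
proof (rule K.invariant_densityI)
  show "(\<lambda>x. ennreal (f x)) \<in> borel_measurable (restrict_space lborel {..<0})"
    by (intro measurable_restrict_space1) simp
  have "(\<integral>\<^sup>+x. ennreal (f x) \<partial>restrict_space lborel {..<0}) = (\<integral>\<^sup>+x. ennreal (f x) * indicator {..<0} x \<partial>lborel)"
    by (rule nn_integral_restrict_space) simp
  also have "\<dots> = (\<integral>\<^sup>+x. ennreal (f x) \<partial>lborel)"
    by (intro nn_integral_cong) (auto simp: f_def h0_def indicator_def)
  finally show "(\<integral>\<^sup>+x. ennreal (f x) \<partial>restrict_space lborel {..<0}) = 1" by (simp add: f_integral)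
  show "AE y in restrict_space lborel {..<0}. K.push (\<lambda>x. ennreal (f x)) y = ennreal (f y)"
  proof (rule AE_I2)
    fix y :: real assume "y \<in> space (restrict_space lborel {..<0})"
    then have y: "y < 0" by (simp add: space_restrict_space)
    define C where "C = H y * exp y / Z"
    have C: "0 \<le> C" using Z_pos H_pos[OF y] by (simp add: C_def)
    have "K.push (\<lambda>x. ennreal (f x)) y = (\<integral>\<^sup>+x. ennreal (f x) * K.k x y * indicator {..<0} x \<partial>lborel)"
      unfolding K.push_def by (rule nn_integral_restrict_space) simp
    also have "\<dots> = (\<integral>\<^sup>+x. ennreal C * ennreal (indicator {\<theta> * x<..} y * (exp ((c - 1) * x) * w x)) \<partial>lborel)"
    proof (rule nn_integral_cong)
      fix x
      show "ennreal (f x) * K.k x y * indicator {..<0} x = ennreal C * ennreal (indicator {\<theta> * x<..} y * (exp ((c - 1) * x) * w x))"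
      proof (cases "x < 0")
        case True
        have e: "exp ((c - 1) * x) * exp x = exp (c * x)"
          by (simp only: exp_add[symmetric]) (simp add: algebra_simps)
        have "f x * (indicator {\<theta> * x<..} y * (h_ii \<theta> \<xi> y / h_ii \<theta> \<xi> x) * (1 / lam_ii \<theta> \<xi>) * phi \<xi> y)
            = C * (indicator {\<theta> * x<..} y * (exp ((c - 1) * x) * w x))"
        proof -
          have 1: "h_ii \<theta> \<xi> y / h_ii \<theta> \<xi> x = H y / H x"
            using True y K0_pos by (simp add: h_eq h0_def)
          have 2: "1 / lam_ii \<theta> \<xi> * phi \<xi> y = c * exp y"
            using y \<xi> by (simp add: lam_eq phi_def)
          have 3: "exp ((c - 1) * x) * w x = c * exp (c * x)"
            using True e by (simp add: w_def mult.left_commute)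
          have "f x = exp (c * x) * H x / Z" using True by (simp add: f_def h0_def)
          moreover have "H x \<noteq> 0" using H_pos[OF True] by simp
          ultimately show ?thesis
            unfolding 1 3 mult.assoc[of _ "1 / lam_ii \<theta> \<xi>"] 2 by (simp add: C_def mult_ac)
        qed
        then show ?thesis
          unfolding K.k_def using True f_nonneg[of x] C by (simp add: ennreal_mult'[symmetric] del: ennreal_mult')
      qed (simp add: w_def)
    qed
    also have "\<dots> = ennreal C * (\<integral>\<^sup>+x. ennreal (indicator {\<theta> * x<..} y * (exp ((c - 1) * x) * w x)) \<partial>lborel)"
    proof -
      have i: "indicator {\<theta> * x<..} y = (indicator {..<y / \<theta>} x :: real)" for x
        using \<theta> by (auto simp: indicator_def field_simps)
      show ?thesis unfolding i by (rule nn_integral_cmult) measurable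
    qed
    also have "\<dots> = ennreal (f y)"
    proof -
      have "exp y * exp ((c - 1) * y) = exp (c * y)"
        by (simp only: exp_add[symmetric]) (simp add: algebra_simps)
      then have "C * exp ((c - 1) * y) = f y" using y by (simp add: C_def f_def h0_def mult_ac)
      then show ?thesis unfolding adjoint_eigen[OF y] ennreal_mult'[OF C, symmetric] by simp
    qed
    finally show "K.push (\<lambda>x. ennreal (f x)) y = ennreal (f y)" .
  qed
qed

text \<open>The law of the discounted sum is never computed: it and the reflected density are both
  invariant for the affine kernel, which has at most one invariant law.\<close>

lemma unique_invariant:
  fixes M :: "'a measure" and E :: "nat \<Rightarrow> 'a \<Rightarrow> real"
  assumes "prob_space M" and ind: "prob_space.indep_vars M (\<lambda>_. borel) E {1..}"
    and E: "\<And>k. k \<ge> 1 \<Longrightarrow> distributed M lborel (E k) (exponential_density 1)"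
  shows "unique_invariant_prob {..<0} (pker {..<0} \<theta> \<xi> (lam_ii \<theta> \<xi>) (h_ii \<theta> \<xi>))
    (law_on {..<0} M (\<lambda>\<omega>. - (1 - 1 / \<theta>) * (\<Sum>k. (1 / \<theta>) ^ k * E (k + 1) \<omega>)))"
proof -
  interpret prob_space M by fact
  let ?S = "\<lambda>\<omega>. (1 - 1 / \<theta>) * (\<Sum>k. (1 / \<theta>) ^ k * E (k + 1) \<omega>)"
  have \<eta>: "0 \<le> 1 / \<theta>" "1 / \<theta> < 1" using \<theta> by auto
  note S = discounted_sum_invariant[OF ind E \<eta>]
  have law: "distr M borel ?S = density lborel (\<lambda>s. ennreal (f (- s)))"
    by (rule exp_kernel_unique[OF \<eta>(2) S(3) reflected_invariant])
  have neg: "(\<lambda>\<omega>. - (1 - 1 / \<theta>) * (\<Sum>k. (1 / \<theta>) ^ k * E (k + 1) \<omega>)) = (\<lambda>\<omega>. - ?S \<omega>)"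
    by (simp only: mult_minus_left)
  have "law_on {..<0} M (\<lambda>\<omega>. - ?S \<omega>) = density (restrict_space lborel {..<0}) (\<lambda>x. ennreal (f x))"
  proof (rule measure_eqI)
    show "sets (law_on {..<0} M (\<lambda>\<omega>. - ?S \<omega>)) = sets (density (restrict_space lborel {..<0}) (\<lambda>x. ennreal (f x)))"
      by (simp add: law_on_def sets_restrict_space)
    fix B assume "B \<in> sets (law_on {..<0} M (\<lambda>\<omega>. - ?S \<omega>))"
    then have B: "B \<in> sets (restrict_space borel {..<0::real})"
      by (simp add: law_on_def sets_restrict_space)
    then have [measurable]: "B \<in> sets borel" and sub: "B \<subseteq> {..<0}"
      by (auto simp: sets_restrict_space_iff)
    have "emeasure (law_on {..<0} M (\<lambda>\<omega>. - ?S \<omega>)) B = emeasure (distr M borel (\<lambda>\<omega>. - ?S \<omega>)) B"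
      unfolding law_on_def by (rule emeasure_restrict_space) (use sub in auto)
    also have "distr M borel (\<lambda>\<omega>. - ?S \<omega>) = distr (distr M borel ?S) borel uminus"
      by (subst distr_distr[OF _ S(1)]) (simp_all add: o_def)
    also have "emeasure \<dots> B = (\<integral>\<^sup>+s. ennreal (f (- s)) * indicator (uminus -` B) s \<partial>lborel)"
    proof -
      have [measurable]: "uminus -` B \<in> sets (borel :: real measure)"
        using measurable_sets[of uminus "borel :: real measure" borel B] by simp
      show ?thesis unfolding law by (subst emeasure_distr) (simp_all add: emeasure_density)
    qed
    also have "\<dots> = (\<integral>\<^sup>+x. ennreal (f x) * indicator B x \<partial>lborel)"
      by (subst nn_integral_real_affine[of _ "-1" 0]) (auto intro!: nn_integral_cong simp: indicator_def)
    also have "\<dots> = (\<integral>\<^sup>+x. ennreal (f x) * indicator B x * indicator {..<0} x \<partial>lborel)"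
      using sub by (intro nn_integral_cong) (auto simp: indicator_def)
    also have "\<dots> = (\<integral>\<^sup>+x. ennreal (f x) * indicator B x \<partial>restrict_space lborel {..<0})"
      by (rule nn_integral_restrict_space[symmetric]) simp
    also have "\<dots> = emeasure (density (restrict_space lborel {..<0}) (\<lambda>x. ennreal (f x))) B"
      using B by (intro emeasure_density[symmetric] measurable_restrict_space1) (auto simp: sets_restrict_space)
    finally show "emeasure (law_on {..<0} M (\<lambda>\<omega>. - ?S \<omega>)) B = emeasure (density (restrict_space lborel {..<0}) (\<lambda>x. ennreal (f x))) B" .
  qed
  then have inv: "invariant_prob {..<0} (pker {..<0} \<theta> \<xi> (lam_ii \<theta> \<xi>) (h_ii \<theta> \<xi>)) (law_on {..<0} M (\<lambda>\<omega>. - ?S \<omega>))"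
    using density_invariant by (simp only: K.invariant_prob_iff)
  show ?thesis
    unfolding neg
  proof (rule K.unique_invariant_probI[OF _ _ _ _ _ inv])
    \<comment> \<open>The thresholds \<open>\<theta> * x\<close> come arbitrarily close to 0, so the
      common intervals must shrink to 0 from the left.\<close>
    show "incseq (\<lambda>n. - inverse (real (Suc n)))"
      by (auto simp: incseq_def intro!: le_imp_inverse_le)
    show "- inverse (real (Suc n)) < (\<lambda>_. 0) n" for n by simp
    show "\<exists>n. \<theta> * x \<le> - inverse (real (Suc n))" if "x \<in> {..<0}" for x
    proof -
      have "0 < - (\<theta> * x)" using that \<theta> by (simp add: mult_pos_neg)
      from reals_Archimedean[OF this] obtain n where "inverse (real (Suc n)) < - (\<theta> * x)" ..
      then show ?thesis by (intro exI[of _ n]) simp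
    qed
    show "0 < phi \<xi> y" if "y \<in> {- inverse (real (Suc n))<..<0}" for n y
      using that \<xi> by (simp add: phi_def)
  qed auto
qed

end

theorem theorem1p2:
  fixes M :: "'a measure" and E :: "nat \<Rightarrow> 'a \<Rightarrow> real" and \<theta> \<xi> :: real
  assumes "prob_space M"
    and "prob_space.indep_vars M (\<lambda>_. borel) E {1..}"
    and "\<And>k. k \<ge> 1 \<Longrightarrow> distributed M lborel (E k) (exponential_density 1)"
    and "\<theta> \<noteq> 1" and "0 \<le> \<xi>" and "\<xi> \<le> 1"
  shows
    "(0 < \<theta> \<and> \<theta> < 1 \<and> \<xi> < 1 \<longrightarrow>
        unique_invariant_prob UNIV (pker UNIV \<theta> \<xi> (lam_i \<theta> \<xi>) (h_i \<theta> \<xi>))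
          (law_on UNIV M (\<lambda>\<omega>. (1 - \<theta>) * (\<Sum>k. \<theta> ^ k * E (k + 1) \<omega>)))) \<and>
     (1 < \<theta> \<and> 0 < \<xi> \<longrightarrow>
        unique_invariant_prob {..<0} (pker {..<0} \<theta> \<xi> (lam_ii \<theta> \<xi>) (h_ii \<theta> \<xi>))
          (law_on {..<0} M (\<lambda>\<omega>. - (1 - 1 / \<theta>) * (\<Sum>k. (1 / \<theta>) ^ k * E (k + 1) \<omega>)))) \<and>
     (\<theta> < 0 \<and> 0 < \<xi> \<and> \<xi> < 1 \<longrightarrow>
        unique_invariant_prob UNIV (pker UNIV \<theta> \<xi> (lam_iii \<theta> \<xi>) (h_iii \<theta> \<xi>)) (pi_iii \<theta> \<xi>)) \<and>
     (\<theta> < 0 \<and> \<xi> = 0 \<longrightarrow>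
        unique_invariant_prob UNIV (pker UNIV \<theta> \<xi> 1 (h_iv \<theta>)) (law_on UNIV M (E 1))) \<and>
     (\<theta> = 0 \<and> \<xi> < 1 \<longrightarrow>
        unique_invariant_prob UNIV (pker UNIV \<theta> \<xi> (1 - \<xi>) (\<lambda>_. 1)) (law_on UNIV M (E 1)))"
proof (intro conjI impI)
  interpret prob_space M by fact
  show "unique_invariant_prob UNIV (pker UNIV \<theta> \<xi> (lam_i \<theta> \<xi>) (h_i \<theta> \<xi>))
      (law_on UNIV M (\<lambda>\<omega>. (1 - \<theta>) * (\<Sum>k. \<theta> ^ k * E (k + 1) \<omega>)))"
    if "0 < \<theta> \<and> \<theta> < 1 \<and> \<xi> < 1"
  proof -
    interpret contracting_parameter \<theta> \<xi> by unfold_locales (use that assms in auto)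
    show ?thesis
      using assms(2,3) that
      by (intro pker_eigen_unique_UNIV discounted_law_invariant_prob K.pker_eigen_axioms kernel_eq) auto
  qed
  show "unique_invariant_prob {..<0} (pker {..<0} \<theta> \<xi> (lam_ii \<theta> \<xi>) (h_ii \<theta> \<xi>))
      (law_on {..<0} M (\<lambda>\<omega>. - (1 - 1 / \<theta>) * (\<Sum>k. (1 / \<theta>) ^ k * E (k + 1) \<omega>)))"
    if "1 < \<theta> \<and> 0 < \<xi>"
    by (rule expanding_parameter.unique_invariant[OF _ assms(1-3)]) (use that assms in \<open>unfold_locales, auto\<close>)
  show "unique_invariant_prob UNIV (pker UNIV \<theta> \<xi> (lam_iii \<theta> \<xi>) (h_iii \<theta> \<xi>)) (pi_iii \<theta> \<xi>)"
    if "\<theta> < 0 \<and> 0 < \<xi> \<and> \<xi> < 1"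
    by (rule negative_parameter.unique_invariant) (use that in \<open>unfold_locales, auto\<close>)
  show "unique_invariant_prob UNIV (pker UNIV \<theta> \<xi> 1 (h_iv \<theta>)) (law_on UNIV M (E 1))"
    if "\<theta> < 0 \<and> \<xi> = 0"
    using unique_invariant_exponential(1)[OF assms(2,3)] that by simp
  show "unique_invariant_prob UNIV (pker UNIV \<theta> \<xi> (1 - \<xi>) (\<lambda>_. 1)) (law_on UNIV M (E 1))"
    if "\<theta> = 0 \<and> \<xi> < 1"
    using unique_invariant_exponential(2)[OF assms(2,3,5)] that by simp
qed

end
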